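(* Let $X$ be a finite $T_0$ topological space. If $F:X\multimap X$ is a Vietoris-like multivalued map and $\Lambda(F_* )\neq 0$, then there exists $x\in X$ with $x\in F(x)$.
   Context: A finite $T_0$ topological space is identified with a finite poset: $x\le y$ iff $U_x\subseteq U_y$, where $U_x$ is the intersection of all open sets containing $x$ (so the open sets are the lower sets); continuous maps are exactly the order-preserving maps. $H_*$ is singular homology with integer coefficients. A space is acyclic if its homology groups are isomorphic to those of a point. A continuous map $f:X\to Y$ between finite $T_0$ spaces is a Vietoris-like map if for every chain $y_1<\dots<y_n$ in $Y$ ($n\ge1$) the subspace $\bigcup_{i=1}^n f^{-1}(y_i)$ of $X$ is acyclic; such a map induces isomorphisms in all homology groups. A multivalued map $F:X\multimap Y$ assigns to each $x\in X$ a subset $F(x)\subseteq Y$ (no continuity is required). Its graph is $\Gamma(F)=\{(x,y)\in X\times Y : y\in F(x)\}$, a finite $T_0$ space with the order induced by the product order ($(x,y)\le(x',y')$ iff $x\le x'$ and $y\le y'$); $p:\Gamma(F)\to X$ and $q:\Gamma(F)\to Y$ are the projections. $F$ is a Vietoris-like multivalued map if $p$ is a Vietoris-like map; then $F_*:=q_*\circ p_*^{-1}:H_*(X)\to H_*(Y)$. For a degree-preserving endomorphism $\varphi$ of $H_*(X)$, $\Lambda(\varphi)=\sum_{i\ge0}(-1)^i\,\mathrm{tr}(\varphi_i)$, the trace being taken on the torsion-free part of $H_i(X)$. *)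

theory Defs
  imports "HOL-Analysis.Abstract_Topological_Spaces" "HOL-Homology.Homology"
begin

section \<open>Finite spaces and their order\<close>

definition finite_t0_space :: "'a topology \<Rightarrow> bool"
  where "finite_t0_space X \<longleftrightarrow> finite (topspace X) \<and> t0_space X"

text \<open>Meaningful for points of \<open>X\<close> only; outside of \<open>topspace X\<close> it is \<open>UNIV\<close>.\<close>

definition min_open :: "'a topology \<Rightarrow> 'a \<Rightarrow> 'a set"
  where "min_open X x = \<Inter> {U. openin X U \<and> x \<in> U}"

definition spec_le :: "'a topology \<Rightarrow> 'a \<Rightarrow> 'a \<Rightarrow> bool"
  where "spec_le X x y \<longleftrightarrow>
    x \<in> topspace X \<and> y \<in> topspace X \<and> min_open X x \<subseteq> min_open X y"

definition spec_less :: "'a topology \<Rightarrow> 'a \<Rightarrow> 'a \<Rightarrow> bool"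
  where "spec_less X x y \<longleftrightarrow> spec_le X x y \<and> x \<noteq> y"

text \<open>The order determines the topology, and it behaves as expected under subspaces of products.
  The latter is why the graph of a multivalued map can be given the subspace topology of the
  product topology below.\<close>

lemma openin_min_open:
  assumes "finite (topspace X)" "x \<in> topspace X"
  shows "openin X (min_open X x)"
proof -
  have "finite {U. openin X U \<and> x \<in> U}"
    by (rule finite_subset[of _ "Pow (topspace X)"]) (use assms openin_subset in auto)
  then show ?thesis
    unfolding min_open_def using assms(2) by (intro openin_Inter) auto
qed

lemma min_open_self: "x \<in> min_open X x"
  by (auto simp: min_open_def)

lemma min_open_least: "openin X U \<Longrightarrow> x \<in> U \<Longrightarrow> min_open X x \<subseteq> U"
  by (auto simp: min_open_def)

lemma min_open_eqI:
  assumes "openin X V" "x \<in> V" "\<And>U. openin X U \<Longrightarrow> x \<in> U \<Longrightarrow> V \<subseteq> U"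
  shows "min_open X x = V"
  using assms by (auto simp: min_open_def)

lemma openin_iff_lower_set:
  assumes "finite (topspace X)"
  shows "openin X U \<longleftrightarrow> U \<subseteq> topspace X \<and> (\<forall>y\<in>U. \<forall>x. spec_le X x y \<longrightarrow> x \<in> U)"
    (is "_ \<longleftrightarrow> ?R")
proof
  assume U: "openin X U"
  have "x \<in> U" if "y \<in> U" "spec_le X x y" for x y
    using min_open_least[OF U \<open>y \<in> U\<close>] that(2) min_open_self[of x X] by (auto simp: spec_le_def)
  then show ?R
    using openin_subset[OF U] by auto
next
  assume R: ?R
  have *: "openin X (min_open X y) \<and> min_open X y \<subseteq> U" if y: "y \<in> U" for y
  proof
    show o: "openin X (min_open X y)"
      using openin_min_open[OF assms] R y by auto
    show "min_open X y \<subseteq> U"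
    proof
      fix x assume x: "x \<in> min_open X y"
      have "x \<in> topspace X" "y \<in> topspace X"
        using openin_subset[OF o] x R y by auto
      then have "spec_le X x y"
        using min_open_least[OF o x] by (simp add: spec_le_def)
      then show "x \<in> U" using R y by simp
    qed
  qed
  have "U = \<Union> (min_open X ` U)"
    using * min_open_self[of _ X] by (intro subset_antisym subsetI) auto
  moreover have "openin X (\<Union> (min_open X ` U))"
    using * by (intro openin_Union) auto
  ultimately show "openin X U" by simp
qed

lemma min_open_subtopology_prod:
  assumes "finite (topspace X)" "finite (topspace Y)" "x \<in> topspace X" "y \<in> topspace Y"
    and "(x, y) \<in> S"
  shows "min_open (subtopology (prod_topology X Y) S) (x, y) = (min_open X x \<times> min_open Y y) \<inter> S"
proof (rule min_open_eqI)
  show "openin (subtopology (prod_topology X Y) S) (min_open X x \<times> min_open Y y \<inter> S)"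
    using openin_min_open[OF assms(1,3)] openin_min_open[OF assms(2,4)]
    by (intro openin_subtopology_Int) (simp add: openin_prod_Times_iff)
  show "(x, y) \<in> min_open X x \<times> min_open Y y \<inter> S"
    using assms by (simp add: min_open_self)
  fix U assume "openin (subtopology (prod_topology X Y) S) U" "(x, y) \<in> U"
  then obtain T where T: "openin (prod_topology X Y) T" "U = T \<inter> S" "(x, y) \<in> T"
    by (auto simp: openin_subtopology)
  then obtain A B where "openin X A" "x \<in> A" "openin Y B" "y \<in> B" and AB: "A \<times> B \<subseteq> T"
    unfolding openin_prod_topology_alt by metis
  then have "min_open X x \<subseteq> A" "min_open Y y \<subseteq> B"
    by (simp_all add: min_open_least)
  then show "min_open X x \<times> min_open Y y \<inter> S \<subseteq> U"
    using AB T(2) by blast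
qed

lemma spec_le_subtopology_prod:
  assumes "finite (topspace X)" "finite (topspace Y)"
  shows "spec_le (subtopology (prod_topology X Y) S) (x, y) (x', y') \<longleftrightarrow>
    (x, y) \<in> S \<and> (x', y') \<in> S \<and> spec_le X x x' \<and> spec_le Y y y'"
proof (cases "(x, y) \<in> S \<and> (x', y') \<in> S \<and> x \<in> topspace X \<and> x' \<in> topspace X \<and>
    y \<in> topspace Y \<and> y' \<in> topspace Y")
  case True
  have *: "min_open Z u \<subseteq> min_open Z v \<longleftrightarrow> u \<in> min_open Z v"
    if "finite (topspace Z)" "v \<in> topspace Z" for Z :: "'z topology" and u v
    using min_open_least[OF openin_min_open[OF that]] min_open_self by fast
  have f: "finite (topspace (subtopology (prod_topology X Y) S))"
    using assms by simp
  show ?thesis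
    using True assms
    by (simp add: spec_le_def * f) (simp add: min_open_subtopology_prod)
next
  case False
  then show ?thesis by (auto simp: spec_le_def)
qed

section \<open>Vietoris-like maps\<close>

definition acyclic_space :: "'a topology \<Rightarrow> bool"
  where "acyclic_space X \<longleftrightarrow>
    (\<forall>p. homology_group p X \<cong> homology_group p (discrete_topology {()}))"

definition vietoris_like_map :: "'a topology \<Rightarrow> 'b topology \<Rightarrow> ('a \<Rightarrow> 'b) \<Rightarrow> bool"
  where "vietoris_like_map X Y f \<longleftrightarrow> continuous_map X Y f \<and>
    (\<forall>ys. ys \<noteq> [] \<and> set ys \<subseteq> topspace Y \<and> sorted_wrt (spec_less Y) ys \<longrightarrow>
      acyclic_space (subtopology X (\<Union>y\<in>set ys. {x \<in> topspace X. f x = y})))"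

text \<open>A multivalued map is a set-valued function of which only the values on the
  points of the domain space matter.\<close>

definition multi_graph :: "'a topology \<Rightarrow> 'b topology \<Rightarrow> ('a \<Rightarrow> 'b set) \<Rightarrow> ('a \<times> 'b) topology"
  where "multi_graph X Y F =
    subtopology (prod_topology X Y) {(x, y). x \<in> topspace X \<and> y \<in> topspace Y \<and> y \<in> F x}"

definition vietoris_like_multimap :: "'a topology \<Rightarrow> 'b topology \<Rightarrow> ('a \<Rightarrow> 'b set) \<Rightarrow> bool"
  where "vietoris_like_multimap X Y F \<longleftrightarrow>
    (\<forall>x\<in>topspace X. F x \<subseteq> topspace Y) \<and> vietoris_like_map (multi_graph X Y F) X fst"

text \<open>For a Vietoris-like \<open>F\<close> the projection to \<open>X\<close> induces a bijection in homology, so that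
  \<open>inv_into\<close> is its inverse.\<close>

definition multi_induced ::
  "int \<Rightarrow> 'a topology \<Rightarrow> 'b topology \<Rightarrow> ('a \<Rightarrow> 'b set) \<Rightarrow> 'a chain set \<Rightarrow> 'b chain set"
  where "multi_induced p X Y F =
    hom_induced p (multi_graph X Y F) {} Y {} snd \<circ>
    inv_into (carrier (homology_group p (multi_graph X Y F)))
      (hom_induced p (multi_graph X Y F) {} X {} fst)"

section \<open>Traces and the Lefschetz number\<close>

definition int_comb :: "('g, 'm) monoid_scheme \<Rightarrow> 'g set \<Rightarrow> ('g \<Rightarrow> int) \<Rightarrow> 'g"
  where "int_comb G B c = finprod G (\<lambda>b. b [^]\<^bsub>G\<^esub> c b) B"

definition int_basis :: "('g, 'm) monoid_scheme \<Rightarrow> 'g set \<Rightarrow> bool"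
  where "int_basis G B \<longleftrightarrow> finite B \<and> B \<subseteq> carrier G \<and>
    (\<forall>x\<in>carrier G. \<exists>!c. c \<in> B \<rightarrow>\<^sub>E UNIV \<and> x = int_comb G B c)"

definition int_coords :: "('g, 'm) monoid_scheme \<Rightarrow> 'g set \<Rightarrow> 'g \<Rightarrow> 'g \<Rightarrow> int"
  where "int_coords G B x = (THE c. c \<in> B \<rightarrow>\<^sub>E UNIV \<and> x = int_comb G B c)"

definition trace_wrt :: "('g, 'm) monoid_scheme \<Rightarrow> 'g set \<Rightarrow> ('g \<Rightarrow> 'g) \<Rightarrow> int"
  where "trace_wrt G B \<phi> = (\<Sum>b\<in>B. int_coords G B (\<phi> b) b)"

text \<open>The trace of an endomorphism of a finitely generated free abelian group. It does not depend
  on the chosen basis, by the lemma \<open>free_trace_eq\<close> below.\<close>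

definition free_trace :: "('g, 'm) monoid_scheme \<Rightarrow> ('g \<Rightarrow> 'g) \<Rightarrow> int"
  where "free_trace G \<phi> = trace_wrt G (SOME B. int_basis G B) \<phi>"

definition torsion_part :: "('g, 'm) monoid_scheme \<Rightarrow> 'g set"
  where "torsion_part G = {x \<in> carrier G. \<exists>n::nat. n > 0 \<and> x [^]\<^bsub>G\<^esub> n = \<one>\<^bsub>G\<^esub>}"

text \<open>The endomorphism of the quotient by the torsion subgroup: the coset of \<open>x\<close> goes to the coset
  of \<open>\<phi> x\<close>, see the lemma \<open>torsion_free_map_coset\<close> below.\<close>

definition torsion_free_map :: "('g, 'm) monoid_scheme \<Rightarrow> ('g \<Rightarrow> 'g) \<Rightarrow> 'g set \<Rightarrow> 'g set"
  where "torsion_free_map G \<phi> C = torsion_part G <#>\<^bsub>G\<^esub> (\<phi> ` C)"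

definition torsion_free_trace :: "('g, 'm) monoid_scheme \<Rightarrow> ('g \<Rightarrow> 'g) \<Rightarrow> int"
  where "torsion_free_trace G \<phi> = free_trace (G Mod torsion_part G) (torsion_free_map G \<phi>)"

text \<open>A graded endomorphism of the homology of \<open>X\<close> is given by its components. The sum
  is a finite one for finite \<open>X\<close>, whose homology vanishes in high degrees; \<open>Sum_any\<close> sums over the
  indices of nonzero terms.\<close>

definition Lefschetz_number :: "'a topology \<Rightarrow> (nat \<Rightarrow> 'a chain set \<Rightarrow> 'a chain set) \<Rightarrow> int"
  where "Lefschetz_number X \<phi> =
    Sum_any (\<lambda>i. (- 1) ^ i * torsion_free_trace (homology_group (int i) X) (\<phi> i))"

lemma (in comm_group) subgroup_torsion_part: "subgroup (torsion_part G) G"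
proof
  show "torsion_part G \<subseteq> carrier G" by (auto simp: torsion_part_def)
  show "\<one> \<in> torsion_part G" by (auto simp: torsion_part_def intro: exI[of _ 1])
  fix x assume "x \<in> torsion_part G"
  then obtain n :: nat where x: "x \<in> carrier G" "n > 0" "x [^] n = \<one>"
    by (auto simp: torsion_part_def)
  show "inv x \<in> torsion_part G"
    using x by (auto simp: torsion_part_def nat_pow_inv intro!: exI[of _ n])
  fix y assume "y \<in> torsion_part G"
  then obtain m :: nat where y: "y \<in> carrier G" "m > 0" "y [^] m = \<one>"
    by (auto simp: torsion_part_def)
  have "(x \<otimes> y) [^] (n * m) = (x [^] n) [^] m \<otimes> (y [^] m) [^] n"
    using x(1) y(1) by (simp add: nat_pow_distrib nat_pow_pow mult.commute)
  then have "(x \<otimes> y) [^] (n * m) = \<one>"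
    using x y by simp
  then show "x \<otimes> y \<in> torsion_part G"
    using x(1,2) y(1,2) by (auto simp: torsion_part_def intro!: exI[of _ "n * m"])
qed

lemma (in comm_group) torsion_free_map_coset:
  assumes \<phi>: "\<phi> \<in> hom G G" and x: "x \<in> carrier G"
  shows "torsion_free_map G \<phi> (torsion_part G #> x) = torsion_part G #> \<phi> x"
proof -
  have \<phi>c: "\<phi> u \<in> carrier G" if "u \<in> carrier G" for u
    using \<phi> that by (auto simp: hom_def)
  note T = subgroup_torsion_part
  have Tc: "u \<in> carrier G" if "u \<in> torsion_part G" for u
    using that by (simp add: torsion_part_def)
  have t: "\<phi> t \<in> torsion_part G" if tT: "t \<in> torsion_part G" for t
  proof -
    obtain n :: nat where n: "t \<in> carrier G" "n > 0" "t [^] n = \<one>"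
      using tT by (auto simp: torsion_part_def)
    then have "\<phi> t [^] n = \<one>"
      using hom_nat_pow[OF \<phi> n(1) is_group is_group, of n] hom_one[OF \<phi> is_group is_group] by simp
    then show ?thesis
      using n \<phi>c by (auto simp: torsion_part_def)
  qed
  show ?thesis
  proof (intro subset_antisym subsetI)
    fix z assume "z \<in> torsion_free_map G \<phi> (torsion_part G #> x)"
    then obtain s u where su: "s \<in> torsion_part G" "u \<in> torsion_part G" "z = s \<otimes> \<phi> (u \<otimes> x)"
      by (auto simp: torsion_free_map_def set_mult_def r_coset_def)
    then have "z = (s \<otimes> \<phi> u) \<otimes> \<phi> x"
      using t[of u] x \<phi>c Tc hom_mult[OF \<phi>, of u x] by (simp add: m_assoc)
    then show "z \<in> torsion_part G #> \<phi> x"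
      using su t subgroup.m_closed[OF T] by (auto simp: r_coset_def)
  next
    fix z assume "z \<in> torsion_part G #> \<phi> x"
    then obtain s where s: "s \<in> torsion_part G" "z = s \<otimes> \<phi> x"
      by (auto simp: r_coset_def)
    have "x \<in> torsion_part G #> x"
      using x subgroup.one_closed[OF T] l_one[OF x, symmetric] unfolding r_coset_def by blast
    then show "z \<in> torsion_free_map G \<phi> (torsion_part G #> x)"
      using s unfolding torsion_free_map_def set_mult_def by blast
  qed
qed

lemma int_coords:
  assumes "int_basis G B" "x \<in> carrier G"
  shows "int_coords G B x \<in> B \<rightarrow>\<^sub>E UNIV" "int_comb G B (int_coords G B x) = x"
proof -
  have "\<exists>!c. c \<in> B \<rightarrow>\<^sub>E UNIV \<and> x = int_comb G B c"
    using assms by (auto simp: int_basis_def)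
  from theI'[OF this] show "int_coords G B x \<in> B \<rightarrow>\<^sub>E UNIV" "int_comb G B (int_coords G B x) = x"
    unfolding int_coords_def by auto
qed

lemma (in comm_group) int_comb_closed:
  "B \<subseteq> carrier G \<Longrightarrow> int_comb G B c \<in> carrier G"
  unfolding int_comb_def by (intro finprod_closed) auto

lemma (in comm_group) int_coords_int_comb:
  assumes B: "int_basis G B" and b: "b \<in> B"
  shows "int_coords G B (int_comb G B c) b = c b"
proof -
  have sub: "B \<subseteq> carrier G" using B by (simp add: int_basis_def)
  have eq: "int_comb G B c = int_comb G B (restrict c B)"
    unfolding int_comb_def using sub by (intro finprod_cong') auto
  have "\<exists>!d. d \<in> B \<rightarrow>\<^sub>E UNIV \<and> int_comb G B c = int_comb G B d"
    using B int_comb_closed[OF sub] by (auto simp: int_basis_def)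
  then have "int_coords G B (int_comb G B c) = restrict c B"
    using eq unfolding int_coords_def by (intro the1_equality) auto
  then show ?thesis using b by simp
qed

lemma (in comm_group) int_coords_mult:
  assumes B: "int_basis G B" and "b \<in> B" and xy: "x \<in> carrier G" "y \<in> carrier G"
  shows "int_coords G B (x \<otimes> y) b = int_coords G B x b + int_coords G B y b"
proof -
  have sub: "B \<subseteq> carrier G" using B by (simp add: int_basis_def)
  have "int_comb G B (\<lambda>b. int_coords G B x b + int_coords G B y b) =
      finprod G (\<lambda>b. b [^] int_coords G B x b \<otimes> b [^] int_coords G B y b) B"
    unfolding int_comb_def using sub by (intro finprod_cong') (auto simp: int_pow_mult)
  also have "\<dots> = int_comb G B (int_coords G B x) \<otimes> int_comb G B (int_coords G B y)"
    unfolding int_comb_def using sub by (intro finprod_multf) auto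
  also have "\<dots> = x \<otimes> y" using int_coords(2)[OF B] xy by simp
  finally show ?thesis
    using int_coords_int_comb[OF B \<open>b \<in> B\<close>] by metis
qed

lemma (in comm_group) additive_int_comb:
  fixes h :: "'a \<Rightarrow> int"
  assumes h: "\<And>x y. x \<in> carrier G \<Longrightarrow> y \<in> carrier G \<Longrightarrow> h (x \<otimes> y) = h x + h y"
    and B: "finite B" "B \<subseteq> carrier G"
  shows "h (int_comb G B c) = (\<Sum>b\<in>B. c b * h b)"
proof -
  have "h \<in> hom G integer_group"
    using h by (auto simp: hom_def integer_group_def)
  then interpret h: group_hom G integer_group h
    by (intro group_hom.intro group_hom_axioms.intro group_integer_group is_group)
  have pow: "h (x [^] n) = n * h x" if "x \<in> carrier G" for x and n :: int
    using h.hom_int_pow[OF that, of n] by (simp add: mult.commute)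
  have one: "h \<one> = 0" using h.hom_one by (simp add: integer_group_def)
  have "h (finprod G (\<lambda>b. b [^] c b) B) = (\<Sum>b\<in>B. h (b [^] c b))"
    using B
  proof (induction B rule: finite_induct)
    case (insert b B)
    have "finprod G (\<lambda>b. b [^] c b) B \<in> carrier G"
      using insert.prems by (intro finprod_closed) auto
    moreover have "finprod G (\<lambda>b. b [^] c b) (insert b B) = b [^] c b \<otimes> finprod G (\<lambda>b. b [^] c b) B"
      using insert by (intro finprod_insert) auto
    ultimately show ?case using insert h by simp
  qed (simp add: one)
  then show ?thesis
    unfolding int_comb_def using pow B by (auto intro: sum.cong)
qed

lemma (in comm_group) trace_wrt_cong_basis:
  assumes \<phi>: "\<phi> \<in> hom G G" and A: "int_basis G A" and B: "int_basis G B"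
  shows "trace_wrt G A \<phi> = trace_wrt G B \<phi>"
proof -
  have fin: "finite A" "finite B" "A \<subseteq> carrier G" "B \<subseteq> carrier G"
    using A B by (auto simp: int_basis_def)
  have \<phi>c: "\<phi> x \<in> carrier G" if "x \<in> carrier G" for x
    using \<phi> that by (auto simp: hom_def)
  have exp: "h x = (\<Sum>b\<in>C. int_coords G C x b * h b)"
    if "int_basis G C" "x \<in> carrier G"
      "\<And>x y. x \<in> carrier G \<Longrightarrow> y \<in> carrier G \<Longrightarrow> h (x \<otimes> y) = h x + h y" for h :: "'a \<Rightarrow> int" and C x
    using additive_int_comb[of h C "int_coords G C x", OF that(3)] that(1) int_coords(2)[OF that(1,2)]
    by (simp add: int_basis_def)
  have "trace_wrt G A \<phi> = (\<Sum>a\<in>A. \<Sum>b\<in>B. int_coords G B a b * int_coords G A (\<phi> b) a)"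
    unfolding trace_wrt_def
  proof (rule sum.cong[OF refl])
    fix a assume a: "a \<in> A"
    show "int_coords G A (\<phi> a) a = (\<Sum>b\<in>B. int_coords G B a b * int_coords G A (\<phi> b) a)"
      by (rule exp[where h = "\<lambda>x. int_coords G A (\<phi> x) a", OF B])
        (use a fin in \<open>auto simp: hom_mult[OF \<phi>] int_coords_mult[OF A] \<phi>c\<close>)
  qed
  also have "\<dots> = (\<Sum>b\<in>B. \<Sum>a\<in>A. int_coords G A (\<phi> b) a * int_coords G B a b)"
    by (subst sum.swap) (simp add: mult.commute)
  also have "\<dots> = trace_wrt G B \<phi>"
    unfolding trace_wrt_def
  proof (rule sum.cong[OF refl])
    fix b assume b: "b \<in> B"
    show "(\<Sum>a\<in>A. int_coords G A (\<phi> b) a * int_coords G B a b) = int_coords G B (\<phi> b) b"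
      by (rule exp[where h = "\<lambda>x. int_coords G B x b", OF A, symmetric])
        (use b fin in \<open>auto simp: int_coords_mult[OF B] \<phi>c\<close>)
  qed
  finally show ?thesis .
qed

lemma (in comm_group) free_trace_eq:
  assumes "\<phi> \<in> hom G G" "int_basis G B"
  shows "free_trace G \<phi> = trace_wrt G B \<phi>"
  unfolding free_trace_def
  by (rule trace_wrt_cong_basis[OF assms(1) someI[of "int_basis G", OF assms(2)] assms(2)])

end

theory Submission
  imports Defs
begin

text \<open>
  Why the theorem holds. Suppose first that \<open>F\<^sub>*\<close> were induced by an endomorphism \<open>\<phi>\<close> of the chain
  complex of the order complex of \<open>X\<close>, whose simplices are the chains \<open>x\<^sub>0 < \<dots> < x\<^sub>p\<close>. By the Hopf trace
  formula \<open>\<Lambda>(F\<^sub>*)\<close> is then the alternating sum of the traces of \<open>\<phi>\<close> on the chain groups, and it is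
  enough to choose \<open>\<phi>\<close> in such a way that no simplex \<open>s\<close> occurs in \<open>\<phi> s\<close> unless \<open>F\<close> has a fixed point.

  Such a \<open>\<phi>\<close> exists because the acyclic preimages in the definition of Vietoris-like maps are
  exactly an acyclic carrier from \<open>X\<close> to the graph \<open>\<Gamma>\<close> of \<open>F\<close>: the simplex \<open>s\<close> goes to \<open>p\<inverse>(s)\<close>. Let \<open>l\<close> be
  a chain map carried in this way. A second chain map \<open>m\<close>, from \<open>\<Gamma>\<close> to \<open>X\<close>, is carried by
  \<open>t \<mapsto> q(t)\<close>; these carriers are acyclic since the image of a chain is a chain. Put \<open>\<phi> = m \<circ> l\<close>. As any two
  chain maps with the same acyclic carrier are homotopic, \<open>m\<close> induces \<open>q\<^sub>*\<close> and \<open>l\<close> induces the inverse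
  of \<open>p\<^sub>*\<close> (\<open>multi_induced_order_cycle\<close>). If \<open>s\<close> occurs in \<open>\<phi> s\<close>, there is a chain \<open>t\<close> in \<open>\<Gamma>\<close> with
  \<open>p(t) \<subseteq> s \<subseteq> q(t)\<close>. Choosing for every \<open>y\<close> in \<open>s\<close> a point \<open>(x, y)\<close> of \<open>t\<close> gives a monotone self-map
  \<open>y \<mapsto> x\<close> of the finite chain \<open>s\<close>; it has a fixed point, and this is a fixed point of \<open>F\<close>
  (\<open>graph_simplex_fixed_point\<close>).

  Carriers are acyclic in singular homology, whereas \<open>l\<close> and \<open>m\<close> live on order complexes. The bridge
  is McCord's theorem in the form \<open>singular_chain_homologous_order_chain\<close>. A chain
  \<open>x\<^sub>0 < \<dots> < x\<^sub>p\<close> determines a singular simplex of the finite space, so the chains of the order complex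
  are a subcomplex of the singular chains; the quotient complex is shown to be acyclic by induction on
  the number of points, with a Mayer-Vietoris argument for the open cover of \<open>X\<close> by the complement of a
  maximal point and the minimal open neighbourhood of that point.

  The Hopf trace formula is proved over the integers. The homology in one degree is compared with the
  chain group by means of generalized inverses of the boundary maps (\<open>homology_trace\<close>), and the
  correction terms of neighbouring degrees cancel in the alternating sum.
\<close>

section \<open>The order of a finite space\<close>

lemma spec_le_iff:
  assumes "finite (topspace X)"
  shows "spec_le X x y \<longleftrightarrow> y \<in> topspace X \<and> x \<in> min_open X y"
proof -
  have "min_open X x \<subseteq> min_open X y" if "y \<in> topspace X" "x \<in> min_open X y"
    using min_open_least[OF openin_min_open[OF assms that(1)] that(2)] .
  moreover have "x \<in> topspace X" if "y \<in> topspace X" "x \<in> min_open X y"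
    using openin_subset[OF openin_min_open[OF assms that(1)]] that(2) by auto
  ultimately show ?thesis
    using min_open_self[of x X] unfolding spec_le_def by blast
qed

lemma spec_le_refl: "x \<in> topspace X \<Longrightarrow> spec_le X x x"
  by (simp add: spec_le_def)

lemma spec_le_trans: "spec_le X x y \<Longrightarrow> spec_le X y z \<Longrightarrow> spec_le X x z"
  by (auto simp: spec_le_def)

lemma spec_le_antisym:
  assumes "finite_t0_space X" "spec_le X x y" "spec_le X y x"
  shows "x = y"
proof (rule ccontr)
  assume "x \<noteq> y"
  with assms obtain U where "openin X U" "(x \<in> U) \<noteq> (y \<in> U)"
    unfolding finite_t0_space_def t0_space_def spec_le_def by blast
  then show False
    using assms min_open_least[of X U] min_open_self[of x X] min_open_self[of y X]
    unfolding spec_le_def by blast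
qed

lemma spec_less_trans:
  assumes "finite_t0_space X" "spec_less X x y" "spec_less X y z"
  shows "spec_less X x z"
  using assms spec_le_trans[of X x y z] spec_le_antisym[OF assms(1), of x y]
  by (auto simp: spec_less_def)

lemma min_open_subtopology:
  assumes "finite (topspace X)" "y \<in> topspace X" "y \<in> Q"
  shows "min_open (subtopology X Q) y = min_open X y \<inter> Q"
proof (rule min_open_eqI)
  show "openin (subtopology X Q) (min_open X y \<inter> Q)"
    using openin_min_open[OF assms(1,2)] by (auto simp: openin_subtopology)
qed (use assms in \<open>auto simp: openin_subtopology min_open_self dest: min_open_least\<close>)

lemma spec_le_subtopology:
  assumes "finite (topspace X)"
  shows "spec_le (subtopology X Q) x y \<longleftrightarrow> x \<in> Q \<and> y \<in> Q \<and> spec_le X x y"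
  using assms spec_le_iff[of "subtopology X Q" x y] spec_le_iff[OF assms, of x y]
    min_open_subtopology[OF assms, of y Q] by auto

lemma finite_t0_space_subtopology: "finite_t0_space X \<Longrightarrow> finite_t0_space (subtopology X Q)"
  by (simp add: finite_t0_space_def t0_space_subtopology)

lemma exists_maximal_point:
  assumes X: "finite_t0_space X" and ne: "topspace X \<noteq> {}"
  obtains x where "x \<in> topspace X" "\<And>y. spec_le X x y \<Longrightarrow> y = x"
proof -
  have "finite (topspace X)"
    using X by (simp add: finite_t0_space_def)
  moreover have "asymp_on (topspace X) (spec_less X)"
    using spec_le_antisym[OF X] by (auto simp: spec_less_def asymp_on_def)
  moreover have "transp_on (topspace X) (spec_less X)"
    using spec_less_trans[OF X] by (auto simp: transp_on_def)
  ultimately obtain x where "x \<in> topspace X" "\<forall>y\<in>topspace X. y \<noteq> x \<longrightarrow> \<not> spec_less X x y"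
    using Finite_Set.bex_max_element[of "topspace X" "spec_less X"] ne by auto
  then show ?thesis
    by (intro that[of x]) (auto simp: spec_less_def spec_le_def)
qed

section \<open>Order simplices\<close>

definition strict_chain :: "'a topology \<Rightarrow> nat \<Rightarrow> (nat \<Rightarrow> 'a) \<Rightarrow> bool"
  where "strict_chain X p v \<longleftrightarrow>
    v ` {..p} \<subseteq> topspace X \<and> (\<forall>i j. i < j \<longrightarrow> j \<le> p \<longrightarrow> spec_less X (v i) (v j))"

text \<open>The simplex sends a point with barycentric coordinates \<open>t\<close> to the smallest vertex whose
  coordinate is nonzero. The smallest one, because open sets are lower sets: the points that land
  below a given vertex are then those for which one of finitely many coordinates is nonzero, an
  open condition.\<close>

definition order_simplex :: "nat \<Rightarrow> (nat \<Rightarrow> 'a) \<Rightarrow> (nat \<Rightarrow> real) \<Rightarrow> 'a"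
  where "order_simplex p v = restrict (\<lambda>t. v (LEAST i. t i \<noteq> 0)) (standard_simplex p)"

definition order_simplices :: "nat \<Rightarrow> 'a topology \<Rightarrow> ((nat \<Rightarrow> real) \<Rightarrow> 'a) set"
  where "order_simplices p X = {order_simplex p v | v. strict_chain X p v}"

text \<open>A subcomplex of the singular chains, so that no comparison map is needed. Since only strictly
  increasing sequences of vertices are admitted, it is finitely generated, and zero in high degrees.\<close>

definition order_chain :: "nat \<Rightarrow> 'a topology \<Rightarrow> 'a chain \<Rightarrow> bool"
  where "order_chain p X c \<longleftrightarrow> Poly_Mapping.keys c \<subseteq> order_simplices p X"

lemma standard_simplex_Least:
  assumes "t \<in> standard_simplex p"
  shows "t (LEAST i. t i \<noteq> 0) \<noteq> 0" "(LEAST i. t i \<noteq> 0) \<le> p"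
proof -
  have "\<exists>i\<le>p. t i \<noteq> 0"
  proof (rule ccontr)
    assume "\<not> ?thesis"
    then have "(\<Sum>i\<le>p. t i) = 0" by simp
    then show False using assms by (simp add: standard_simplex_def)
  qed
  then obtain i where i: "i \<le> p" "t i \<noteq> 0"
    by blast
  show "t (LEAST i. t i \<noteq> 0) \<noteq> 0"
    by (rule LeastI[of "\<lambda>i. t i \<noteq> 0", OF i(2)])
  show "(LEAST i. t i \<noteq> 0) \<le> p"
    using Least_le[of "\<lambda>i. t i \<noteq> 0", OF i(2)] i(1) by simp
qed

lemma Least_basis: "(LEAST j::nat. (if j = i then 1 else (0::real)) \<noteq> 0) = i"
  by (rule Least_equality) (auto split: if_splits)

lemma order_simplex_basis:
  "i \<le> p \<Longrightarrow> order_simplex p v (\<lambda>j. if j = i then 1 else 0) = v i"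
  using Least_basis[of i] by (simp add: order_simplex_def)

lemma image_order_simplex: "order_simplex p v ` standard_simplex p = v ` {..p}"
proof
  show "order_simplex p v ` standard_simplex p \<subseteq> v ` {..p}"
    using standard_simplex_Least(2) by (auto simp: order_simplex_def)
  show "v ` {..p} \<subseteq> order_simplex p v ` standard_simplex p"
  proof
    fix y assume "y \<in> v ` {..p}"
    then obtain i where "i \<le> p" "y = v i" by auto
    then show "y \<in> order_simplex p v ` standard_simplex p"
      by (intro image_eqI[of _ _ "\<lambda>j. if j = i then 1 else 0"]) (simp_all add: order_simplex_basis)
  qed
qed

lemma order_simplex_cong:
  assumes "\<And>i. i \<le> p \<Longrightarrow> v i = w i"
  shows "order_simplex p v = order_simplex p w"
  using assms standard_simplex_Least(2) by (auto simp: order_simplex_def fun_eq_iff)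

lemma singular_simplex_order_simplex:
  assumes fin: "finite (topspace X)" and v: "strict_chain X p v"
  shows "singular_simplex p X (order_simplex p v)"
proof -
  let ?T = "subtopology (powertop_real UNIV) (standard_simplex p)"
  have le: "spec_le X (v i) (v j)" if "i \<le> j" "j \<le> p" for i j
    using v that spec_le_refl[of "v j" X]
    by (cases "i = j") (auto simp: strict_chain_def spec_less_def image_subset_iff)
  have "continuous_map ?T X (order_simplex p v)"
    unfolding continuous_map_def
  proof (intro conjI allI impI)
    show "order_simplex p v \<in> topspace ?T \<rightarrow> topspace X"
      using v image_order_simplex[of p v] by (auto simp: strict_chain_def)
    fix U assume U: "openin X U"
    have "{t \<in> topspace ?T. order_simplex p v t \<in> U} =
        (\<Union>i\<in>{i. i \<le> p \<and> v i \<in> U}. {t \<in> topspace ?T. t i \<in> - {0}})"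
    proof (intro subset_antisym subsetI)
      fix t assume "t \<in> {t \<in> topspace ?T. order_simplex p v t \<in> U}"
      then show "t \<in> (\<Union>i\<in>{i. i \<le> p \<and> v i \<in> U}. {t \<in> topspace ?T. t i \<in> - {0}})"
        using standard_simplex_Least[of t p] by (auto simp: order_simplex_def)
    next
      fix t assume "t \<in> (\<Union>i\<in>{i. i \<le> p \<and> v i \<in> U}. {t \<in> topspace ?T. t i \<in> - {0}})"
      then obtain i where i: "i \<le> p" "v i \<in> U" "t \<in> topspace ?T" "t i \<noteq> 0" by auto
      then have "spec_le X (v (LEAST i. t i \<noteq> 0)) (v i)"
        using Least_le[of "\<lambda>i. t i \<noteq> 0"] by (intro le) auto
      then have "v (LEAST i. t i \<noteq> 0) \<in> U"
        using U i(2) openin_iff_lower_set[OF fin] by blast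
      then show "t \<in> {t \<in> topspace ?T. order_simplex p v t \<in> U}"
        using i(3) by (auto simp: order_simplex_def)
    qed
    moreover have "openin ?T {t \<in> topspace ?T. t i \<in> - {0}}" for i
    proof (rule openin_continuous_map_preimage)
      show "continuous_map ?T euclideanreal (\<lambda>t. t i)"
        by (intro continuous_map_from_subtopology continuous_map_product_projection) simp
    qed auto
    ultimately show "openin ?T {t \<in> topspace ?T. order_simplex p v t \<in> U}"
      by (simp only:) (intro openin_Union ballI, elim imageE, simp only:)
  qed
  then show ?thesis
    by (simp add: singular_simplex_def order_simplex_def)
qed

definition skip :: "nat \<Rightarrow> nat \<Rightarrow> nat"
  where "skip k i = (if i < k then i else Suc i)"

lemma singular_face_order_simplex:
  assumes "1 \<le> p" "k \<le> p"
  shows "singular_face p k (order_simplex p v) = order_simplex (p - 1) (v \<circ> skip k)"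
proof
  fix t :: "nat \<Rightarrow> real"
  show "singular_face p k (order_simplex p v) t = order_simplex (p - 1) (v \<circ> skip k) t"
  proof (cases "t \<in> standard_simplex (p - 1)")
    case True
    note L = standard_simplex_Least[OF True]
    have "(LEAST i. simplical_face k t i \<noteq> 0) = skip k (LEAST i. t i \<noteq> 0)"
    proof (rule Least_equality)
      show "simplical_face k t (skip k (LEAST i. t i \<noteq> 0)) \<noteq> 0"
        using L(1) by (simp add: simplical_face_def skip_def)
      fix j assume j: "simplical_face k t j \<noteq> 0"
      define i where "i = (if j < k then j else j - 1)"
      have "t i \<noteq> 0" "j = skip k i"
        using j by (auto simp: simplical_face_def i_def skip_def split: if_splits)
      then show "skip k (LEAST i. t i \<noteq> 0) \<le> j"
        using Least_le[of "\<lambda>i. t i \<noteq> 0" i] by (auto simp: skip_def)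
    qed
    moreover have "simplical_face k t \<in> standard_simplex p"
      using simplical_face_in_standard_simplex[of p k t] assms True by simp
    ultimately show ?thesis
      using True by (simp add: singular_face_def order_simplex_def)
  qed (simp add: singular_face_def order_simplex_def)
qed

lemma strict_chain_skip:
  assumes "strict_chain X p v" "1 \<le> p" "k \<le> p"
  shows "strict_chain X (p - 1) (v \<circ> skip k)"
  using assms by (auto simp: strict_chain_def skip_def image_subset_iff)

lemma strict_chain_subtopology:
  assumes "finite (topspace X)"
  shows "strict_chain (subtopology X Q) p v \<longleftrightarrow> strict_chain X p v \<and> v ` {..p} \<subseteq> Q"
  using spec_le_subtopology[OF assms]
  by (auto simp: strict_chain_def spec_less_def image_subset_iff)

lemma order_simplices_subtopology:
  assumes "finite (topspace X)"
  shows "order_simplices p (subtopology X Q) =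
    {s \<in> order_simplices p X. s ` standard_simplex p \<subseteq> Q}"
proof -
  have "v ` {..p} \<subseteq> Q \<longleftrightarrow> order_simplex p v ` standard_simplex p \<subseteq> Q" for v
    by (simp only: image_order_simplex)
  then show ?thesis
    unfolding order_simplices_def strict_chain_subtopology[OF assms] by blast
qed

lemma singular_simplex_order_simplices:
  "finite (topspace X) \<Longrightarrow> s \<in> order_simplices p X \<Longrightarrow> singular_simplex p X s"
  by (auto simp: order_simplices_def intro: singular_simplex_order_simplex)

lemma order_chain_imp_singular_chain:
  "finite (topspace X) \<Longrightarrow> order_chain p X c \<Longrightarrow> singular_chain p X c"
  by (auto simp: order_chain_def singular_chain_def intro: singular_simplex_order_simplices)

lemma singular_face_order_simplices:
  assumes "s \<in> order_simplices p X" "1 \<le> p" "k \<le> p"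
  shows "singular_face p k s \<in> order_simplices (p - 1) X"
  using assms strict_chain_skip singular_face_order_simplex
  by (force simp: order_simplices_def)

lemma order_chain_0 [simp]: "order_chain p X 0"
  by (simp add: order_chain_def)

lemma order_chain_of [simp]: "order_chain p X (frag_of s) \<longleftrightarrow> s \<in> order_simplices p X"
  by (simp add: order_chain_def)

lemma order_chain_cmul: "order_chain p X c \<Longrightarrow> order_chain p X (frag_cmul k c)"
  using keys_cmul[of k c] by (auto simp: order_chain_def)

lemma order_chain_minus [simp]: "order_chain p X (- c) \<longleftrightarrow> order_chain p X c"
  by (simp add: order_chain_def)

lemma order_chain_add: "order_chain p X a \<Longrightarrow> order_chain p X b \<Longrightarrow> order_chain p X (a + b)"
  using keys_add[of a b] by (auto simp: order_chain_def)

lemma order_chain_diff: "order_chain p X a \<Longrightarrow> order_chain p X b \<Longrightarrow> order_chain p X (a - b)"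
  using keys_diff[of a b] by (auto simp: order_chain_def)

lemma order_chain_sum: "(\<And>i. i \<in> I \<Longrightarrow> order_chain p X (f i)) \<Longrightarrow> order_chain p X (sum f I)"
  by (induction I rule: infinite_finite_induct) (auto intro: order_chain_add)

lemma order_chain_extend:
  "(\<And>s. s \<in> Poly_Mapping.keys c \<Longrightarrow> order_chain p X (f s)) \<Longrightarrow> order_chain p X (frag_extend f c)"
  by (simp add: frag_extend_def order_chain_cmul order_chain_sum)

lemma order_chain_boundary:
  assumes "order_chain p X c"
  shows "order_chain (p - 1) X (chain_boundary p c)"
  unfolding chain_boundary_def
  using assms singular_face_order_simplices[of _ p X]
  by (auto simp: order_chain_def[of p] intro!: order_chain_extend order_chain_sum order_chain_cmul)

lemma order_chain_subtopology:
  assumes "finite (topspace X)"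
  shows "order_chain p (subtopology X Q) c \<longleftrightarrow>
    order_chain p X c \<and> singular_chain p (subtopology X Q) c"
  using singular_simplex_order_simplices[OF assms]
  unfolding order_chain_def singular_chain_def order_simplices_subtopology[OF assms]
    singular_simplex_subtopology by blast

lemma singular_chain_0_imp_order_chain:
  assumes "finite (topspace X)" "singular_chain 0 X c"
  shows "order_chain 0 X c"
proof -
  have "s \<in> order_simplices 0 X" if s: "singular_simplex 0 X s" for s
  proof -
    let ?e = "\<lambda>j. if j = 0 then 1 else (0::real)"
    have "s = order_simplex 0 (\<lambda>_. s ?e)"
    proof
      fix t show "s t = order_simplex 0 (\<lambda>_. s ?e) t"
      proof (cases "t \<in> standard_simplex 0")
        case True
        then show ?thesis by (simp add: order_simplex_def) (simp add: standard_simplex_0)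
      next
        case False
        then show ?thesis
          using s by (simp add: order_simplex_def singular_simplex_def extensional_def)
      qed
    qed
    moreover have "s ?e \<in> topspace X"
      using s by (auto simp: singular_simplex_def continuous_map_def standard_simplex_0)
    then have "strict_chain X 0 (\<lambda>_. s ?e)"
      by (auto simp: strict_chain_def)
    ultimately show ?thesis
      unfolding order_simplices_def by blast
  qed
  then show ?thesis
    using assms(2) by (auto simp: singular_chain_def order_chain_def)
qed

lemma finite_order_simplices:
  assumes "finite (topspace X)"
  shows "finite (order_simplices p X)"
proof (rule finite_subset)
  show "order_simplices p X \<subseteq> order_simplex p ` ({..p} \<rightarrow>\<^sub>E topspace X)"
  proof
    fix s assume "s \<in> order_simplices p X"
    then obtain v where v: "s = order_simplex p v" "strict_chain X p v"
      by (auto simp: order_simplices_def)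
    have "s = order_simplex p (restrict v {..p})"
      unfolding v(1) by (rule order_simplex_cong) simp
    moreover have "restrict v {..p} \<in> {..p} \<rightarrow>\<^sub>E topspace X"
      using v(2) by (auto simp: strict_chain_def)
    ultimately show "s \<in> order_simplex p ` ({..p} \<rightarrow>\<^sub>E topspace X)" by blast
  qed
  show "finite (order_simplex p ` ({..p} \<rightarrow>\<^sub>E topspace X))"
    using assms by (intro finite_imageI finite_PiE) auto
qed

lemma order_simplices_high_degree:
  assumes "finite (topspace X)" "card (topspace X) \<le> p"
  shows "order_simplices p X = {}"
proof -
  have False if v: "strict_chain X p v" for v
  proof -
    have "inj_on v {..p}"
      using v by (intro linorder_inj_onI) (auto simp: strict_chain_def spec_less_def)
    then have "card {..p} \<le> card (topspace X)"
      using v assms(1) by (intro card_inj_on_le[of v]) (auto simp: strict_chain_def)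
    then show False using assms(2) by simp
  qed
  then show ?thesis by (auto simp: order_simplices_def)
qed

section \<open>Acyclic spaces\<close>

text \<open>The values are multiples of the generator of a free group of rank one instead of integers; in
  this way the augmentation is an instance of \<open>frag_extend\<close>.\<close>

definition augmentation :: "('b \<Rightarrow>\<^sub>0 int) \<Rightarrow> (unit \<Rightarrow>\<^sub>0 int)"
  where "augmentation = frag_extend (\<lambda>_. frag_of ())"

text \<open>The cycles of the augmented chain complex. In an acyclic space they are boundaries in every
  degree, degree 0 included.\<close>

definition reduced_cycle :: "nat \<Rightarrow> 'a chain \<Rightarrow> bool"
  where "reduced_cycle p c \<longleftrightarrow> chain_boundary p c = 0 \<and> (p = 0 \<longrightarrow> augmentation c = 0)"

definition singular_acyclic :: "'a topology \<Rightarrow> bool"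
  where "singular_acyclic X \<longleftrightarrow> topspace X \<noteq> {} \<and>
    (\<forall>p c. singular_chain p X c \<longrightarrow> reduced_cycle p c \<longrightarrow> singular_relboundary p X {} c)"

lemma chain_boundary_degree_0 [simp]: "chain_boundary 0 c = 0"
  by (simp add: chain_boundary_def)

lemma augmentation_of [simp]: "augmentation (frag_of s) = frag_of ()"
  and augmentation_0 [simp]: "augmentation 0 = 0"
  and augmentation_diff: "augmentation (a - b) = augmentation a - augmentation b"
  by (simp_all add: augmentation_def frag_extend_diff)

lemma frag_extend_frag_extend:
  "frag_extend f (frag_extend g c) = frag_extend (\<lambda>x. frag_extend f (g x)) c"
  using subset_UNIV
  by (induction c rule: frag_induction) (auto simp: frag_extend_diff)

lemma augmentation_extend: "augmentation (frag_extend g c) = frag_extend (augmentation \<circ> g) c"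
  by (simp add: augmentation_def frag_extend_frag_extend comp_def)

lemma augmentation_boundary: "augmentation (chain_boundary (Suc 0) c) = 0"
  using subset_UNIV
  by (induction c rule: frag_induction)
    (auto simp: chain_boundary_of chain_boundary_diff augmentation_diff)

lemma path_connected_imp_boundary_if_augmentation_0:
  assumes X: "path_connected_space X" and c: "singular_chain 0 X c" "augmentation c = 0"
  shows "singular_relboundary 0 X {} c"
proof (cases "topspace X = {}")
  case True
  then show ?thesis using c(1) by (simp add: singular_chain_empty)
next
  case False
  then obtain a where "a \<in> topspace X" by blast
  then have "singular_simplex 0 X (restrict (\<lambda>x. a) (standard_simplex 0))"
    by (simp add: singular_simplex_def)
  then obtain f where f: "singular_simplex 0 X f"
    by blast
  have "homologous_rel 0 X {} c (frag_extend (\<lambda>_. frag_of f) c)"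
    using c(1) unfolding singular_chain_def
  proof (induction c rule: frag_induction)
    case (one x)
    then show ?case
      using iso_integer_zeroth_homology_group_aux[OF X _ f, of x] by simp
  qed (auto simp: frag_extend_diff homologous_rel_diff)
  moreover have "frag_extend (\<lambda>_. frag_of f) c = frag_extend (\<lambda>_. frag_of f) (augmentation c)"
    by (simp add: augmentation_def frag_extend_frag_extend)
  ultimately show ?thesis
    using c(2) by (simp add: homologous_rel_def)
qed

text \<open>In degree 0 only an abstract isomorphism with the homology of a point is given. As the homology
  group is free on the path components, its isomorphism type detects that there is exactly one of
  them.\<close>

lemma acyclic_space_imp_singular_acyclic:
  assumes "acyclic_space X"
  shows "singular_acyclic X"
proof -
  let ?P = "discrete_topology {()}"
  have iso: "homology_group p X \<cong> homology_group p ?P" for p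
    using assms by (simp add: acyclic_space_def)
  have "path_connected_space X"
    using isomorphic_homology_imp_path_connectedness[OF iso[of 0]]
    by (simp add: contractible_imp_path_connected_space)
  moreover have "topspace X \<noteq> {}"
  proof
    assume "topspace X = {}"
    then have "trivial_group (homology_group 0 X)"
      by (rule trivial_homology_group_empty)
    then have "trivial_group (homology_group 0 ?P)"
      by (rule isomorphic_group_triviality1[OF iso group_relative_homology_group])
    then have "trivial_group integer_group"
      by (rule isomorphic_group_triviality1[rotated 2]) (simp_all add: homology_coefficients[of _ "()"])
    then have "carrier integer_group = {\<one>\<^bsub>integer_group\<^esub>}"
      unfolding trivial_group_def by blast
    then have "(1::int) \<in> {0}"
      by (simp add: integer_group_def set_eq_iff)
    then show False by simp
  qed
  moreover have "singular_relboundary p X {} c"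
    if "singular_chain p X c" "reduced_cycle p c" "p \<noteq> 0" for p c
  proof -
    have "trivial_group (homology_group (int p) ?P)"
      by (rule homology_dimension_axiom[of _ "()"]) (use that in auto)
    then have "trivial_group (homology_group (int p) X)"
      using isomorphic_group_triviality[OF iso group_relative_homology_group group_relative_homology_group]
      by blast
    moreover have "singular_relcycle p X {} c"
      using that by (simp add: singular_cycle reduced_cycle_def)
    then have "homologous_rel_set p X {} c \<in> carrier (homology_group (int p) X)"
      by (simp add: carrier_relative_homology_group)
    ultimately show ?thesis
      by (simp add: trivial_group_def homologous_rel_set_eq_relboundary)
  qed
  ultimately show ?thesis
    using path_connected_imp_boundary_if_augmentation_0[of X]
    unfolding singular_acyclic_def reduced_cycle_def by metis
qed

lemma contractible_space_imp_singular_acyclic: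
  assumes "contractible_space X" "topspace X \<noteq> {}"
  shows "singular_acyclic X"
proof -
  obtain a where a: "a \<in> topspace X" "X homotopy_equivalent_space subtopology X {a}"
    using assms contractible_eq_homotopy_equivalent_singleton_subtopology[of X] by auto
  have "subtopology X {a} = discrete_topology {a}"
    using a(1) by (simp add: subtopology_eq_discrete_topology_sing)
  then have "X homotopy_equivalent_space discrete_topology {a}"
    using a(2) by simp
  moreover have "discrete_topology {a} homeomorphic_space discrete_topology {()}"
    unfolding homeomorphic_space_def
    by (intro exI[of _ "\<lambda>_. ()"] exI[of _ "\<lambda>_. a"]) (simp add: homeomorphic_maps_def)
  ultimately have "acyclic_space X"
    unfolding acyclic_space_def
    using homotopy_equivalent_space_imp_isomorphic_homology_groups
      homeomorphic_space_imp_isomorphic_homology_groups iso_trans by blast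
  then show ?thesis
    by (rule acyclic_space_imp_singular_acyclic)
qed

text \<open>If \<open>x\<close> is the maximum, the constant map to \<open>x\<close> agrees with the identity on the preimage
  of every open set other than the whole space, so that jumping from the identity to this constant
  at time 1 is continuous.\<close>

lemma maximum_imp_contractible_space:
  assumes fin: "finite (topspace X)" and x: "x \<in> topspace X"
    and max: "\<And>y. y \<in> topspace X \<Longrightarrow> spec_le X y x"
  shows "contractible_space X"
proof -
  let ?h = "\<lambda>(t::real, y). if t < 1 then y else x"
  let ?I = "top_of_set {0..1::real}"
  have "continuous_map (prod_topology ?I X) X ?h"
    unfolding continuous_map_def
  proof (intro conjI allI impI)
    show "?h \<in> topspace (prod_topology ?I X) \<rightarrow> topspace X"
      using x by auto
    fix U assume U: "openin X U"
    show "openin (prod_topology ?I X) {z \<in> topspace (prod_topology ?I X). ?h z \<in> U}"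
    proof (cases "x \<in> U")
      case True
      then have "U = topspace X"
        using U max openin_iff_lower_set[OF fin, of U] by blast
      then have "{z \<in> topspace (prod_topology ?I X). ?h z \<in> U} = topspace (prod_topology ?I X)"
        using x by auto
      then show ?thesis by (simp only: openin_topspace)
    next
      case False
      have "{z \<in> topspace (prod_topology ?I X). ?h z \<in> U} = ({..<1} \<inter> {0..1}) \<times> U"
        using False openin_subset[OF U] by (auto split: if_splits)
      moreover have "openin ?I ({..<1} \<inter> {0..1})"
        by (auto simp: openin_open intro!: exI[of _ "{..<1}"])
      ultimately show ?thesis
        using U by (simp add: openin_prod_Times_iff)
    qed
  qed
  then have "homotopic_with (\<lambda>_. True) X X id (\<lambda>_. x)"
    unfolding homotopic_with_def by (intro exI[of _ ?h]) auto
  then show ?thesis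
    unfolding contractible_space_def by blast
qed

definition vertex :: "nat \<Rightarrow> nat \<Rightarrow> real"
  where "vertex i = (\<lambda>j. if j = i then 1 else 0)"

text \<open>The apex \<open>x\<close> is the maximum of the space and becomes the last vertex. The cone over a simplex that
  already ends in \<open>x\<close> is degenerate and counts as zero.\<close>

definition cone_simplex :: "'a \<Rightarrow> nat \<Rightarrow> ((nat \<Rightarrow> real) \<Rightarrow> 'a) \<Rightarrow> 'a chain"
  where "cone_simplex x p s = (if s (vertex p) = x then 0
    else frag_of (order_simplex (Suc p) (\<lambda>i. if i \<le> p then s (vertex i) else x)))"

lemma cone_simplex_order_simplex:
  "cone_simplex x p (order_simplex p v) =
    (if v p = x then 0 else frag_of (order_simplex (Suc p) (v(Suc p := x))))"
proof -
  have "order_simplex p v (vertex i) = v i" if "i \<le> p" for i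
    using order_simplex_basis[OF that, of v] by (simp add: vertex_def)
  moreover have "order_simplex (Suc p) (\<lambda>i. if i \<le> p then order_simplex p v (vertex i) else x) =
      order_simplex (Suc p) (v(Suc p := x))"
    by (rule order_simplex_cong) (auto simp: calculation)
  ultimately show ?thesis
    by (simp add: cone_simplex_def)
qed

lemma order_chain_cone_simplex:
  assumes X: "finite_t0_space X" and x: "x \<in> topspace X"
    and max: "\<And>y. y \<in> topspace X \<Longrightarrow> spec_le X y x" and s: "s \<in> order_simplices p X"
  shows "order_chain (Suc p) X (cone_simplex x p s)"
proof -
  obtain v where v: "s = order_simplex p v" "strict_chain X p v"
    using s by (auto simp: order_simplices_def)
  have "strict_chain X (Suc p) (v(Suc p := x))" if "v p \<noteq> x"
  proof -
    have less: "spec_less X (v i) x" if "i \<le> p" for i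
    proof -
      have "spec_less X (v p) x"
        using v(2) max \<open>v p \<noteq> x\<close> by (auto simp: strict_chain_def spec_less_def)
      then show ?thesis
        using v(2) spec_less_trans[OF X, of "v i" "v p" x] \<open>i \<le> p\<close>
        by (cases "i = p") (auto simp: strict_chain_def)
    qed
    show ?thesis
      using v(2) x less by (auto simp: strict_chain_def le_Suc_eq)
  qed
  then show ?thesis
    unfolding v(1) cone_simplex_order_simplex order_simplices_def by (auto simp: order_simplices_def)
qed

text \<open>The cone operator contracts the augmented complex of order chains, up to sign.\<close>

lemma chain_boundary_cone_simplex:
  assumes X: "finite_t0_space X" and max: "\<And>y. y \<in> topspace X \<Longrightarrow> spec_le X y x"
    and s: "s \<in> order_simplices p X"
  shows "chain_boundary (Suc p) (cone_simplex x p s) =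
    (if p = 0 then frag_of (order_simplex 0 (\<lambda>_. x))
     else frag_extend (cone_simplex x (p - 1)) (chain_boundary p (frag_of s))) +
    frag_cmul ((-1) ^ Suc p) (frag_of s)"
proof -
  obtain v where v: "s = order_simplex p v" "strict_chain X p v"
    using s by (auto simp: order_simplices_def)
  have ne: "v i \<noteq> v p" if "i < p" for i
    using v(2) that by (auto simp: strict_chain_def spec_less_def)
  show ?thesis
  proof (cases "p = 0")
    case True
    have "order_simplex 0 (v(Suc 0 := x) \<circ> skip 0) = order_simplex 0 (\<lambda>_. x)"
      "order_simplex 0 (v(Suc 0 := x) \<circ> skip (Suc 0)) = order_simplex 0 v"
      by (auto intro!: order_simplex_cong simp: skip_def)
    moreover have "order_simplex 0 v = order_simplex 0 (\<lambda>_. x)" if "v 0 = x"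
      using that by (intro order_simplex_cong) auto
    ultimately show ?thesis
      using True by (auto simp: v(1) cone_simplex_order_simplex chain_boundary_of
          singular_face_order_simplex)
  next
    case False
    then obtain q where p: "p = Suc q" by (cases p) auto
    have ext: "frag_extend (cone_simplex x (p - 1)) (chain_boundary p (frag_of s)) =
        (\<Sum>k\<le>p. frag_cmul ((-1) ^ k) (cone_simplex x q (order_simplex q (v \<circ> skip k))))"
      using p by (simp add: v(1) chain_boundary_of frag_extend_sum frag_extend_cmul
          singular_face_order_simplex del: sum.atMost_Suc)
    show ?thesis
    proof (cases "v p = x")
      case True
      have "cone_simplex x q (order_simplex q (v \<circ> skip k)) = 0" if "k \<le> q" for k
        using that True p by (simp add: cone_simplex_order_simplex skip_def)
      moreover have "cone_simplex x q (order_simplex q (v \<circ> skip p)) = frag_of s"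
      proof -
        have "v q \<noteq> x" using ne[of q] True p by simp
        moreover have "order_simplex p ((v \<circ> skip p)(p := x)) = order_simplex p v"
          by (rule order_simplex_cong) (use True in \<open>auto simp: skip_def\<close>)
        ultimately show ?thesis
          using p by (simp add: cone_simplex_order_simplex v(1) skip_def)
      qed
      ultimately show ?thesis
        using False True ext p v(1)
        by (simp add: cone_simplex_order_simplex[of x "Suc q"] flip: frag_cmul_distrib)
    next
      case vx: False
      have *: "cone_simplex x q (order_simplex q (v \<circ> skip k)) =
          frag_of (order_simplex p (v(Suc p := x) \<circ> skip k))" if k: "k \<le> p" for k
      proof -
        have "spec_less X (v q) (v p)" "spec_le X (v p) x"
          using v(2) p max by (auto simp: strict_chain_def)
        then have "v q \<noteq> x"
          using spec_le_antisym[OF X, of "v q" "v p"] by (auto simp: spec_less_def)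
        then have "(v \<circ> skip k) q \<noteq> x"
          using k p vx by (auto simp: skip_def)
        moreover have "order_simplex p ((v \<circ> skip k)(p := x)) = order_simplex p (v(Suc p := x) \<circ> skip k)"
          by (rule order_simplex_cong) (use k p in \<open>auto simp: skip_def\<close>)
        ultimately show ?thesis
          using p by (simp add: cone_simplex_order_simplex)
      qed
      have last: "order_simplex p (v(Suc p := x) \<circ> skip (Suc p)) = s"
        unfolding v(1) by (rule order_simplex_cong) (auto simp: skip_def)
      show ?thesis
      proof -
        have "frag_extend (cone_simplex x (p - 1)) (chain_boundary p (frag_of s)) =
            (\<Sum>k\<le>p. frag_cmul ((-1) ^ k) (frag_of (order_simplex p (v(Suc p := x) \<circ> skip k))))"
          unfolding ext by (intro sum.cong refl) (simp add: *)
        then show ?thesis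
          using False vx unfolding v(1) cone_simplex_order_simplex
          by (simp add: chain_boundary_of singular_face_order_simplex last[unfolded v(1)])
      qed
    qed
  qed
qed

lemma maximum_imp_order_boundary:
  assumes X: "finite_t0_space X" and x: "x \<in> topspace X"
    and max: "\<And>y. y \<in> topspace X \<Longrightarrow> spec_le X y x"
    and c: "order_chain p X c" "reduced_cycle p c"
  obtains d where "order_chain (Suc p) X d" "chain_boundary (Suc p) d = c"
proof -
  let ?K = "frag_extend (cone_simplex x p) c"
  let ?R = "if p = 0 then frag_extend (\<lambda>_. frag_of (order_simplex 0 (\<lambda>_. x))) c
    else frag_extend (cone_simplex x (p - 1)) (chain_boundary p c)"
  have "chain_boundary (Suc p) ?K = ?R + frag_cmul ((-1) ^ Suc p) c"
    using c(1) unfolding order_chain_def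
  proof (induction c rule: frag_induction)
    case (one s)
    then show ?case
      using chain_boundary_cone_simplex[OF X max, of s p] by simp
  next
    case (diff a b)
    then show ?case
      using frag_cmul_distrib2[of "(-1) ^ Suc p" "a - b" b]
      by (auto simp: frag_extend_diff chain_boundary_diff algebra_simps)
  qed simp
  moreover have "?R = 0"
  proof -
    have "frag_extend (\<lambda>_. frag_of (order_simplex 0 (\<lambda>_. x))) c =
        frag_extend (\<lambda>_. frag_of (order_simplex 0 (\<lambda>_. x))) (augmentation c)"
      by (simp add: augmentation_def frag_extend_frag_extend)
    then show ?thesis
      using c(2) by (auto simp: reduced_cycle_def)
  qed
  ultimately have "chain_boundary (Suc p) (frag_cmul ((-1) ^ Suc p) ?K) = c"
    by (simp add: chain_boundary_cmul flip: power_add)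
  moreover have "order_chain (Suc p) X (frag_cmul ((-1) ^ Suc p) ?K)"
    using c(1) order_chain_cone_simplex[OF X x max]
    by (intro order_chain_cmul order_chain_extend) (auto simp: order_chain_def[of p])
  ultimately show ?thesis
    using that by blast
qed

section \<open>Order chains compute singular homology\<close>

text \<open>Iterated barycentric subdivision makes \<open>z\<close> small. The natural homotopy between subdivision and
  identity contributes a term that depends on the boundary of \<open>z\<close> only, and this one already has
  the required form.\<close>

lemma singular_chain_decompose_open_cover:
  assumes AB: "openin X A" "openin X B" "topspace X \<subseteq> A \<union> B"
    and z: "singular_chain p X z" "chain_boundary p z = \<alpha> + \<beta>"
    and \<alpha>: "singular_chain (p - 1) (subtopology X A) \<alpha>"
    and \<beta>: "singular_chain (p - 1) (subtopology X B) \<beta>"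
    and p: "1 \<le> p"
  obtains a b w where "singular_chain p (subtopology X A) a" "singular_chain p (subtopology X B) b"
    "singular_chain (Suc p) X w" "z = a + b + chain_boundary (Suc p) w"
proof -
  obtain n where n: "\<And>m f. n \<le> m \<Longrightarrow> f \<in> Poly_Mapping.keys ((singular_subdivision p ^^ m) z) \<Longrightarrow>
      \<exists>V \<in> {A, B}. f \<in> standard_simplex p \<rightarrow> V"
    by (rule sufficient_iterated_singular_subdivision_exists[of "{A, B}" X p z]) (use AB z in auto)
  obtain h :: "nat \<Rightarrow> 'a chain \<Rightarrow> 'a chain" where h: "\<And>p. h p 0 = 0"
    "\<And>p c1 c2. h p (c1 - c2) = h p c1 - h p c2"
    "\<And>p X c. singular_chain p X c \<Longrightarrow> singular_chain (Suc p) X (h p c)"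
    "\<And>p X c. singular_chain p X c \<Longrightarrow> chain_boundary (Suc p) (h p c) +
      h (p - Suc 0) (chain_boundary p c) = (singular_subdivision p ^^ n) c - c"
    by (rule chain_homotopic_iterated_singular_subdivision[of n]) blast
  let ?s = "(singular_subdivision p ^^ n) z"
  have "singular_chain p X ((singular_subdivision p ^^ m) z)" for m
    by (induction m) (auto simp: singular_chain_singular_subdivision z)
  then have "Poly_Mapping.keys ?s \<subseteq>
      singular_simplex_set p (subtopology X A) \<union> singular_simplex_set p (subtopology X B)"
    using n[OF order_refl] unfolding singular_chain_def singular_simplex_subtopology by blast
  then obtain a b where ab: "singular_chain p (subtopology X A) a"
      "singular_chain p (subtopology X B) b" "a + b = ?s"
    unfolding singular_chain_def by (rule frag_split)
  have "h (p - 1) (\<alpha> + \<beta>) = h (p - 1) \<alpha> + h (p - 1) \<beta>"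
    using h(2)[of "p - 1" \<alpha> "- \<beta>"] h(1)[of "p - 1"] h(2)[of "p - 1" 0 \<beta>] by simp
  then have "z = (a - h (p - 1) \<alpha>) + (b - h (p - 1) \<beta>) + chain_boundary (Suc p) (- h p z)"
    using h(4)[OF z(1)] z(2) ab(3) by (simp add: chain_boundary_minus algebra_simps)
  moreover have "singular_chain p (subtopology X A) (a - h (p - 1) \<alpha>)"
    "singular_chain p (subtopology X B) (b - h (p - 1) \<beta>)"
    using ab h(3)[OF \<alpha>] h(3)[OF \<beta>] p by (simp_all add: singular_chain_diff)
  ultimately show ?thesis
    using that h(3)[OF z(1)] by (metis singular_chain_minus)
qed

text \<open>McCord's theorem, stated as the acyclicity of the quotient of the singular chains by the order
  chains. In this relative form the surjectivity and the injectivity of the comparison in homology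
  are one statement, and the induction needs no exact sequences.

  Let \<open>x\<close> be maximal. An order simplex with vertex \<open>x\<close> lies below \<open>x\<close>, so every order simplex is contained in
  the open set \<open>A\<close> of the points other than \<open>x\<close> or in the minimal neighbourhood \<open>B\<close> of \<open>x\<close>. If \<open>B\<close> is the
  whole space, both complexes are contractible. Otherwise \<open>A\<close>, \<open>B\<close> and their
  intersection have fewer points: a relative cycle \<open>z\<close> splits into chains \<open>a\<close> and \<open>b\<close>. The
  relative boundary \<open>w\<close> of \<open>a\<close> is minus that of \<open>b\<close>, hence lives on the intersection. Filling \<open>w\<close>
  there turns \<open>a\<close> and \<open>b\<close> into relative cycles of \<open>A\<close> and \<open>B\<close>.\<close>

theorem singular_chain_homologous_order_chain:
  assumes "finite_t0_space X" "singular_chain p X z" "order_chain (p - 1) X (chain_boundary p z)"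
  shows "\<exists>c w. order_chain p X c \<and> singular_chain (Suc p) X w \<and> z = c + chain_boundary (Suc p) w"
  using assms
proof (induction "card (topspace X)" arbitrary: p X z rule: less_induct)
  case (less X p z)
  note X = less.prems(1) and z = less.prems(2,3)
  have fin: "finite (topspace X)"
    using X by (simp add: finite_t0_space_def)
  have bd2: "chain_boundary (p - 1) (chain_boundary p z) = 0"
    using chain_boundary_boundary[OF z(1)] by simp
  show ?case
  proof (cases "p = 0 \<or> topspace X = {}")
    case True
    then have "order_chain p X z"
      using z(1) singular_chain_0_imp_order_chain[OF fin] by (auto simp: singular_chain_empty)
    then show ?thesis
      by (intro exI[of _ z] exI[of _ 0]) simp
  next
    case False
    then have p: "1 \<le> p" "p \<noteq> 0" by auto
    obtain x where x: "x \<in> topspace X" and max: "\<And>y. spec_le X x y \<Longrightarrow> y = x"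
      using exists_maximal_point[OF X] False by blast
    let ?A = "topspace X - {x}" and ?B = "min_open X x"
    have oA: "openin X ?A"
      using max by (auto simp: openin_iff_lower_set[OF fin] spec_le_def)
    have oB: "openin X ?B"
      by (rule openin_min_open[OF fin x])
    show ?thesis
    proof (cases "?B = topspace X")
      case True
      have mx: "spec_le X y x" if "y \<in> topspace X" for y
        using that True x by (simp add: spec_le_iff[OF fin])
      have "reduced_cycle (p - 1) (chain_boundary p z)"
        unfolding reduced_cycle_def
        using bd2 augmentation_boundary p by (cases "p = 1") auto
      then obtain c where c: "order_chain p X c" "chain_boundary p c = chain_boundary p z"
        using maximum_imp_order_boundary[OF X x mx z(2)] p by auto
      have "singular_acyclic X"
        by (rule contractible_space_imp_singular_acyclic[OF maximum_imp_contractible_space[OF fin x mx]])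
          (use x in auto)
      moreover have "singular_chain p X (z - c)" "reduced_cycle p (z - c)"
        using c z(1) p order_chain_imp_singular_chain[OF fin c(1)]
        by (auto simp: reduced_cycle_def chain_boundary_diff singular_chain_diff)
      ultimately obtain w where "singular_chain (Suc p) X w" "chain_boundary (Suc p) w = z - c"
        unfolding singular_acyclic_def singular_boundary by blast
      then show ?thesis
        using c(1) by (intro exI[of _ c] exI[of _ w]) simp
    next
      case False
      let ?XA = "subtopology X ?A" and ?XB = "subtopology X ?B" and ?XD = "subtopology X (?A \<inter> ?B)"
      have card: "card (topspace ?XA) < card (topspace X)" "card (topspace ?XB) < card (topspace X)"
          "card (topspace ?XD) < card (topspace X)"
        using x False openin_subset[OF oB] by (auto intro!: psubset_card_mono fin)
      note T0 = finite_t0_space_subtopology[OF X]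
      have "s \<in> order_simplices (p - 1) ?XA \<union> order_simplices (p - 1) ?XB"
        if s: "s \<in> order_simplices (p - 1) X" for s
      proof -
        obtain v where v: "s = order_simplex (p - 1) v" "strict_chain X (p - 1) v"
          using s by (auto simp: order_simplices_def)
        have "v i \<in> ?B" if "i \<le> p - 1" "j \<le> p - 1" "v j = x" for i j
        proof -
          consider "i < j" | "i = j" | "j < i" by linarith
          then have "spec_le X (v i) x"
          proof cases
            case 3
            then have "spec_less X x (v i)"
              using v(2) that by (auto simp: strict_chain_def)
            then show ?thesis using max by (auto simp: spec_less_def)
          qed (use v(2) that spec_le_refl[OF x] in \<open>auto simp: strict_chain_def spec_less_def\<close>)
          then show ?thesis by (simp add: spec_le_iff[OF fin])
        qed
        moreover have "v ` {..p - 1} \<subseteq> topspace X"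
          using v(2) by (simp add: strict_chain_def)
        ultimately have "v ` {..p - 1} \<subseteq> ?A \<or> v ` {..p - 1} \<subseteq> ?B"
          by blast
        then show ?thesis
          using v by (auto simp: order_simplices_def strict_chain_subtopology[OF fin])
      qed
      then obtain \<alpha> \<beta> where \<alpha>: "order_chain (p - 1) ?XA \<alpha>" and \<beta>: "order_chain (p - 1) ?XB \<beta>"
        and \<alpha>\<beta>: "\<alpha> + \<beta> = chain_boundary p z"
        using z(2) frag_split[of "chain_boundary p z" "order_simplices (p - 1) ?XA" "order_simplices (p - 1) ?XB"]
        unfolding order_chain_def by (metis subset_iff)
      note s\<alpha> = \<alpha>[unfolded order_chain_subtopology[OF fin], THEN conjunct2]
        and s\<beta> = \<beta>[unfolded order_chain_subtopology[OF fin], THEN conjunct2]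
      obtain a b u where a: "singular_chain p ?XA a" and b: "singular_chain p ?XB b"
        and u: "singular_chain (Suc p) X u" "z = a + b + chain_boundary (Suc p) u"
        using singular_chain_decompose_open_cover[OF oA oB _ z(1) \<alpha>\<beta>[symmetric] s\<alpha> s\<beta> p(1)]
          min_open_self[of x X] by blast
      have "chain_boundary p (chain_boundary (Suc p) u) = 0"
        using chain_boundary_boundary_alt[OF u(1)] .
      then have ab: "\<alpha> + \<beta> = chain_boundary p a + chain_boundary p b"
        using \<alpha>\<beta> u(2) by (simp add: chain_boundary_add)
      define w where "w = chain_boundary p a - \<alpha>"
      have w': "w = \<beta> - chain_boundary p b"
        using ab by (simp add: w_def algebra_simps)
      have "singular_chain (p - 1) ?XA w"
        unfolding w_def using singular_chain_diff[OF singular_chain_boundary[OF a]] s\<alpha> by simp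
      moreover have "singular_chain (p - 1) ?XB w"
        unfolding w' using singular_chain_diff[OF _ singular_chain_boundary[OF b]] s\<beta> by simp
      ultimately have wD: "singular_chain (p - 1) ?XD w"
        unfolding singular_chain_subtopology by blast
      have "chain_boundary (p - 1) w = - chain_boundary (p - 1) \<alpha>"
        using chain_boundary_boundary[OF a] by (simp add: w_def chain_boundary_diff)
      then have "order_chain (p - 1 - 1) X (chain_boundary (p - 1) w)"
        using order_chain_boundary[OF \<alpha>] unfolding order_chain_subtopology[OF fin] by simp
      then have "order_chain (p - 1 - 1) ?XD (chain_boundary (p - 1) w)"
        using singular_chain_boundary[OF wD] unfolding order_chain_subtopology[OF fin] by simp
      then obtain \<delta> e where \<delta>: "order_chain (p - 1) ?XD \<delta>" and "singular_chain (Suc (p - 1)) ?XD e"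
        and "w = \<delta> + chain_boundary (Suc (p - 1)) e"
        using less.hyps[OF card(3) T0 wD] by blast
      then have e: "singular_chain p ?XD e" and w: "w = \<delta> + chain_boundary p e"
        using p by simp_all
      have \<delta>AB: "order_chain (p - 1) ?XA \<delta>" "order_chain (p - 1) ?XB \<delta>"
        using \<delta> unfolding order_chain_subtopology[OF fin] singular_chain_subtopology by blast+
      have eAB: "singular_chain p ?XA e" "singular_chain p ?XB e"
        using e unfolding singular_chain_subtopology by blast+
      have "chain_boundary p (a - e) = \<alpha> + \<delta>"
        using w by (simp add: w_def chain_boundary_diff algebra_simps)
      then obtain c1 u1 where 1: "order_chain p ?XA c1" "singular_chain (Suc p) ?XA u1"
          "a - e = c1 + chain_boundary (Suc p) u1"
        using less.hyps[OF card(1) T0 singular_chain_diff[OF a eAB(1)]]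
          order_chain_add[OF \<alpha> \<delta>AB(1)] by metis
      have "chain_boundary p (b + e) = \<beta> - \<delta>"
        using w by (simp add: w' chain_boundary_add algebra_simps)
      then obtain c2 u2 where 2: "order_chain p ?XB c2" "singular_chain (Suc p) ?XB u2"
          "b + e = c2 + chain_boundary (Suc p) u2"
        using less.hyps[OF card(2) T0 singular_chain_add[OF b eAB(2)]]
          order_chain_diff[OF \<beta> \<delta>AB(2)] by metis
      have "z = (a - e) + (b + e) + chain_boundary (Suc p) u"
        using u(2) by simp
      also have "\<dots> = (c1 + c2) + chain_boundary (Suc p) (u1 + u2 + u)"
        unfolding 1(3) 2(3) by (simp add: chain_boundary_add algebra_simps)
      finally have "z = (c1 + c2) + chain_boundary (Suc p) (u1 + u2 + u)" .
      moreover have "order_chain p X (c1 + c2)"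
        using 1(1) 2(1) unfolding order_chain_subtopology[OF fin] by (auto intro: order_chain_add)
      moreover have "singular_chain (Suc p) X (u1 + u2 + u)"
        using 1(2) 2(2) u(1) unfolding singular_chain_subtopology by (auto intro: singular_chain_add)
      ultimately show ?thesis
        by blast
    qed
  qed
qed

text \<open>A singular filling of \<open>c\<close> is a relative cycle, hence homologous to an order chain.\<close>

corollary order_chain_boundary_if_singular_boundary:
  assumes X: "finite_t0_space X" and c: "order_chain p X c" "singular_relboundary p X {} c"
  obtains d where "order_chain (Suc p) X d" "chain_boundary (Suc p) d = c"
proof -
  obtain z where z: "singular_chain (Suc p) X z" "chain_boundary (Suc p) z = c"
    using c(2) by (auto simp: singular_boundary)
  then obtain d w where "order_chain (Suc p) X d" "singular_chain (Suc (Suc p)) X w"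
      "z = d + chain_boundary (Suc (Suc p)) w"
    using singular_chain_homologous_order_chain[OF X, of "Suc p" z] c(1) by auto
  then show ?thesis
    using that[of d] z(2) chain_boundary_boundary_alt[of "Suc p" X w]
    by (simp add: chain_boundary_add)
qed

section \<open>Acyclic carriers\<close>

text \<open>The maps are given on simplices only, degree by degree; \<open>frag_extend\<close> extends
  them to chains.\<close>

definition carried_chain_map ::
    "'a topology \<Rightarrow> 'b topology \<Rightarrow> ('a set \<Rightarrow> 'b set) \<Rightarrow>
     (nat \<Rightarrow> ((nat \<Rightarrow> real) \<Rightarrow> 'a) \<Rightarrow> 'b chain) \<Rightarrow> bool"
  where "carried_chain_map X Y \<Phi> f \<longleftrightarrow>
    (\<forall>p. \<forall>s\<in>order_simplices p X.
      singular_chain p (subtopology Y (\<Phi> (s ` standard_simplex p))) (f p s)) \<and>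
    (\<forall>p. \<forall>s\<in>order_simplices (Suc p) X. chain_boundary (Suc p) (f (Suc p) s) =
      frag_extend (f p) (chain_boundary (Suc p) (frag_of s))) \<and>
    (\<forall>s\<in>order_simplices 0 X. augmentation (f 0 s) = frag_of ())"

definition acyclic_carrier :: "'a topology \<Rightarrow> 'b topology \<Rightarrow> ('a set \<Rightarrow> 'b set) \<Rightarrow> bool"
  where "acyclic_carrier X Y \<Phi> \<longleftrightarrow> mono \<Phi> \<and>
    (\<forall>p. \<forall>s\<in>order_simplices p X. singular_acyclic (subtopology Y (\<Phi> (s ` standard_simplex p))))"

lemma augmentation_apply: "augmentation c = frag_extend (\<lambda>_. frag_of ()) c"
  by (simp add: augmentation_def)

lemma chain_boundary_extend:
  "chain_boundary p (frag_extend f c) = frag_extend (\<lambda>s. chain_boundary p (f s)) c"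
  using subset_UNIV
  by (induction c rule: frag_induction) (auto simp: frag_extend_diff chain_boundary_diff)

lemma frag_extend_chain_boundary:
  "frag_extend f (chain_boundary p c) =
    frag_extend (\<lambda>s. frag_extend f (chain_boundary p (frag_of s))) c"
  using subset_UNIV
  by (induction c rule: frag_induction) (auto simp: frag_extend_diff chain_boundary_diff)

lemma frag_extend_diff_fun:
  "frag_extend (\<lambda>s. f s - g s) c = frag_extend f c - frag_extend g c"
  using subset_UNIV
  by (induction c rule: frag_induction) (auto simp: frag_extend_diff)

lemma keys_chain_boundary_order_simplex:
  assumes s: "s \<in> order_simplices (Suc p) X"
    and t: "t \<in> Poly_Mapping.keys (chain_boundary (Suc p) (frag_of s))"
  shows "t \<in> order_simplices p X" "t ` standard_simplex p \<subseteq> s ` standard_simplex (Suc p)"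
proof -
  have "order_chain p X (chain_boundary (Suc p) (frag_of s))"
    using order_chain_boundary[of "Suc p" X "frag_of s"] s by simp
  then show "t \<in> order_simplices p X"
    using t by (auto simp: order_chain_def)
  obtain k where "k \<le> Suc p" "t = singular_face (Suc p) k s"
    using t keys_sum[of "\<lambda>k. frag_cmul ((-1) ^ k) (frag_of (singular_face (Suc p) k s))" "{..Suc p}"]
    by (auto simp: chain_boundary_of simp del: sum.atMost_Suc)
  then show "t ` standard_simplex p \<subseteq> s ` standard_simplex (Suc p)"
    using simplical_face_in_standard_simplex[of "Suc p" k] by (auto simp: singular_face_def)
qed

lemma order_chain_mono:
  "finite (topspace X) \<Longrightarrow> Q \<subseteq> R \<Longrightarrow> order_chain p (subtopology X Q) c \<Longrightarrow>
    order_chain p (subtopology X R) c"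
  by (auto simp: order_chain_subtopology intro: singular_chain_mono)

text \<open>Boundaries of order simplices are cycles, so a map that commutes with boundaries up to
  degree \<open>p\<close> sends the boundary of a \<open>p + 1\<close>-simplex to a cycle of the carrier; acyclicity provides
  a filling, the value in degree \<open>p + 1\<close>. The values can be taken among order chains, since the
  carriers are acyclic for them as well.\<close>

theorem carried_chain_map_exists:
  assumes X: "finite_t0_space X" and Y: "finite_t0_space Y" and \<Phi>: "acyclic_carrier X Y \<Phi>"
  obtains f where "carried_chain_map X Y \<Phi> f"
    "\<And>p s. s \<in> order_simplices p X \<Longrightarrow> order_chain p Y (f p s)"
proof -
  have finX: "finite (topspace X)" and fin: "finite (topspace Y)"
    using X Y by (simp_all add: finite_t0_space_def)
  let ?Y = "\<lambda>p s. subtopology Y (\<Phi> (s ` standard_simplex p))"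
  have acyc: "singular_acyclic (?Y p s)" if "s \<in> order_simplices p X" for p s
    using \<Phi> that by (simp add: acyclic_carrier_def)
  have mono: "order_chain q (?Y (Suc p) s) c"
    if "s \<in> order_simplices (Suc p) X" "t \<in> Poly_Mapping.keys (chain_boundary (Suc p) (frag_of s))"
      "order_chain q (?Y p t) c" for p q s t c
    using order_chain_mono[OF fin _ that(3)] keys_chain_boundary_order_simplex(2)[OF that(1,2)] \<Phi>
    by (auto simp: acyclic_carrier_def dest: monoD)
  have bd2: "chain_boundary (Suc p) (chain_boundary (Suc (Suc p)) (frag_of s)) = 0"
    if "s \<in> order_simplices (Suc (Suc p)) X" for p s
    using chain_boundary_boundary_alt[of "Suc p" X "frag_of s"] singular_simplex_order_simplices[OF finX that]
    by (simp add: singular_chain_of)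
  define P where "P p l \<longleftrightarrow>
      (\<forall>s\<in>order_simplices p X. order_chain p (?Y p s) (l s) \<and> (p = 0 \<longrightarrow> augmentation (l s) = frag_of ())) \<and>
      (\<forall>s\<in>order_simplices (Suc p) X.
        reduced_cycle p (frag_extend l (chain_boundary (Suc p) (frag_of s))))" for p l
  define Q where "Q p l l' \<longleftrightarrow> (\<forall>s\<in>order_simplices (Suc p) X.
      chain_boundary (Suc p) (l' s) = frag_extend l (chain_boundary (Suc p) (frag_of s)))"
    for p and l l' :: "((nat \<Rightarrow> real) \<Rightarrow> 'a) \<Rightarrow> 'b chain"
  have "\<exists>f. \<forall>p. P p (f p) \<and> Q p (f p) (f (Suc p))"
  proof (rule dependent_nat_choice)
    have "\<exists>c. order_chain 0 (?Y 0 s) c \<and> augmentation c = frag_of ()"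
      if s: "s \<in> order_simplices 0 X" for s
    proof -
      obtain y where "y \<in> topspace (?Y 0 s)"
        using acyc[OF s] by (auto simp: singular_acyclic_def)
      then have "order_simplex 0 (\<lambda>_. y) \<in> order_simplices 0 (?Y 0 s)"
        by (auto simp: order_simplices_def strict_chain_def intro!: exI[of _ "\<lambda>_. y"])
      then show ?thesis
        by (intro exI[of _ "frag_of (order_simplex 0 (\<lambda>_. y))"]) simp
    qed
    then obtain l where l: "\<And>s. s \<in> order_simplices 0 X \<Longrightarrow>
        order_chain 0 (?Y 0 s) (l s) \<and> augmentation (l s) = frag_of ()"
      by metis
    have "reduced_cycle 0 (frag_extend l (chain_boundary (Suc 0) (frag_of s)))"
      if s: "s \<in> order_simplices (Suc 0) X" for s
    proof -
      have "frag_extend (augmentation \<circ> l) (chain_boundary (Suc 0) (frag_of s)) =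
          augmentation (chain_boundary (Suc 0) (frag_of s))"
        unfolding augmentation_apply[of "chain_boundary _ _"]
        using keys_chain_boundary_order_simplex(1)[OF s] l by (intro frag_extend_eq) auto
      then show ?thesis
        by (simp add: reduced_cycle_def augmentation_extend augmentation_boundary)
    qed
    then show "\<exists>l. P 0 l"
      using l by (auto simp: P_def)
  next
    fix l p assume l: "P p l"
    have "\<exists>c. order_chain (Suc p) (?Y (Suc p) s) c \<and>
        chain_boundary (Suc p) c = frag_extend l (chain_boundary (Suc p) (frag_of s))"
      if s: "s \<in> order_simplices (Suc p) X" for s
    proof -
      let ?c = "frag_extend l (chain_boundary (Suc p) (frag_of s))"
      have "order_chain p (?Y (Suc p) s) ?c"
        using l mono[OF s] keys_chain_boundary_order_simplex[OF s]
        by (intro order_chain_extend) (auto simp: P_def)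
      moreover have "reduced_cycle p ?c"
        using l s by (simp add: P_def)
      ultimately have "order_chain p (?Y (Suc p) s) ?c" "singular_relboundary p (?Y (Suc p) s) {} ?c"
        using acyc[OF s] order_chain_imp_singular_chain[of "?Y (Suc p) s" p ?c] fin
        by (auto simp: singular_acyclic_def)
      then show ?thesis
        using order_chain_boundary_if_singular_boundary[OF finite_t0_space_subtopology[OF Y]] by metis
    qed
    then obtain l' where l': "\<And>s. s \<in> order_simplices (Suc p) X \<Longrightarrow>
        order_chain (Suc p) (?Y (Suc p) s) (l' s) \<and>
        chain_boundary (Suc p) (l' s) = frag_extend l (chain_boundary (Suc p) (frag_of s))"
      by metis
    have "reduced_cycle (Suc p) (frag_extend l' (chain_boundary (Suc (Suc p)) (frag_of s)))"
      if s: "s \<in> order_simplices (Suc (Suc p)) X" for s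
    proof -
      have "chain_boundary (Suc p) (frag_extend l' (chain_boundary (Suc (Suc p)) (frag_of s))) =
          frag_extend (\<lambda>t. frag_extend l (chain_boundary (Suc p) (frag_of t)))
            (chain_boundary (Suc (Suc p)) (frag_of s))"
        unfolding chain_boundary_extend
        using keys_chain_boundary_order_simplex(1)[OF s] l' by (intro frag_extend_eq) auto
      also have "\<dots> = 0"
        using bd2[OF s] by (simp flip: frag_extend_chain_boundary)
      finally show ?thesis
        by (simp add: reduced_cycle_def)
    qed
    then show "\<exists>l'. P (Suc p) l' \<and> Q p l l'"
      using l' by (intro exI[of _ l']) (auto simp: P_def Q_def)
  qed
  then obtain f where f: "\<And>p. P p (f p)" "\<And>p. Q p (f p) (f (Suc p))"
    by metis
  show ?thesis
  proof (rule that[of f])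
    show "carried_chain_map X Y \<Phi> f"
      using f order_chain_imp_singular_chain[of "?Y _ _"] fin
      unfolding carried_chain_map_def P_def Q_def by simp
    show "order_chain p Y (f p s)" if "s \<in> order_simplices p X" for p s
      using f(1)[of p] that unfolding P_def order_chain_subtopology[OF fin] by blast
  qed
qed

text \<open>The difference \<open>d\<close> of the two maps is null-homotopic. The homotopy is constructed degree by degree
  like the maps above: what it has to fill in degree \<open>p\<close> is a cycle of the carrier, and in degree 0
  one of augmentation 0.\<close>

theorem carried_chain_maps_homologous:
  assumes X: "finite_t0_space X" and \<Phi>: "acyclic_carrier X Y \<Phi>"
    and f: "carried_chain_map X Y \<Phi> f" and g: "carried_chain_map X Y \<Phi> g"
    and c: "order_chain p X c" "chain_boundary p c = 0"
  shows "homologous_rel p Y {} (frag_extend (f p) c) (frag_extend (g p) c)"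
proof -
  have finX: "finite (topspace X)"
    using X by (simp add: finite_t0_space_def)
  let ?Y = "\<lambda>p s. subtopology Y (\<Phi> (s ` standard_simplex p))"
  define d where "d p s = f p s - g p s" for p s
  have d: "singular_chain p (?Y p s) (d p s)" if "s \<in> order_simplices p X" for p s
    using f g that by (auto simp: carried_chain_map_def d_def intro: singular_chain_diff)
  have bd: "chain_boundary (Suc p) (d (Suc p) s) =
      frag_extend (d p) (chain_boundary (Suc p) (frag_of s))" if "s \<in> order_simplices (Suc p) X" for p s
    using f g that
    by (simp add: carried_chain_map_def d_def[abs_def] frag_extend_diff_fun chain_boundary_diff)
  have aug: "augmentation (d 0 s) = 0" if "s \<in> order_simplices 0 X" for s
    using f g that by (simp add: carried_chain_map_def d_def augmentation_diff)
  have acyc: "\<exists>w. singular_chain (Suc p) (?Y p s) w \<and> chain_boundary (Suc p) w = c"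
    if "s \<in> order_simplices p X" "singular_chain p (?Y p s) c" "reduced_cycle p c" for p s c
    using \<Phi> that by (auto simp: acyclic_carrier_def singular_acyclic_def simp flip: singular_boundary)
  have mono: "singular_chain q (?Y (Suc p) s) c"
    if "s \<in> order_simplices (Suc p) X" "t \<in> Poly_Mapping.keys (chain_boundary (Suc p) (frag_of s))"
      "singular_chain q (?Y p t) c" for p q s t c
    using singular_chain_mono[OF that(3)] keys_chain_boundary_order_simplex(2)[OF that(1,2)] \<Phi>
    by (auto simp: acyclic_carrier_def dest: monoD)
  have bd2: "chain_boundary (Suc p) (chain_boundary (Suc (Suc p)) (frag_of s)) = 0"
    if "s \<in> order_simplices (Suc (Suc p)) X" for p s
    using chain_boundary_boundary_alt[of "Suc p" X "frag_of s"] singular_simplex_order_simplices[OF finX that]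
    by (simp add: singular_chain_of)
  define P where "P p h \<longleftrightarrow>
      (\<forall>s\<in>order_simplices p X. singular_chain (Suc p) (?Y p s) (h s) \<and>
        (p = 0 \<longrightarrow> chain_boundary (Suc p) (h s) = d p s)) \<and>
      (\<forall>s\<in>order_simplices (Suc p) X. chain_boundary (Suc p) (frag_extend h (chain_boundary (Suc p) (frag_of s))) =
        frag_extend (d p) (chain_boundary (Suc p) (frag_of s)))" for p h
  define Q where "Q p h h' \<longleftrightarrow> (\<forall>s\<in>order_simplices (Suc p) X.
      chain_boundary (Suc (Suc p)) (h' s) =
        d (Suc p) s - frag_extend h (chain_boundary (Suc p) (frag_of s)))"
    for p and h h' :: "((nat \<Rightarrow> real) \<Rightarrow> 'a) \<Rightarrow> 'b chain"
  have "\<exists>h. \<forall>p. P p (h p) \<and> Q p (h p) (h (Suc p))"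
  proof (rule dependent_nat_choice)
    have "\<exists>w. singular_chain (Suc 0) (?Y 0 s) w \<and> chain_boundary (Suc 0) w = d 0 s"
      if s: "s \<in> order_simplices 0 X" for s
      by (rule acyc[OF s d[OF s]]) (simp add: reduced_cycle_def aug[OF s])
    then obtain h where h: "\<And>s. s \<in> order_simplices 0 X \<Longrightarrow>
        singular_chain (Suc 0) (?Y 0 s) (h s) \<and> chain_boundary (Suc 0) (h s) = d 0 s"
      by metis
    have "chain_boundary (Suc 0) (frag_extend h (chain_boundary (Suc 0) (frag_of s))) =
        frag_extend (d 0) (chain_boundary (Suc 0) (frag_of s))"
      if s: "s \<in> order_simplices (Suc 0) X" for s
      unfolding chain_boundary_extend
      using keys_chain_boundary_order_simplex(1)[OF s] h by (intro frag_extend_eq) auto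
    then show "\<exists>h. P 0 h"
      using h by (intro exI[of _ h]) (simp add: P_def)
  next
    fix h p assume h: "P p h"
    have "\<exists>w. singular_chain (Suc (Suc p)) (?Y (Suc p) s) w \<and>
        chain_boundary (Suc (Suc p)) w = d (Suc p) s - frag_extend h (chain_boundary (Suc p) (frag_of s))"
      if s: "s \<in> order_simplices (Suc p) X" for s
    proof (rule acyc[OF s])
      have "singular_chain (Suc p) (?Y (Suc p) s) (frag_extend h (chain_boundary (Suc p) (frag_of s)))"
        using h mono[OF s] keys_chain_boundary_order_simplex[OF s]
        by (intro singular_chain_extend) (auto simp: P_def)
      then show "singular_chain (Suc p) (?Y (Suc p) s)
          (d (Suc p) s - frag_extend h (chain_boundary (Suc p) (frag_of s)))"
        using d[OF s] by (intro singular_chain_diff)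
      show "reduced_cycle (Suc p) (d (Suc p) s - frag_extend h (chain_boundary (Suc p) (frag_of s)))"
        using h s bd[OF s] by (simp add: reduced_cycle_def chain_boundary_diff P_def)
    qed
    then obtain h' where h': "\<And>s. s \<in> order_simplices (Suc p) X \<Longrightarrow>
        singular_chain (Suc (Suc p)) (?Y (Suc p) s) (h' s) \<and>
        chain_boundary (Suc (Suc p)) (h' s) =
          d (Suc p) s - frag_extend h (chain_boundary (Suc p) (frag_of s))"
      by metis
    have "chain_boundary (Suc (Suc p)) (frag_extend h' (chain_boundary (Suc (Suc p)) (frag_of s))) =
        frag_extend (d (Suc p)) (chain_boundary (Suc (Suc p)) (frag_of s))"
      if s: "s \<in> order_simplices (Suc (Suc p)) X" for s
    proof -
      have "chain_boundary (Suc (Suc p)) (frag_extend h' (chain_boundary (Suc (Suc p)) (frag_of s))) =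
          frag_extend (\<lambda>t. d (Suc p) t - frag_extend h (chain_boundary (Suc p) (frag_of t)))
            (chain_boundary (Suc (Suc p)) (frag_of s))"
        unfolding chain_boundary_extend
        using keys_chain_boundary_order_simplex(1)[OF s] h' by (intro frag_extend_eq) auto
      then show ?thesis
        using bd2[OF s] by (simp add: frag_extend_diff_fun flip: frag_extend_chain_boundary)
    qed
    then show "\<exists>h'. P (Suc p) h' \<and> Q p h h'"
      using h' by (intro exI[of _ h']) (auto simp: P_def Q_def)
  qed
  then obtain h where h: "\<And>p. P p (h p)" "\<And>p. Q p (h p) (h (Suc p))"
    by metis
  have keys: "s \<in> order_simplices p X" if "s \<in> Poly_Mapping.keys c" for s
    using c(1) that by (auto simp: order_chain_def)
  have "chain_boundary (Suc p) (frag_extend (h p) c) = frag_extend (d p) c"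
  proof (cases p)
    case 0
    then show ?thesis
      unfolding chain_boundary_extend
      using keys h(1)[of 0] by (intro frag_extend_eq) (auto simp: P_def)
  next
    case (Suc q)
    have "chain_boundary (Suc p) (frag_extend (h p) c) =
        frag_extend (\<lambda>s. d p s - frag_extend (h q) (chain_boundary p (frag_of s))) c"
      unfolding chain_boundary_extend
      using keys h(2)[of q] Suc by (intro frag_extend_eq) (auto simp: Q_def)
    then show ?thesis
      using c(2) by (simp add: frag_extend_diff_fun flip: frag_extend_chain_boundary)
  qed
  moreover have "singular_chain (Suc p) Y (frag_extend (h p) c)"
    using keys h(1)[of p] by (intro singular_chain_extend) (auto simp: P_def singular_chain_subtopology)
  ultimately have "singular_relboundary p Y {} (frag_extend (d p) c)"
    unfolding singular_boundary by blast
  then show ?thesis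
    by (simp add: homologous_rel_def d_def[abs_def] frag_extend_diff_fun)
qed

lemma carried_chain_map_weaken:
  assumes fin: "finite (topspace X)" and f: "carried_chain_map X Y \<Phi> f"
    and sub: "\<And>Q. Q \<subseteq> topspace X \<Longrightarrow> \<Phi> Q \<subseteq> \<Psi> Q"
  shows "carried_chain_map X Y \<Psi> f"
proof -
  have "s ` standard_simplex p \<subseteq> topspace X" if "s \<in> order_simplices p X" for p s
    using singular_simplex_order_simplices[OF fin that]
    by (auto simp: singular_simplex_def continuous_map_def)
  then have "\<Phi> (s ` standard_simplex p) \<subseteq> \<Psi> (s ` standard_simplex p)"
    if "s \<in> order_simplices p X" for p s
    using that by (intro sub)
  then have "singular_chain p (subtopology Y (\<Psi> (s ` standard_simplex p))) (f p s)"
    if "s \<in> order_simplices p X" for p s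
    using f that singular_chain_mono[of p Y "\<Phi> (s ` standard_simplex p)" "f p s"]
    by (simp add: carried_chain_map_def)
  then show ?thesis
    using f by (simp add: carried_chain_map_def)
qed

lemma carried_chain_map_extend:
  assumes f: "carried_chain_map X Y \<Phi> f" and c: "order_chain (Suc p) X c"
  shows "chain_boundary (Suc p) (frag_extend (f (Suc p)) c) =
    frag_extend (f p) (chain_boundary (Suc p) c)"
  unfolding chain_boundary_extend frag_extend_chain_boundary[of _ _ c]
  using f c by (intro frag_extend_eq) (auto simp: carried_chain_map_def order_chain_def)

lemma carried_chain_map_comp:
  assumes f: "carried_chain_map X Y \<Phi> f" and g: "carried_chain_map Y Z \<Psi> g" and \<Psi>: "mono \<Psi>"
    and fin: "finite (topspace Y)"
    and order: "\<And>p s. s \<in> order_simplices p X \<Longrightarrow> order_chain p Y (f p s)"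
  shows "carried_chain_map X Z (\<Psi> \<circ> \<Phi>) (\<lambda>p s. frag_extend (g p) (f p s))"
  unfolding carried_chain_map_def
proof (intro conjI allI ballI)
  fix p s assume s: "s \<in> order_simplices p X"
  show "singular_chain p (subtopology Z ((\<Psi> \<circ> \<Phi>) (s ` standard_simplex p))) (frag_extend (g p) (f p s))"
  proof (rule singular_chain_extend)
    fix t assume t: "t \<in> Poly_Mapping.keys (f p s)"
    then have "t \<in> order_simplices p Y"
      using order[OF s] by (auto simp: order_chain_def)
    then have "singular_chain p (subtopology Z (\<Psi> (t ` standard_simplex p))) (g p t)"
      using g by (simp add: carried_chain_map_def)
    moreover have "t ` standard_simplex p \<subseteq> \<Phi> (s ` standard_simplex p)"
      using f s t unfolding carried_chain_map_def singular_chain_subtopology by blast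
    ultimately show "singular_chain p (subtopology Z ((\<Psi> \<circ> \<Phi>) (s ` standard_simplex p))) (g p t)"
      using singular_chain_mono[OF _ monoD[OF \<Psi>]] by simp
  qed
next
  fix p s assume s: "s \<in> order_simplices (Suc p) X"
  then show "chain_boundary (Suc p) (frag_extend (g (Suc p)) (f (Suc p) s)) =
      frag_extend (\<lambda>s. frag_extend (g p) (f p s)) (chain_boundary (Suc p) (frag_of s))"
    using carried_chain_map_extend[OF g order[OF s]] f
    by (simp add: carried_chain_map_def frag_extend_frag_extend)
next
  fix s assume s: "s \<in> order_simplices 0 X"
  have "augmentation (frag_extend (g 0) (f 0 s)) = augmentation (f 0 s)"
    unfolding augmentation_extend unfolding augmentation_apply[of "f 0 s"]
    using g order[OF s] by (intro frag_extend_eq) (auto simp: carried_chain_map_def order_chain_def)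
  then show "augmentation (frag_extend (g 0) (f 0 s)) = frag_of ()"
    using f s by (simp add: carried_chain_map_def)
qed

lemma carried_chain_map_continuous:
  assumes fin: "finite (topspace X)" and r: "continuous_map X Y r"
  shows "carried_chain_map X Y ((`) r) (\<lambda>p s. frag_of (simplex_map p r s))"
  unfolding carried_chain_map_def
proof (intro conjI allI ballI)
  fix p s assume "s \<in> order_simplices p X"
  then have "singular_simplex p Y (simplex_map p r s)"
    using singular_simplex_order_simplices[OF fin] singular_simplex_simplex_map[OF _ r] by blast
  then show "singular_chain p (subtopology Y (r ` s ` standard_simplex p)) (frag_of (simplex_map p r s))"
    by (auto simp: singular_chain_of singular_simplex_subtopology simplex_map_def)
next
  fix p s assume "s \<in> order_simplices (Suc p) X"
  then have "singular_chain (Suc p) X (frag_of s)"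
    using singular_simplex_order_simplices[OF fin] by (simp add: singular_chain_of)
  then show "chain_boundary (Suc p) (frag_of (simplex_map (Suc p) r s)) =
      frag_extend (\<lambda>s. frag_of (simplex_map p r s)) (chain_boundary (Suc p) (frag_of s))"
    using chain_boundary_chain_map[of "Suc p" X "frag_of s" r] by (simp add: chain_map_def comp_def)
qed simp

lemma carried_chain_map_identity:
  assumes fin: "finite (topspace X)"
  shows "carried_chain_map X X (\<lambda>Q. Q) (\<lambda>p. frag_of)"
  unfolding carried_chain_map_def frag_expansion[symmetric] singular_chain_of
    singular_simplex_subtopology
  using singular_simplex_order_simplices[OF fin] by simp

section \<open>The chain map of a Vietoris-like multivalued map\<close>

lemma maximum_imp_singular_acyclic_subspace:
  assumes fin: "finite (topspace X)" and "Q \<subseteq> topspace X" "x \<in> Q" "\<And>y. y \<in> Q \<Longrightarrow> spec_le X y x"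
  shows "singular_acyclic (subtopology X Q)"
proof (rule contractible_space_imp_singular_acyclic)
  show "contractible_space (subtopology X Q)"
    using assms by (intro maximum_imp_contractible_space[of _ x]) (auto simp: spec_le_subtopology)
qed (use assms in auto)

lemma strict_chain_le:
  assumes "strict_chain X p v" "i \<le> j" "j \<le> p"
  shows "spec_le X (v i) (v j)"
  using assms spec_le_refl[of "v i" X]
  by (cases "i = j") (auto simp: strict_chain_def spec_less_def)

text \<open>The image of a simplex is a chain; its maximum makes it contractible.\<close>

lemma acyclic_carrier_monotone_image:
  assumes Y: "finite (topspace Y)"
    and r: "\<And>x x'. spec_le X x x' \<Longrightarrow> spec_le Y (r x) (r x')"
  shows "acyclic_carrier X Y ((`) r)"
  unfolding acyclic_carrier_def
proof (intro conjI allI ballI)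
  fix p s assume "s \<in> order_simplices p X"
  then obtain v where v: "s = order_simplex p v" "strict_chain X p v"
    by (auto simp: order_simplices_def)
  have "spec_le Y (r (v i)) (r (v p))" if "i \<le> p" for i
    using r strict_chain_le[OF v(2) that order_refl] .
  then show "singular_acyclic (subtopology Y (r ` s ` standard_simplex p))"
    unfolding v(1) image_order_simplex
    by (intro maximum_imp_singular_acyclic_subspace[OF Y, of _ "r (v p)"]) (auto simp: spec_le_def)
qed (auto simp: mono_def)

lemma monotone_sequence_strict_list:
  fixes p :: nat
  assumes "\<And>i j. i \<le> j \<Longrightarrow> j \<le> p \<Longrightarrow> spec_le Y (v i) (v j)" and Y: "finite_t0_space Y"
  shows "\<exists>ys. ys \<noteq> [] \<and> set ys = v ` {..p} \<and> sorted_wrt (spec_less Y) ys"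
  using assms(1)
proof (induction p)
  case 0
  show ?case by (intro exI[of _ "[v 0]"]) simp
next
  case (Suc p)
  then obtain ys where ys: "ys \<noteq> []" "set ys = v ` {..p}" "sorted_wrt (spec_less Y) ys"
    by auto
  show ?case
  proof (cases "v (Suc p) \<in> set ys")
    case True
    then show ?thesis
      using ys by (intro exI[of _ ys]) (auto simp: atMost_Suc)
  next
    case False
    have "spec_less Y y (v (Suc p))" if y: "y \<in> set ys" for y
    proof -
      have "spec_le Y y (v (Suc p))"
        using y Suc.prems[of _ "Suc p"] ys(2) by auto
      then show ?thesis
        using y False by (auto simp: spec_less_def)
    qed
    then show ?thesis
      using ys by (intro exI[of _ "ys @ [v (Suc p)]"]) (auto simp: sorted_wrt_append atMost_Suc)
  qed
qed

text \<open>Discarding the repetitions of a weakly increasing sequence leaves a chain as in the definition of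
  Vietoris-like maps. Repetitions arise when simplices of the graph are projected.\<close>

lemma vietoris_like_map_acyclic_preimage:
  fixes p :: nat
  assumes f: "vietoris_like_map X Y f" and Y: "finite_t0_space Y"
    and v: "\<And>i j. i \<le> j \<Longrightarrow> j \<le> p \<Longrightarrow> spec_le Y (v i) (v j)"
  shows "singular_acyclic (subtopology X {x \<in> topspace X. f x \<in> v ` {..p}})"
proof -
  obtain ys where ys: "ys \<noteq> []" "set ys = v ` {..p}" "sorted_wrt (spec_less Y) ys"
    using monotone_sequence_strict_list[of p Y v, OF v Y] by auto
  have "set ys \<subseteq> topspace Y"
    using v[OF order_refl] unfolding ys(2) by (auto simp: spec_le_def)
  then have "acyclic_space (subtopology X (\<Union>y\<in>set ys. {x \<in> topspace X. f x = y}))"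
    using f ys(1,3) unfolding vietoris_like_map_def by blast
  moreover have "(\<Union>y\<in>set ys. {x \<in> topspace X. f x = y}) = {x \<in> topspace X. f x \<in> v ` {..p}}"
    unfolding ys(2) by auto
  ultimately show ?thesis
    by (simp only: acyclic_space_imp_singular_acyclic)
qed

lemma vietoris_like_map_acyclic_carrier:
  assumes f: "vietoris_like_map X Y f" and Y: "finite_t0_space Y"
  shows "acyclic_carrier Y X (\<lambda>Q. {x \<in> topspace X. f x \<in> Q})"
  unfolding acyclic_carrier_def
proof (intro conjI allI ballI)
  fix p s assume "s \<in> order_simplices p Y"
  then obtain v where v: "s = order_simplex p v" "strict_chain Y p v"
    by (auto simp: order_simplices_def)
  show "singular_acyclic (subtopology X {x \<in> topspace X. f x \<in> s ` standard_simplex p})"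
    unfolding v(1) image_order_simplex
    by (rule vietoris_like_map_acyclic_preimage[OF f Y]) (rule strict_chain_le[OF v(2)])
qed (auto simp: mono_def)

lemma carried_chain_map_cycle:
  assumes f: "carried_chain_map X Y \<Phi> f" and c: "order_chain p X c" "chain_boundary p c = 0"
  shows "singular_relcycle p Y {} (frag_extend (f p) c)"
proof -
  have "singular_chain p Y (frag_extend (f p) c)"
    using f c(1) by (intro singular_chain_extend)
      (auto simp: carried_chain_map_def order_chain_def singular_chain_subtopology)
  moreover have "chain_boundary p (frag_extend (f p) c) = 0"
    using carried_chain_map_extend[OF f, of "p - 1" c] c by (cases p) auto
  ultimately show ?thesis
    by (simp add: singular_cycle)
qed

lemma homology_class_order_cycle:
  assumes X: "finite_t0_space X" and x: "x \<in> carrier (homology_group (int p) X)"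
  obtains c where "order_chain p X c" "chain_boundary p c = 0" "x = homologous_rel_set p X {} c"
proof -
  obtain z where z: "x = homologous_rel_set p X {} z" "singular_relcycle p X {} z"
    using x by (auto simp: carrier_relative_homology_group)
  then obtain c w where c: "order_chain p X c" "singular_chain (Suc p) X w"
      "z = c + chain_boundary (Suc p) w"
    using singular_chain_homologous_order_chain[OF X, of p z] by (auto simp: singular_cycle)
  have "homologous_rel p X {} z c"
    using c by (auto simp: homologous_rel_def singular_boundary)
  then have "x = homologous_rel_set p X {} c"
    using z(1) by (simp add: homologous_rel_set_eq)
  moreover have "chain_boundary p c = 0"
    using z(2) c(3) chain_boundary_boundary_alt[OF c(2)] by (simp add: singular_cycle chain_boundary_add)
  ultimately show ?thesis
    using that c(1) by blast
qed

lemma frag_extend_simplex_map: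
  "frag_extend (\<lambda>s. frag_of (simplex_map p r s)) c = chain_map p r c"
  by (simp add: chain_map_def comp_def)

text \<open>For \<open>G\<close> the graph of \<open>F\<close> let \<open>l\<close>, \<open>k\<close>, \<open>m\<close> be carried by the preimages under the first projection and
  by the images under the first and the second projection. Comparing carriers, the first
  projection maps \<open>l c\<close> to a cycle homologous to \<open>c\<close>, the chain map \<open>k\<close> represents the first
  projection, the composition \<open>l \<circ> k\<close> the identity of \<open>G\<close>, and \<open>m\<close> the second projection. Hence the class of
  \<open>l c\<close> is the only preimage of the class of \<open>c\<close>, and every choice of an inverse in the
  definition of the induced map has to return it.\<close>

theorem multi_induced_order_cycle:
  assumes X: "finite_t0_space X" and Y: "finite_t0_space Y" and F: "vietoris_like_multimap X Y F"
  obtains l m where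
    "carried_chain_map X (multi_graph X Y F) (\<lambda>Q. {z \<in> topspace (multi_graph X Y F). fst z \<in> Q}) l"
    "\<And>p s. s \<in> order_simplices p X \<Longrightarrow> order_chain p (multi_graph X Y F) (l p s)"
    "carried_chain_map (multi_graph X Y F) Y ((`) snd) m"
    "\<And>p s. s \<in> order_simplices p (multi_graph X Y F) \<Longrightarrow> order_chain p Y (m p s)"
    "\<And>p c. order_chain p X c \<Longrightarrow> chain_boundary p c = 0 \<Longrightarrow>
      multi_induced (int p) X Y F (homologous_rel_set p X {} c) =
      homologous_rel_set p Y {} (frag_extend (m p) (frag_extend (l p) c))"
proof -
  define G where "G = multi_graph X Y F"
  let ?P = "\<lambda>Q. {z \<in> topspace G. fst z \<in> Q}"
  have fin: "finite (topspace X)" "finite (topspace Y)"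
    using X Y by (simp_all add: finite_t0_space_def)
  have G: "finite_t0_space G"
    unfolding G_def multi_graph_def
    by (intro finite_t0_space_subtopology)
      (use X Y in \<open>auto simp: finite_t0_space_def intro: t0_space_prod_topologyI\<close>)
  have finG: "finite (topspace G)"
    using G by (simp add: finite_t0_space_def)
  have fst: "vietoris_like_map G X fst"
    using F by (simp add: vietoris_like_multimap_def G_def)
  then have cfst: "continuous_map G X fst"
    by (simp add: vietoris_like_map_def)
  have csnd: "continuous_map G Y snd"
    unfolding G_def multi_graph_def by (intro continuous_map_from_subtopology continuous_map_snd)
  have le: "spec_le X (fst z) (fst z')" "spec_le Y (snd z) (snd z')" if "spec_le G z z'" for z z'
    using that spec_le_subtopology_prod[OF fin, of _ "fst z" "snd z" "fst z'" "snd z'"]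
    unfolding G_def multi_graph_def prod.collapse by blast+
  have acP: "acyclic_carrier X G ?P"
    by (rule vietoris_like_map_acyclic_carrier[OF fst X])
  have acX: "acyclic_carrier X X (\<lambda>Q. Q)"
  proof -
    have "acyclic_carrier X X ((`) (\<lambda>x. x))"
      by (rule acyclic_carrier_monotone_image[OF fin(1)])
    moreover have "(`) (\<lambda>x::'a. x) = (\<lambda>Q. Q)"
      by (rule ext) simp
    ultimately show ?thesis by simp
  qed
  have ac1: "acyclic_carrier G X ((`) fst)"
    using le(1) by (rule acyclic_carrier_monotone_image[OF fin(1)])
  have ac2: "acyclic_carrier G Y ((`) snd)"
    using le(2) by (rule acyclic_carrier_monotone_image[OF fin(2)])
  obtain l where l: "carried_chain_map X G ?P l"
    and lo: "\<And>p s. s \<in> order_simplices p X \<Longrightarrow> order_chain p G (l p s)"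
    by (rule carried_chain_map_exists[OF X G acP]) (rule that)
  obtain k where k: "carried_chain_map G X ((`) fst) k"
    and ko: "\<And>p s. s \<in> order_simplices p G \<Longrightarrow> order_chain p X (k p s)"
    by (rule carried_chain_map_exists[OF G X ac1]) (rule that)
  obtain m where m: "carried_chain_map G Y ((`) snd) m"
    and mo: "\<And>p s. s \<in> order_simplices p G \<Longrightarrow> order_chain p Y (m p s)"
    by (rule carried_chain_map_exists[OF G Y ac2]) (rule that)
  have mono_fst: "mono ((`) fst)" and mono_P: "mono ?P"
    by (auto simp: mono_def)
  have l_chain: "order_chain p G (frag_extend (l p) c)" if "order_chain p X c" for p c
    using that lo by (intro order_chain_extend) (auto simp: order_chain_def[of p X])
  have k_chain: "order_chain p X (frag_extend (k p) c)" if "order_chain p G c" for p c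
    using that ko by (intro order_chain_extend) (auto simp: order_chain_def[of p G])
  \<comment> \<open>The composition of \<open>l\<close> with the first projection and the identity are both carried by
    the simplices themselves, so \<open>l\<close> is a section in homology.\<close>
  have fst_l: "homologous_rel p X {} (chain_map p fst (frag_extend (l p) c)) c"
    if c: "order_chain p X c" "chain_boundary p c = 0" for p c
  proof -
    have "carried_chain_map X X (\<lambda>Q. Q) (\<lambda>p s. frag_extend (\<lambda>s. frag_of (simplex_map p fst s)) (l p s))"
      using carried_chain_map_comp[OF l carried_chain_map_continuous[OF finG cfst] mono_fst finG lo]
      by (rule carried_chain_map_weaken[OF fin(1)]) auto
    from carried_chain_maps_homologous[OF X acX this carried_chain_map_identity[OF fin(1)] c]
    show ?thesis
      unfolding frag_extend_simplex_map[symmetric] frag_extend_frag_extend frag_expansion[symmetric] .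
  qed
  have fst_k: "homologous_rel p X {} (chain_map p fst c) (frag_extend (k p) c)"
    if c: "order_chain p G c" "chain_boundary p c = 0" for p c
    using carried_chain_maps_homologous[OF G ac1 carried_chain_map_continuous[OF finG cfst] k c]
    by (simp add: frag_extend_simplex_map)
  have snd_m: "homologous_rel p Y {} (chain_map p snd c) (frag_extend (m p) c)"
    if c: "order_chain p G c" "chain_boundary p c = 0" for p c
    using carried_chain_maps_homologous[OF G ac2 carried_chain_map_continuous[OF finG csnd] m c]
    by (simp add: frag_extend_simplex_map)
  \<comment> \<open>Both \<open>l \<circ> k\<close> and the identity are carried by the preimages of the first projections.\<close>
  have l_k: "homologous_rel p G {} (frag_extend (l p) (frag_extend (k p) c)) c"
    if c: "order_chain p G c" "chain_boundary p c = 0" for p c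
  proof -
    have ac: "acyclic_carrier G G (?P \<circ> (`) fst)"
      unfolding acyclic_carrier_def
    proof (intro conjI allI ballI)
      show "mono (?P \<circ> (`) fst)"
        by (auto simp: mono_def)
      fix p s assume s: "s \<in> order_simplices p G"
      then obtain v where v: "s = order_simplex p v" "strict_chain G p v"
        by (auto simp: order_simplices_def)
      have "spec_le X (fst (v i)) (fst (v j))" if "i \<le> j" "j \<le> p" for i j
        using strict_chain_le[OF v(2) that] by (rule le(1))
      from vietoris_like_map_acyclic_preimage[OF fst X this]
      show "singular_acyclic (subtopology G ((?P \<circ> (`) fst) (s ` standard_simplex p)))"
        unfolding v(1) image_order_simplex comp_apply image_image .
    qed
    have 1: "carried_chain_map G G (?P \<circ> (`) fst) (\<lambda>p s. frag_extend (l p) (k p s))"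
      by (rule carried_chain_map_comp[OF k l mono_P fin(1) ko])
    have 2: "carried_chain_map G G (?P \<circ> (`) fst) (\<lambda>p. frag_of)"
      by (rule carried_chain_map_weaken[OF finG carried_chain_map_identity[OF finG]]) auto
    from carried_chain_maps_homologous[OF G ac 1 2 c] show ?thesis
      unfolding frag_extend_frag_extend frag_expansion[symmetric] .
  qed
  have main: "multi_induced (int p) X Y F (homologous_rel_set p X {} c) =
      homologous_rel_set p Y {} (frag_extend (m p) (frag_extend (l p) c))"
    if c: "order_chain p X c" "chain_boundary p c = 0" for p c
  proof -
    let ?fst = "hom_induced (int p) G {} X {} fst"
    let ?lc = "frag_extend (l p) c"
    have lc: "order_chain p G ?lc" "chain_boundary p ?lc = 0" "singular_relcycle p G {} ?lc"
      using l_chain[OF c(1)] carried_chain_map_cycle[OF l c] by (auto simp: singular_cycle)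
    have fst_lc: "?fst (homologous_rel_set p G {} ?lc) = homologous_rel_set p X {} c"
      using fst_l[OF c] hom_induced_chain_map[OF cfst _ lc(3), of "{}"]
      by (simp add: homologous_rel_set_eq)
    have carr: "homologous_rel_set p G {} ?lc \<in> carrier (homology_group (int p) G)"
      using lc(3) by (simp add: carrier_relative_homology_group)
    have unique: "y = homologous_rel_set p G {} ?lc"
      if y: "y \<in> carrier (homology_group (int p) G)" "?fst y = homologous_rel_set p X {} c" for y
    proof -
      obtain u where u: "order_chain p G u" "chain_boundary p u = 0" "y = homologous_rel_set p G {} u"
        by (rule homology_class_order_cycle[OF G y(1)])
      have "singular_relcycle p G {} u"
        using u order_chain_imp_singular_chain[OF finG] by (simp add: singular_cycle)
      then have "homologous_rel p X {} (chain_map p fst u) c"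
        using y(2) hom_induced_chain_map[OF cfst, of "{}" "{}" p u]
        by (simp add: u(3) homologous_rel_set_eq)
      then have "homologous_rel p X {} (frag_extend (k p) u) c"
        using fst_k[OF u(1,2)] homologous_rel_sym homologous_rel_trans by metis
      then have "singular_relboundary p X {} (frag_extend (k p) u - c)"
        by (simp add: homologous_rel_def)
      then obtain w where w: "order_chain (Suc p) X w"
          "chain_boundary (Suc p) w = frag_extend (k p) u - c"
        by (rule order_chain_boundary_if_singular_boundary[OF X
            order_chain_diff[OF k_chain[OF u(1)] c(1)]])
      have "chain_boundary (Suc p) (frag_extend (l (Suc p)) w) =
          frag_extend (l p) (frag_extend (k p) u) - ?lc"
        using carried_chain_map_extend[OF l w(1)] by (simp add: w(2) frag_extend_diff)
      moreover have "singular_chain (Suc p) G (frag_extend (l (Suc p)) w)"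
        using order_chain_imp_singular_chain[OF finG l_chain[OF w(1)]] .
      ultimately have "homologous_rel p G {} (frag_extend (l p) (frag_extend (k p) u)) ?lc"
        unfolding homologous_rel_def singular_boundary by blast
      then have "homologous_rel p G {} u ?lc"
        using l_k[OF u(1,2)] homologous_rel_sym homologous_rel_trans by metis
      then show ?thesis
        by (simp add: u(3) homologous_rel_set_eq)
    qed
    have "homologous_rel_set p X {} c \<in> ?fst ` carrier (homology_group (int p) G)"
      using carr fst_lc by (metis imageI)
    then have "inv_into (carrier (homology_group (int p) G)) ?fst (homologous_rel_set p X {} c) =
        homologous_rel_set p G {} ?lc"
      by (intro unique inv_into_into f_inv_into_f)
    then have "multi_induced (int p) X Y F (homologous_rel_set p X {} c) =
        hom_induced (int p) G {} Y {} snd (homologous_rel_set p G {} ?lc)"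
      by (simp add: multi_induced_def G_def)
    also have "\<dots> = homologous_rel_set p Y {} (frag_extend (m p) ?lc)"
      using snd_m[OF lc(1,2)] hom_induced_chain_map[OF csnd _ lc(3), of "{}"]
      by (simp add: homologous_rel_set_eq)
    finally show ?thesis .
  qed
  show ?thesis
    by (rule that[of l m, folded G_def, OF l lo m mo main])
qed

section \<open>Traces of maps between finitely generated free abelian groups\<close>

lemma lookup_frag_extend:
  assumes "finite K" "Poly_Mapping.keys c \<subseteq> K"
  shows "Poly_Mapping.lookup (frag_extend f c) x = (\<Sum>y\<in>K. Poly_Mapping.lookup c y * Poly_Mapping.lookup (f y) x)"
proof -
  have "Poly_Mapping.lookup (frag_extend f c) x = (\<Sum>y\<in>Poly_Mapping.keys c. Poly_Mapping.lookup c y * Poly_Mapping.lookup (f y) x)"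
    by (simp add: frag_extend_def lookup_sum)
  also have "\<dots> = (\<Sum>y\<in>K. Poly_Mapping.lookup c y * Poly_Mapping.lookup (f y) x)"
    using assms by (intro sum.mono_neutral_left) (auto simp: in_keys_iff)
  finally show ?thesis .
qed

lemma keys_frag_extend_subset:
  "(\<And>x. x \<in> Poly_Mapping.keys c \<Longrightarrow> Poly_Mapping.keys (f x) \<subseteq> T) \<Longrightarrow> Poly_Mapping.keys (frag_extend f c) \<subseteq> T"
  using keys_frag_extend[of f c] by blast

text \<open>\<open>J\<close> is a basis of \<open>A\<close> modulo the common kernel of the functionals \<open>\<eta>\<close>, and \<open>\<xi>\<close> its dual basis. The
  weights \<open>w\<close> express the dual basis rationally, with denominator \<open>N\<close>, by the functionals \<open>\<eta>\<close>: where
  these are defined on all chains, the dual basis extends beyond \<open>A\<close>.\<close>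

definition dual_basis_modulo ::
    "'y set \<Rightarrow> ('x \<Rightarrow>\<^sub>0 int) set \<Rightarrow> ('y \<Rightarrow> ('x \<Rightarrow>\<^sub>0 int) \<Rightarrow> int) \<Rightarrow> ('x \<Rightarrow>\<^sub>0 int) set \<Rightarrow>
      (('x \<Rightarrow>\<^sub>0 int) \<Rightarrow> ('x \<Rightarrow>\<^sub>0 int) \<Rightarrow> int) \<Rightarrow> (('x \<Rightarrow>\<^sub>0 int) \<Rightarrow> 'y \<Rightarrow> int) \<Rightarrow> int \<Rightarrow> bool"
  where "dual_basis_modulo S A \<eta> J \<xi> w N \<longleftrightarrow> N > 0 \<and> finite J \<and> J \<subseteq> A \<and>
    (\<forall>j\<in>J. \<forall>a\<in>A. N * \<xi> j a = (\<Sum>y\<in>S. w j y * \<eta> y a)) \<and>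
    (\<forall>j\<in>J. \<forall>k\<in>J. \<xi> j k = (if j = k then 1 else 0)) \<and>
    (\<forall>a\<in>A. (\<forall>j\<in>J. \<xi> j a = 0) \<longrightarrow> (\<forall>y\<in>S. \<eta> y a = 0))"

lemma dual_basis_moduloD:
  assumes "dual_basis_modulo S A \<eta> J \<xi> w N"
  shows "N > 0" "finite J" "J \<subseteq> A"
    "\<And>j a. j \<in> J \<Longrightarrow> a \<in> A \<Longrightarrow> N * \<xi> j a = (\<Sum>y\<in>S. w j y * \<eta> y a)"
    "\<And>j k. j \<in> J \<Longrightarrow> k \<in> J \<Longrightarrow> \<xi> j k = (if j = k then 1 else 0)"
    "\<And>a. a \<in> A \<Longrightarrow> (\<And>j. j \<in> J \<Longrightarrow> \<xi> j a = 0) \<Longrightarrow> \<forall>y\<in>S. \<eta> y a = 0"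
  using assms unfolding dual_basis_modulo_def by simp_all

text \<open>Induction on the number of functionals. The values of one functional on \<open>A\<close> form a
  subgroup \<open>d\<int>\<close> of the integers; an element with value \<open>d\<close> extends a basis of the kernel of this
  functional. That subgroups of free abelian groups of finite rank are free, and that the quotient by
  the torsion is free as well, is contained in this statement.\<close>

lemma integral_dual_basis:
  fixes \<eta> :: "'y \<Rightarrow> ('x \<Rightarrow>\<^sub>0 int) \<Rightarrow> int"
  assumes S: "finite S" and A: "0 \<in> A" "\<And>a b. a \<in> A \<Longrightarrow> b \<in> A \<Longrightarrow> a - b \<in> A"
    and \<eta>: "\<And>y a b. y \<in> S \<Longrightarrow> a \<in> A \<Longrightarrow> b \<in> A \<Longrightarrow> \<eta> y (a - b) = \<eta> y a - \<eta> y b"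
  shows "\<exists>J \<xi> w N. dual_basis_modulo S A \<eta> J \<xi> w N"
  using S A \<eta>
proof (induction S arbitrary: A rule: finite_induct)
  case empty
  show ?case by (rule exI[of _ "{}"]) (auto simp: dual_basis_modulo_def intro: exI[of _ 1])
next
  case (insert x S)
  note A = insert.prems(1,2)
  have cmul: "frag_cmul k a \<in> A" if "a \<in> A" for k a
    by (rule frag_closure_minus_cmul[of "\<lambda>a. a \<in> A"]) (use A that in auto)
  have \<eta>_cmul: "\<eta> y (frag_cmul k a) = k * \<eta> y a" if "a \<in> A" "y \<in> insert x S" for k a y
  proof -
    have 0: "\<eta> y 0 = 0"
      using insert.prems(3)[OF that(2) A(1) A(1)] by simp
    have minus: "\<eta> y (- b) = - \<eta> y b" if "b \<in> A" for b
      using insert.prems(3)[OF \<open>y \<in> insert x S\<close> A(1) that] 0 by simp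
    have nat: "\<eta> y (frag_cmul (int n) a) = int n * \<eta> y a" for n
    proof (induction n)
      case (Suc n)
      have "frag_cmul (int (Suc n)) a = frag_cmul (int n) a - (- a)"
        by (simp add: frag_cmul_distrib add.commute)
      moreover have "- a \<in> A" using A(2)[OF A(1) that(1)] by simp
      ultimately show ?case
        using insert.prems(3)[OF that(2) cmul[OF that(1)], of "- a" "int n"] Suc minus[OF that(1)]
        by (simp only:) (simp add: algebra_simps)
    qed (simp add: 0)
    show ?thesis
    proof (cases "0 \<le> k")
      case True
      then show ?thesis using nat[of "nat k"] by simp
    next
      case False
      then show ?thesis
        using nat[of "nat (- k)"] minus[OF cmul[OF that(1), of "- k"]] by simp
    qed
  qed
  define A' where "A' = {a \<in> A. \<eta> x a = 0}"
  have "\<exists>J \<xi> w N. dual_basis_modulo S A' \<eta> J \<xi> w N"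
    using insert.prems(3)[of x 0 0] A insert.prems(3)
    by (intro insert.IH) (auto simp: A'_def)
  then obtain J \<xi> w N where db: "dual_basis_modulo S A' \<eta> J \<xi> w N"
    by blast
  note N = dual_basis_moduloD(1)[OF db] and J = dual_basis_moduloD(2,3)[OF db]
    and w = dual_basis_moduloD(4)[OF db] and dual = dual_basis_moduloD(5)[OF db]
    and ker = dual_basis_moduloD(6)[OF db]
  show ?case
  proof (cases "A' = A")
    case True
    have "\<eta> x a = 0" if "a \<in> A" for a
      using that True unfolding A'_def by blast
    then have "dual_basis_modulo (insert x S) A \<eta> J \<xi> w N"
      using db[unfolded True] insert.hyps unfolding dual_basis_modulo_def by simp
    then show ?thesis by blast
  next
    case False
    then obtain a0 where a0: "a0 \<in> A" "\<eta> x a0 \<noteq> 0"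
      by (auto simp: A'_def)
    have pos: "\<exists>n. n > 0 \<and> (\<exists>a\<in>A. \<eta> x a = int n)"
    proof -
      have "\<eta> x (frag_cmul (\<eta> x a0) a0) = int (nat (\<eta> x a0 * \<eta> x a0))"
        using \<eta>_cmul[OF a0(1)] by simp
      then show ?thesis
        using cmul[OF a0(1)] a0(2) by (intro exI[of _ "nat (\<eta> x a0 * \<eta> x a0)"])
          (auto simp: zero_less_mult_iff neq_iff)
    qed
    (* the generator of the group of values; r reduces an element to the kernel *)
    define n where "n = (LEAST n. n > 0 \<and> (\<exists>a\<in>A. \<eta> x a = int n))"
    have n: "n > 0" "\<exists>a\<in>A. \<eta> x a = int n"
      using LeastI_ex[OF pos] by (simp_all add: n_def)
    then obtain g where g: "g \<in> A" "\<eta> x g = int n" by blast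
    define d where "d = int n"
    have d: "d > 0" "\<eta> x g = d" using n g by (simp_all add: d_def)
    define r where "r a = a - frag_cmul (\<eta> x a div d) g" for a
    have rA: "r a \<in> A" if "a \<in> A" for a
      unfolding r_def using A(2) cmul[OF g(1)] that by blast
    have \<eta>_r: "\<eta> y (r a) = \<eta> y a - (\<eta> x a div d) * \<eta> y g" if "a \<in> A" "y \<in> insert x S" for a y
      unfolding r_def using insert.prems(3)[OF that(2,1) cmul[OF g(1)]] \<eta>_cmul[OF g(1) that(2)] by simp
    have dvd: "d dvd \<eta> x a" if "a \<in> A" for a
    proof (rule ccontr)
      assume "\<not> d dvd \<eta> x a"
      then have m: "\<eta> x a mod d \<noteq> 0" by auto
      have "\<eta> x (r a) = \<eta> x a mod d"
        using \<eta>_r[OF that, of x] d by (simp add: minus_div_mult_eq_mod)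
      then have "\<eta> x (r a) = int (nat (\<eta> x a mod d))" "nat (\<eta> x a mod d) > 0"
        using m pos_mod_sign[OF d(1), of "\<eta> x a"] by auto
      then have "n \<le> nat (\<eta> x a mod d)"
        unfolding n_def using rA[OF that] by (intro Least_le) blast
      then show False
        using pos_mod_bound[OF d(1), of "\<eta> x a"] pos_mod_sign[OF d(1), of "\<eta> x a"] by (simp add: d_def)
    qed
    have rA': "r a \<in> A'" if "a \<in> A" for a
      using rA[OF that] \<eta>_r[OF that, of x] dvd[OF that] d by (simp add: A'_def)
    have gJ: "g \<notin> J"
      using J(2) d by (auto simp: A'_def)
    define \<xi>' where "\<xi>' j a = (if j = g then \<eta> x a div d else \<xi> j (r a))" for j a
    define w' where "w' j y =
        (if j = g then (if y = x then N else 0)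
         else if y = x then - (\<Sum>y\<in>S. w j y * \<eta> y g) else d * w j y)" for j y
    have w': "(N * d) * \<xi>' j a = (\<Sum>y\<in>insert x S. w' j y * \<eta> y a)"
      if j: "j \<in> insert g J" and a: "a \<in> A" for j a
    proof (cases "j = g")
      case True
      have "(\<Sum>y\<in>S. w' j y * \<eta> y a) = 0"
        using True insert.hyps by (intro sum.neutral) (auto simp: w'_def)
      then show ?thesis
        using True insert.hyps dvd[OF a] by (simp add: w'_def \<xi>'_def)
    next
      case False
      then have jJ: "j \<in> J" using j by simp
      have "(N * d) * \<xi>' j a = d * (\<Sum>y\<in>S. w j y * \<eta> y (r a))"
        using False w[OF jJ rA'[OF a]] by (simp add: \<xi>'_def mult.commute mult.left_commute)
      also have "\<dots> = (\<Sum>y\<in>S. d * w j y * \<eta> y a - (d * (\<eta> x a div d)) * (w j y * \<eta> y g))"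
        unfolding sum_distrib_left by (intro sum.cong refl) (simp add: \<eta>_r[OF a] algebra_simps)
      also have "\<dots> = (\<Sum>y\<in>S. d * w j y * \<eta> y a) - \<eta> x a * (\<Sum>y\<in>S. w j y * \<eta> y g)"
        using dvd[OF a] by (simp add: sum_subtractf sum_distrib_left)
      also have "(\<Sum>y\<in>S. d * w j y * \<eta> y a) = (\<Sum>y\<in>S. w' j y * \<eta> y a)"
        using False insert.hyps by (intro sum.cong) (auto simp: w'_def)
      finally show ?thesis
        using False insert.hyps by (simp add: w'_def)
    qed
    have r_J: "r k = k" if "k \<in> J" for k
      using that J(2) by (auto simp: r_def A'_def)
    have r_g: "r g = 0"
      using d by (simp add: r_def)
    have \<xi>0: "\<xi> j 0 = 0" if "j \<in> J" for j
    proof -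
      have "\<eta> y 0 = 0" if "y \<in> S" for y
        using insert.prems(3)[of y 0 0] A(1) that by simp
      moreover have "0 \<in> A'" using rA'[OF g(1)] r_g by simp
      ultimately show ?thesis
        using w[OF that, of 0] N by simp
    qed
    have dual': "\<xi>' j k = (if j = k then 1 else 0)" if "j \<in> insert g J" "k \<in> insert g J" for j k
      using that d gJ dual r_J r_g \<xi>0 J(2) by (auto simp: \<xi>'_def A'_def)
    have ker': "\<forall>y\<in>insert x S. \<eta> y a = 0"
      if a: "a \<in> A" and 0: "\<And>j. j \<in> insert g J \<Longrightarrow> \<xi>' j a = 0" for a
    proof -
      have "\<eta> x a div d = 0"
        using 0[of g] by (simp add: \<xi>'_def)
      then have x: "\<eta> x a = 0" and ra: "r a = a"
        using dvd[OF a] d by (auto simp: r_def)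
      have "\<xi> j a = 0" if "j \<in> J" for j
      proof -
        have "j \<noteq> g" using that gJ by blast
        then show ?thesis using 0[of j] that ra by (simp add: \<xi>'_def)
      qed
      then show ?thesis
        using ker[of a] a x by (auto simp: A'_def)
    qed
    have "dual_basis_modulo (insert x S) A \<eta> (insert g J) \<xi>' w' (N * d)"
      unfolding dual_basis_modulo_def
    proof (intro conjI ballI)
      show "insert g J \<subseteq> A" using g(1) J(2) by (auto simp: A'_def)
      fix a assume a: "a \<in> A"
      show "(\<forall>j\<in>insert g J. \<xi>' j a = 0) \<longrightarrow> (\<forall>y\<in>insert x S. \<eta> y a = 0)"
        using ker'[OF a] by blast
    qed (use N d J(1) w' dual' in \<open>simp_all del: insert_iff\<close>)
    then show ?thesis by blast
  qed
qed

text \<open>A section of \<open>D\<close> over its image, extended to all chains with the help of the weights. It is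
  this extension that forces the factor \<open>N\<close>.\<close>

lemma generalized_inverse:
  fixes D :: "'x \<Rightarrow> ('y \<Rightarrow>\<^sub>0 int)"
  assumes S: "finite S" and T: "finite T" and D: "\<And>x. x \<in> S \<Longrightarrow> Poly_Mapping.keys (D x) \<subseteq> T"
  obtains N s where "N > (0::int)" "\<And>y. Poly_Mapping.keys (s y) \<subseteq> S"
    "\<And>c. Poly_Mapping.keys c \<subseteq> S \<Longrightarrow>
      frag_extend D (frag_extend s (frag_extend D c)) = frag_cmul N (frag_extend D c)"
proof -
  define A where "A = {frag_extend D c | c. Poly_Mapping.keys c \<subseteq> S}"
  have keysA: "Poly_Mapping.keys a \<subseteq> T" if "a \<in> A" for a
    using that D keys_frag_extend_subset[of _ D T] unfolding A_def by blast
  have A: "0 \<in> A" "\<And>a b. a \<in> A \<Longrightarrow> b \<in> A \<Longrightarrow> a - b \<in> A"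
  proof -
    show "0 \<in> A" unfolding A_def by (auto intro: exI[of _ 0])
    fix a b assume "a \<in> A" "b \<in> A"
    then obtain c e where "a = frag_extend D c" "b = frag_extend D e"
        "Poly_Mapping.keys c \<subseteq> S" "Poly_Mapping.keys e \<subseteq> S"
      unfolding A_def by blast
    then show "a - b \<in> A"
      unfolding A_def using keys_diff[of c e] by (auto simp flip: frag_extend_diff)
  qed
  have "\<exists>J \<xi> w N. dual_basis_modulo T A (\<lambda>y a. Poly_Mapping.lookup a y) J \<xi> w N"
    by (rule integral_dual_basis[of T A "\<lambda>y a. Poly_Mapping.lookup a y", OF T A]) (auto simp: lookup_minus)
  then obtain J \<xi> w N where db: "dual_basis_modulo T A (\<lambda>y a. Poly_Mapping.lookup a y) J \<xi> w N"
    by blast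
  note N = dual_basis_moduloD(1)[OF db] and J = dual_basis_moduloD(2,3)[OF db]
    and w = dual_basis_moduloD(4)[OF db] and dual = dual_basis_moduloD(5)[OF db]
    and ker = dual_basis_moduloD(6)[OF db]
  have "\<forall>j\<in>J. \<exists>c. Poly_Mapping.keys c \<subseteq> S \<and> frag_extend D c = j"
    using J(2) unfolding A_def by blast
  then obtain c where c: "\<And>j. j \<in> J \<Longrightarrow> Poly_Mapping.keys (c j) \<subseteq> S \<and> frag_extend D (c j) = j"
    by metis
  define s where "s y = (\<Sum>j\<in>J. frag_cmul (w j y) (c j))" for y
  show ?thesis
  proof (rule that[OF N, of s])
    show "Poly_Mapping.keys (s y) \<subseteq> S" for y
    proof -
      have "Poly_Mapping.keys (s y) \<subseteq> (\<Union>j\<in>J. Poly_Mapping.keys (frag_cmul (w j y) (c j)))"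
        unfolding s_def by (rule keys_sum)
      then show ?thesis using c keys_cmul by blast
    qed
    fix e :: "'x \<Rightarrow>\<^sub>0 int"
    assume e: "Poly_Mapping.keys e \<subseteq> S"
    define a where "a = frag_extend D e"
    have aA: "a \<in> A" using e by (auto simp: a_def A_def)
    have comb_A: "(\<Sum>j\<in>I. frag_cmul (\<xi> j a) j) \<in> A" if "I \<subseteq> J" for I
    proof -
      have "(\<Sum>j\<in>I. frag_cmul (\<xi> j a) j) = frag_extend D (\<Sum>j\<in>I. frag_cmul (\<xi> j a) (c j))"
        using c that finite_subset[OF that J(1)]
        by (auto simp: frag_extend_sum frag_extend_cmul intro!: sum.cong)
      moreover have "Poly_Mapping.keys (\<Sum>j\<in>I. frag_cmul (\<xi> j a) (c j)) \<subseteq> S"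
        using keys_sum[of "\<lambda>j. frag_cmul (\<xi> j a) (c j)" I] c that keys_cmul by blast
      ultimately show ?thesis unfolding A_def by blast
    qed
    have lookup_a: "Poly_Mapping.lookup a y = (\<Sum>j\<in>J. \<xi> j a * Poly_Mapping.lookup j y)" if "y \<in> T" for y
    proof -
      let ?b = "a - (\<Sum>j\<in>J. frag_cmul (\<xi> j a) j)"
      have bA: "?b \<in> A" using A(2)[OF aA comb_A] by simp
      have "\<xi> k ?b = 0" if k: "k \<in> J" for k
      proof -
        have "N * \<xi> k ?b = (\<Sum>y\<in>T. w k y * Poly_Mapping.lookup a y) -
            (\<Sum>y\<in>T. \<Sum>j\<in>J. \<xi> j a * (w k y * Poly_Mapping.lookup j y))"
          unfolding w[OF k bA] by (simp add: lookup_minus lookup_sum algebra_simps sum_distrib_left sum_subtractf)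
        also have "(\<Sum>y\<in>T. \<Sum>j\<in>J. \<xi> j a * (w k y * Poly_Mapping.lookup j y)) = (\<Sum>j\<in>J. \<xi> j a * (N * \<xi> k j))"
          using w[OF k] J(2) by (subst sum.swap) (auto simp: sum_distrib_left intro!: sum.cong)
        also have "\<dots> = (\<Sum>j\<in>J. if k = j then N * \<xi> k a else 0)"
          using dual[OF k] by (intro sum.cong) auto
        finally show ?thesis
          using w[OF k aA] N J(1) k by simp
      qed
      then have "Poly_Mapping.lookup ?b y = 0"
        using ker[OF bA] that by blast
      then show ?thesis by (simp add: lookup_minus lookup_sum)
    qed
    have "frag_extend s a = (\<Sum>j\<in>J. frag_cmul (N * \<xi> j a) (c j))"
    proof (rule poly_mapping_eqI)
      fix x
      have "Poly_Mapping.lookup (frag_extend s a) x = (\<Sum>y\<in>T. \<Sum>j\<in>J. w j y * Poly_Mapping.lookup a y * Poly_Mapping.lookup (c j) x)"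
        unfolding lookup_frag_extend[OF T keysA[OF aA]]
        by (simp add: s_def lookup_sum sum_distrib_left algebra_simps)
      also have "\<dots> = (\<Sum>j\<in>J. (\<Sum>y\<in>T. w j y * Poly_Mapping.lookup a y) * Poly_Mapping.lookup (c j) x)"
        by (subst sum.swap) (simp add: sum_distrib_right)
      also have "\<dots> = (\<Sum>j\<in>J. (N * \<xi> j a) * Poly_Mapping.lookup (c j) x)"
        using w[OF _ aA] by (intro sum.cong) auto
      finally show "Poly_Mapping.lookup (frag_extend s a) x = Poly_Mapping.lookup (\<Sum>j\<in>J. frag_cmul (N * \<xi> j a) (c j)) x"
        by (simp add: lookup_sum)
    qed
    then have "frag_extend D (frag_extend s a) = (\<Sum>j\<in>J. frag_cmul (N * \<xi> j a) j)"
      using c J(1) by (auto simp: frag_extend_sum frag_extend_cmul intro!: sum.cong)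
    also have "\<dots> = frag_cmul N a"
    proof (rule poly_mapping_eqI)
      fix y
      show "Poly_Mapping.lookup (\<Sum>j\<in>J. frag_cmul (N * \<xi> j a) j) y = Poly_Mapping.lookup (frag_cmul N a) y"
      proof (cases "y \<in> T")
        case True
        then show ?thesis
          by (simp add: lookup_sum lookup_a sum_distrib_left mult.assoc)
      next
        case False
        then have "Poly_Mapping.lookup j y = 0" if "j \<in> insert a J" for j
        proof -
          have "Poly_Mapping.keys j \<subseteq> T"
            using aA J(2) that by (intro keysA) auto
          then show ?thesis using False by (auto simp flip: not_in_keys_iff_lookup_eq_zero)
        qed
        then show ?thesis by (simp add: lookup_sum)
      qed
    qed
    finally show "frag_extend D (frag_extend s (frag_extend D e)) = frag_cmul N (frag_extend D e)"
      by (simp add: a_def)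
  qed
qed

definition frag_trace :: "'x set \<Rightarrow> (('x \<Rightarrow>\<^sub>0 int) \<Rightarrow> ('x \<Rightarrow>\<^sub>0 int)) \<Rightarrow> int"
  where "frag_trace S f = (\<Sum>x\<in>S. Poly_Mapping.lookup (f (frag_of x)) x)"

lemma frag_trace_commute:
  assumes S: "finite S" and T: "finite T"
    and a: "\<And>x. x \<in> S \<Longrightarrow> Poly_Mapping.keys (a x) \<subseteq> T"
    and b: "\<And>y. y \<in> T \<Longrightarrow> Poly_Mapping.keys (b y) \<subseteq> S"
  shows "frag_trace S (\<lambda>c. frag_extend b (frag_extend a c)) = frag_trace T (\<lambda>c. frag_extend a (frag_extend b c))"
proof -
  have "frag_trace S (\<lambda>c. frag_extend b (frag_extend a c)) =
      (\<Sum>x\<in>S. \<Sum>y\<in>T. Poly_Mapping.lookup (a x) y * Poly_Mapping.lookup (b y) x)"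
    unfolding frag_trace_def by (intro sum.cong refl) (simp add: lookup_frag_extend[OF T a])
  also have "\<dots> = (\<Sum>y\<in>T. \<Sum>x\<in>S. Poly_Mapping.lookup (b y) x * Poly_Mapping.lookup (a x) y)"
    by (subst sum.swap) (simp add: mult.commute)
  also have "\<dots> = frag_trace T (\<lambda>c. frag_extend a (frag_extend b c))"
    unfolding frag_trace_def by (intro sum.cong refl) (simp add: lookup_frag_extend[OF S b])
  finally show ?thesis .
qed

lemma frag_cmul_diff_distrib2: "frag_cmul k (a - b) = frag_cmul k a - frag_cmul k b"
  using frag_cmul_distrib2[of k "a - b" b] by simp

lemma frag_extend_cmul_fun:
  "frag_extend (\<lambda>x. frag_cmul k (f x)) c = frag_cmul k (frag_extend f c)"
  using subset_UNIV
  by (induction c rule: frag_induction) (auto simp: frag_extend_diff frag_cmul_diff_distrib2)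

text \<open>The cycles \<open>z\<close> some multiple of which is a boundary are the common kernel of the coordinates of
  \<open>E = L - D1 s\<close>, where \<open>s\<close> is a generalized inverse of \<open>D1\<close> with denominator \<open>L\<close>. They are exactly
  the cycles whose homology class is torsion.\<close>

lemma cycles_dual_basis:
  fixes D1 :: "'y \<Rightarrow> ('x \<Rightarrow>\<^sub>0 int)" and D0 :: "'x \<Rightarrow> ('z \<Rightarrow>\<^sub>0 int)"
  assumes S: "finite S" and T: "finite T" and D1: "\<And>y. y \<in> T \<Longrightarrow> Poly_Mapping.keys (D1 y) \<subseteq> S"
  defines "Z \<equiv> {z. Poly_Mapping.keys z \<subseteq> S \<and> frag_extend D0 z = 0}"
  obtains J \<xi> v N where "N > (0::int)" "finite J" "J \<subseteq> Z"
    "\<And>j z. j \<in> J \<Longrightarrow> z \<in> Z \<Longrightarrow> N * \<xi> j z = (\<Sum>x\<in>S. Poly_Mapping.lookup z x * v j x)"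
    "\<And>j k. j \<in> J \<Longrightarrow> k \<in> J \<Longrightarrow> \<xi> j k = (if j = k then 1 else 0)"
    "\<And>z. z \<in> Z \<Longrightarrow> (\<forall>j\<in>J. \<xi> j z = 0) \<longleftrightarrow>
      (\<exists>M>0. \<exists>y. Poly_Mapping.keys y \<subseteq> T \<and> frag_cmul M z = frag_extend D1 y)"
proof -
  obtain L s where L: "L > (0::int)" and s: "\<And>x. Poly_Mapping.keys (s x) \<subseteq> T"
    and inv: "\<And>c. Poly_Mapping.keys c \<subseteq> T \<Longrightarrow>
      frag_extend D1 (frag_extend s (frag_extend D1 c)) = frag_cmul L (frag_extend D1 c)"
    by (rule generalized_inverse[of T S D1, OF T S D1]) (assumption, rule that)
  define E where "E x = frag_cmul L (frag_of x) - frag_extend D1 (s x)" for x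
  have E: "frag_extend E c = frag_cmul L c - frag_extend D1 (frag_extend s c)" for c
    unfolding E_def[abs_def] frag_extend_diff_fun frag_extend_cmul_fun frag_extend_frag_extend
    by (simp flip: frag_expansion)
  have keysE: "Poly_Mapping.keys (frag_extend E z) \<subseteq> S" if "z \<in> Z" for z
  proof -
    have "Poly_Mapping.keys (frag_extend s z) \<subseteq> T"
      using s by (rule keys_frag_extend_subset)
    then have "Poly_Mapping.keys (frag_extend D1 (frag_extend s z)) \<subseteq> S"
      by (rule_tac keys_frag_extend_subset) (use D1 in blast)
    then show ?thesis
      using that keys_cmul[of L z] keys_diff[of "frag_cmul L z" "frag_extend D1 (frag_extend s z)"]
      unfolding E Z_def by blast
  qed
  have Z0: "0 \<in> Z"
    by (simp add: Z_def)
  have Z_diff: "a - b \<in> Z" if "a \<in> Z" "b \<in> Z" for a b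
    using that keys_diff[of a b] by (auto simp: Z_def frag_extend_diff)
  have "\<exists>J \<xi> w N. dual_basis_modulo S Z (\<lambda>x z. Poly_Mapping.lookup (frag_extend E z) x) J \<xi> w N"
    by (rule integral_dual_basis[of S Z "\<lambda>x z. Poly_Mapping.lookup (frag_extend E z) x", OF S Z0 Z_diff])
      (auto simp: frag_extend_diff lookup_minus)
  then obtain J \<xi> w N
    where db: "dual_basis_modulo S Z (\<lambda>x z. Poly_Mapping.lookup (frag_extend E z) x) J \<xi> w N"
    by blast
  note N = dual_basis_moduloD(1)[OF db] and J = dual_basis_moduloD(2,3)[OF db]
    and w = dual_basis_moduloD(4)[OF db] and dual = dual_basis_moduloD(5)[OF db]
    and ker = dual_basis_moduloD(6)[OF db]
  define v where "v j x = (\<Sum>x'\<in>S. w j x' * Poly_Mapping.lookup (E x) x')" for j x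
  have v: "N * \<xi> j z = (\<Sum>x\<in>S. Poly_Mapping.lookup z x * v j x)" if "j \<in> J" "z \<in> Z" for j z
  proof -
    have "Poly_Mapping.keys z \<subseteq> S" using that(2) by (simp add: Z_def)
    then have "N * \<xi> j z = (\<Sum>x'\<in>S. \<Sum>x\<in>S. Poly_Mapping.lookup z x * (w j x' * Poly_Mapping.lookup (E x) x'))"
      unfolding w[OF that] by (simp add: lookup_frag_extend[OF S] sum_distrib_left algebra_simps)
    also have "\<dots> = (\<Sum>x\<in>S. Poly_Mapping.lookup z x * v j x)"
      by (subst sum.swap) (simp add: v_def sum_distrib_left)
    finally show ?thesis .
  qed
  have iff: "(\<forall>j\<in>J. \<xi> j z = 0) \<longleftrightarrow>
      (\<exists>M>0. \<exists>y. Poly_Mapping.keys y \<subseteq> T \<and> frag_cmul M z = frag_extend D1 y)" if z: "z \<in> Z" for z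
  proof
    assume "\<forall>j\<in>J. \<xi> j z = 0"
    then have "\<forall>x\<in>S. Poly_Mapping.lookup (frag_extend E z) x = 0"
      using ker[OF z] by blast
    then have "frag_extend E z = 0"
      using keysE[OF z] by (intro poly_mapping_eqI) (auto simp: in_keys_iff)
    then have "frag_cmul L z = frag_extend D1 (frag_extend s z)"
      by (simp add: E)
    moreover have "Poly_Mapping.keys (frag_extend s z) \<subseteq> T"
      using s by (rule keys_frag_extend_subset)
    ultimately show "\<exists>M>0. \<exists>y. Poly_Mapping.keys y \<subseteq> T \<and> frag_cmul M z = frag_extend D1 y"
      using L by blast
  next
    assume "\<exists>M>0. \<exists>y. Poly_Mapping.keys y \<subseteq> T \<and> frag_cmul M z = frag_extend D1 y"
    then obtain M y where M: "M > 0" and y: "Poly_Mapping.keys y \<subseteq> T" "frag_cmul M z = frag_extend D1 y"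
      by blast
    have "frag_cmul M (frag_extend E z) = frag_extend E (frag_cmul M z)"
      by (simp add: frag_extend_cmul)
    also have "\<dots> = 0"
      unfolding y(2) E using inv[OF y(1)] by simp
    finally have "frag_extend E z = 0"
      using M by simp
    then show "\<forall>j\<in>J. \<xi> j z = 0"
      using w[OF _ z] N by auto
  qed
  show ?thesis
    by (rule that[OF N J v dual iff])
qed

lemma keys_diff_subset:
  "Poly_Mapping.keys a \<subseteq> S \<Longrightarrow> Poly_Mapping.keys b \<subseteq> S \<Longrightarrow> Poly_Mapping.keys (a - b) \<subseteq> S"
  using keys_diff[of a b] by blast

lemma keys_cmul_subset: "Poly_Mapping.keys a \<subseteq> S \<Longrightarrow> Poly_Mapping.keys (frag_cmul k a) \<subseteq> S"
  using keys_cmul[of k a] by blast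
text \<open>Over the rationals \<open>s0 D0 / N0\<close> and \<open>D1 s1 / N1\<close> are projections, the first one along the
  cycles and the second one onto the boundaries, so that \<open>Q = 1 - s0 D0 / N0 - D1 s1 / N1\<close> projects
  the chains onto a copy of the homology. The trace of \<open>f\<close> on homology is therefore the trace of
  \<open>f Q\<close>. The statement is multiplied by \<open>N0 N1\<close> to stay within the integers.\<close>

lemma homology_trace:
  fixes D1 :: "'y \<Rightarrow> ('x \<Rightarrow>\<^sub>0 int)" and D0 :: "'x \<Rightarrow> ('z \<Rightarrow>\<^sub>0 int)"
  assumes S: "finite S" and T: "finite T"
    and D1: "\<And>y. y \<in> T \<Longrightarrow> Poly_Mapping.keys (D1 y) \<subseteq> S"
    and DD: "\<And>y. y \<in> T \<Longrightarrow> frag_extend D0 (D1 y) = 0"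
    and s0: "\<And>z. Poly_Mapping.keys (s0 z) \<subseteq> S" "\<And>c. Poly_Mapping.keys c \<subseteq> S \<Longrightarrow>
      frag_extend D0 (frag_extend s0 (frag_extend D0 c)) = frag_cmul N0 (frag_extend D0 c)"
    and s1: "\<And>x. Poly_Mapping.keys (s1 x) \<subseteq> T" "\<And>c. Poly_Mapping.keys c \<subseteq> T \<Longrightarrow>
      frag_extend D1 (frag_extend s1 (frag_extend D1 c)) = frag_cmul N1 (frag_extend D1 c)"
    and N1: "N1 > (0::int)"
    and f1: "\<And>y. y \<in> T \<Longrightarrow> Poly_Mapping.keys (f1 y) \<subseteq> T"
    and f_D1: "\<And>y. y \<in> T \<Longrightarrow> frag_extend f (D1 y) = frag_extend D1 (f1 y)"
  defines "Z \<equiv> {z. Poly_Mapping.keys z \<subseteq> S \<and> frag_extend D0 z = 0}"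
  assumes f_Z: "\<And>z. z \<in> Z \<Longrightarrow> frag_extend f z \<in> Z"
    and N: "N > (0::int)" and J: "finite J" "J \<subseteq> Z"
    and v: "\<And>j z. j \<in> J \<Longrightarrow> z \<in> Z \<Longrightarrow> N * \<xi> j z = (\<Sum>x\<in>S. Poly_Mapping.lookup z x * v j x)"
    and dual: "\<And>j k. j \<in> J \<Longrightarrow> k \<in> J \<Longrightarrow> \<xi> j k = (if j = k then 1 else (0::int))"
    and ker: "\<And>z. z \<in> Z \<Longrightarrow> (\<forall>j\<in>J. \<xi> j z = 0) \<longleftrightarrow>
      (\<exists>M>0. \<exists>y. Poly_Mapping.keys y \<subseteq> T \<and> frag_cmul M z = frag_extend D1 y)"
  shows "N0 * N1 * (\<Sum>j\<in>J. \<xi> j (frag_extend f j)) = N0 * N1 * frag_trace S (frag_extend f) -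
    N1 * frag_trace S (\<lambda>c. frag_extend f (frag_extend s0 (frag_extend D0 c))) -
    N0 * frag_trace T (\<lambda>c. frag_extend f1 (frag_extend s1 (frag_extend D1 c)))"
proof -
  have ext_T: "Poly_Mapping.keys (frag_extend s1 c) \<subseteq> T" for c
    using s1(1) by (rule keys_frag_extend_subset)
  have ext_S: "Poly_Mapping.keys (frag_extend D1 c) \<subseteq> S" if "Poly_Mapping.keys c \<subseteq> T" for c
    by (rule keys_frag_extend_subset) (use D1 that in blast)
  have DD': "frag_extend D0 (frag_extend D1 c) = 0" if "Poly_Mapping.keys c \<subseteq> T" for c
    unfolding frag_extend_frag_extend by (rule frag_extend_eq_0) (use DD that in blast)
  have f_D1': "frag_extend f (frag_extend D1 c) = frag_extend D1 (frag_extend f1 c)"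
    if "Poly_Mapping.keys c \<subseteq> T" for c
    unfolding frag_extend_frag_extend by (rule frag_extend_eq) (use f_D1 that in blast)
  have bd_Z: "frag_extend D1 c \<in> Z" if "Poly_Mapping.keys c \<subseteq> T" for c
    using ext_S[OF that] DD'[OF that] by (simp add: Z_def)
  have \<xi>_bd: "\<xi> j (frag_extend D1 c) = 0" if "j \<in> J" "Poly_Mapping.keys c \<subseteq> T" for j c
  proof -
    have "frag_cmul 1 (frag_extend D1 c) = frag_extend D1 c" by simp
    then show ?thesis
      using ker[OF bd_Z[OF that(2)]] that zero_less_one by blast
  qed
  have ker': "frag_cmul N1 z = frag_extend D1 (frag_extend s1 z)" if z: "z \<in> Z" "\<forall>j\<in>J. \<xi> j z = 0" for z
  proof -
    obtain M y where M: "M > 0" and y: "Poly_Mapping.keys y \<subseteq> T" "frag_cmul M z = frag_extend D1 y"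
      using ker[OF z(1)] z(2) by blast
    have "frag_cmul M (frag_cmul N1 z) = frag_cmul N1 (frag_cmul M z)"
      by (simp add: mult.commute)
    also have "\<dots> = frag_extend D1 (frag_extend s1 (frag_cmul M z))"
      unfolding y(2) using s1(2)[OF y(1)] by simp
    also have "\<dots> = frag_cmul M (frag_extend D1 (frag_extend s1 z))"
      by (simp add: frag_extend_cmul)
    finally have "frag_cmul M (frag_cmul N1 z - frag_extend D1 (frag_extend s1 z)) = 0"
      unfolding frag_cmul_diff_distrib2 by simp
    then show ?thesis using M by simp
  qed
  (* N0 N1 times the projection to homology *)
  define Q where "Q x = frag_cmul (N0 * N1) (frag_of x) - frag_cmul N1 (frag_extend s0 (D0 x)) -
      frag_cmul N0 (frag_extend D1 (s1 x))" for x
  have Q: "frag_extend Q c = frag_cmul (N0 * N1) c - frag_cmul N1 (frag_extend s0 (frag_extend D0 c)) -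
      frag_cmul N0 (frag_extend D1 (frag_extend s1 c))" for c
    unfolding Q_def[abs_def] frag_extend_diff_fun frag_extend_cmul_fun frag_extend_frag_extend
    by (simp flip: frag_expansion)
  have QZ: "Q x \<in> Z" if x: "x \<in> S" for x
  proof -
    have "Poly_Mapping.keys (frag_extend s0 (D0 x)) \<subseteq> S" "Poly_Mapping.keys (frag_extend D1 (s1 x)) \<subseteq> S"
      by (rule keys_frag_extend_subset, rule s0(1), rule ext_S[OF s1(1)])
    then have "Poly_Mapping.keys (Q x) \<subseteq> S"
      unfolding Q_def using x by (intro keys_diff_subset keys_cmul_subset) simp_all
    moreover have "frag_extend D0 (Q x) = 0"
      using s0(2)[of "frag_of x"] x DD'[OF s1(1)] unfolding Q_def
      by (simp add: frag_extend_diff frag_extend_cmul mult.commute)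
    ultimately show ?thesis by (simp add: Z_def)
  qed
  (* N times the dual basis, extended to all chains *)
  define V where "V j c = (\<Sum>x\<in>S. Poly_Mapping.lookup c x * v j x)" for j c
  have V_ext: "V j (frag_extend g c) = (\<Sum>x\<in>S. Poly_Mapping.lookup c x * V j (g x))"
    if "Poly_Mapping.keys c \<subseteq> S" for j c g
  proof -
    have "V j (frag_extend g c) = (\<Sum>x'\<in>S. \<Sum>x\<in>S. Poly_Mapping.lookup c x * Poly_Mapping.lookup (g x) x' * v j x')"
      unfolding V_def by (simp add: lookup_frag_extend[OF S that] sum_distrib_right)
    also have "\<dots> = (\<Sum>x\<in>S. Poly_Mapping.lookup c x * V j (g x))"
      unfolding V_def by (subst sum.swap) (simp add: sum_distrib_left mult.assoc)
    finally show ?thesis .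
  qed
  have V_diff: "V j (a - b) = V j a - V j b" and V_cmul: "V j (frag_cmul k a) = k * V j a" for j a b k
    by (simp_all add: V_def lookup_minus algebra_simps sum_subtractf sum_distrib_left)
  have V_sum: "V j (sum g I) = (\<Sum>i\<in>I. V j (g i))" for j I and g :: "('x \<Rightarrow>\<^sub>0 int) \<Rightarrow> _"
    unfolding V_def lookup_sum sum_distrib_right by (rule sum.swap)
  have v': "V j z = N * \<xi> j z" if "j \<in> J" "z \<in> Z" for j z
    using v[OF that] by (simp add: V_def)
  (* what the basis of the homology does not see of Q; it does not contribute to the trace *)
  define E where "E x = Q x - (\<Sum>j\<in>J. frag_cmul (\<xi> j (Q x)) j)" for x
  have comb_Z: "(\<Sum>j\<in>J. frag_cmul (k j) j) \<in> Z" for k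
  proof -
    have "Poly_Mapping.keys (\<Sum>j\<in>J. frag_cmul (k j) j) \<subseteq> (\<Union>j\<in>J. Poly_Mapping.keys (frag_cmul (k j) j))"
      by (rule keys_sum)
    also have "\<dots> \<subseteq> S"
      using J(2) by (intro UN_least keys_cmul_subset) (auto simp: Z_def)
    finally have "Poly_Mapping.keys (\<Sum>j\<in>J. frag_cmul (k j) j) \<subseteq> S"
 .
    moreover have "frag_extend D0 (\<Sum>j\<in>J. frag_cmul (k j) j) = 0"
      using J by (auto simp: frag_extend_sum frag_extend_cmul Z_def intro!: sum.neutral)
    ultimately show ?thesis by (simp add: Z_def)
  qed
  have EZ: "E x \<in> Z" if "x \<in> S" for x
  proof -
    have "Poly_Mapping.keys (E x) \<subseteq> S"
      using QZ[OF that] comb_Z[of "\<lambda>j. \<xi> j (Q x)"] unfolding E_def Z_def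
      by (intro keys_diff_subset) auto
    then show ?thesis
      using QZ[OF that] comb_Z[of "\<lambda>j. \<xi> j (Q x)"] unfolding E_def by (simp add: Z_def frag_extend_diff)
  qed
  have E_bd: "frag_cmul N1 (E x) = frag_extend D1 (frag_extend s1 (E x))" if x: "x \<in> S" for x
  proof (rule ker'[OF EZ[OF x]], rule ballI)
    fix k assume k: "k \<in> J"
    have "N * \<xi> k (E x) = V k (Q x) - (\<Sum>j\<in>J. \<xi> j (Q x) * V k j)"
      unfolding v'[OF k EZ[OF x], symmetric] by (simp add: E_def V_diff V_sum V_cmul)
    also have "(\<Sum>j\<in>J. \<xi> j (Q x) * V k j) = (\<Sum>j\<in>J. if k = j then N * \<xi> k (Q x) else 0)"
      using v'[OF k] dual[OF k] J(2) by (intro sum.cong) auto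
    finally show "\<xi> k (E x) = 0"
      using v'[OF k QZ[OF x]] J(1) k N by simp
  qed
  have E_D1: "frag_extend E (D1 y) = 0" if y: "y \<in> T" for y
  proof -
    have keys: "Poly_Mapping.keys (D1 y) \<subseteq> S" using D1[OF y] .
    have Q0: "frag_extend Q (D1 y) = 0"
      using s1(2)[of "frag_of y"] DD[OF y] y unfolding Q by (simp add: mult.commute)
    have "(\<Sum>x\<in>S. Poly_Mapping.lookup (D1 y) x * \<xi> j (Q x)) = 0" if j: "j \<in> J" for j
    proof -
      have "N * (\<Sum>x\<in>S. Poly_Mapping.lookup (D1 y) x * \<xi> j (Q x)) =
          (\<Sum>x\<in>S. Poly_Mapping.lookup (D1 y) x * V j (Q x))"
        using v'[OF j QZ] by (simp add: sum_distrib_left mult.left_commute)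
      also have "\<dots> = V j (frag_extend Q (D1 y))"
        by (simp add: V_ext[OF keys])
      also have "\<dots> = 0" unfolding Q0 by (simp add: V_def)
      finally show ?thesis using N by simp
    qed
    then have *: "(\<Sum>x\<in>S. Poly_Mapping.lookup (D1 y) x * (\<Sum>j\<in>J. \<xi> j (Q x) * Poly_Mapping.lookup j x')) = 0" for x'
    proof -
      have "(\<Sum>x\<in>S. Poly_Mapping.lookup (D1 y) x * (\<Sum>j\<in>J. \<xi> j (Q x) * Poly_Mapping.lookup j x')) =
          (\<Sum>j\<in>J. (\<Sum>x\<in>S. Poly_Mapping.lookup (D1 y) x * \<xi> j (Q x)) * Poly_Mapping.lookup j x')"
        unfolding sum_distrib_left sum_distrib_right by (subst sum.swap) (simp add: mult.assoc)
      then show ?thesis using \<open>\<And>j. j \<in> J \<Longrightarrow> _ j = 0\<close> by simp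
    qed
    have "frag_extend E (D1 y) = frag_extend Q (D1 y) -
        frag_extend (\<lambda>x. \<Sum>j\<in>J. frag_cmul (\<xi> j (Q x)) j) (D1 y)"
      unfolding E_def[abs_def] frag_extend_diff_fun ..
    moreover have "frag_extend (\<lambda>x. \<Sum>j\<in>J. frag_cmul (\<xi> j (Q x)) j) (D1 y) = 0"
      by (rule poly_mapping_eqI) (simp add: lookup_frag_extend[OF S keys] lookup_sum *)
    ultimately show ?thesis using Q0 by simp
  qed
  have tr_scale: "frag_trace A (\<lambda>c. frag_cmul k (g c)) = k * frag_trace A g" for A :: "'x set" and k g
    by (simp add: frag_trace_def sum_distrib_left)
  have keys_f1: "Poly_Mapping.keys (frag_extend f1 c) \<subseteq> T" if "Poly_Mapping.keys c \<subseteq> T" for c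
    by (rule keys_frag_extend_subset) (use f1 that in blast)
  have fE: "frag_trace S (\<lambda>c. frag_extend f (frag_extend E c)) = 0"
  proof -
    have "N1 * frag_trace S (\<lambda>c. frag_extend f (frag_extend E c)) =
        frag_trace S (\<lambda>c. frag_extend D1 (frag_extend (\<lambda>x. frag_extend f1 (frag_extend s1 (E x))) c))"
      unfolding tr_scale[symmetric] unfolding frag_trace_def
    proof (intro sum.cong refl)
      fix x assume x: "x \<in> S"
      have "frag_cmul N1 (frag_extend f (E x)) = frag_extend f (frag_cmul N1 (E x))"
        by (simp add: frag_extend_cmul)
      also have "\<dots> = frag_extend D1 (frag_extend f1 (frag_extend s1 (E x)))"
        unfolding E_bd[OF x] using f_D1'[OF ext_T] .
      finally show "Poly_Mapping.lookup (frag_cmul N1 (frag_extend f (frag_extend E (frag_of x)))) x =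
          Poly_Mapping.lookup (frag_extend D1 (frag_extend (\<lambda>x. frag_extend f1 (frag_extend s1 (E x))) (frag_of x))) x"
        by simp
    qed
    also have "\<dots> = frag_trace T (\<lambda>c. frag_extend (\<lambda>x. frag_extend f1 (frag_extend s1 (E x))) (frag_extend D1 c))"
      by (rule frag_trace_commute[OF S T]) (use D1 keys_f1[OF ext_T] in auto)
    also have "\<dots> = 0"
      unfolding frag_trace_def
      using E_D1 by (intro sum.neutral) (simp flip: frag_extend_frag_extend)
    finally show ?thesis using N1 by simp
  qed
  have fQ: "frag_trace S (\<lambda>c. frag_extend f (frag_extend Q c)) =
      (\<Sum>x\<in>S. \<Sum>j\<in>J. \<xi> j (Q x) * Poly_Mapping.lookup (frag_extend f j) x)"
  proof -
    have "frag_trace S (\<lambda>c. frag_extend f (frag_extend Q c)) =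
        frag_trace S (\<lambda>c. frag_extend f (frag_extend E c)) +
        (\<Sum>x\<in>S. \<Sum>j\<in>J. \<xi> j (Q x) * Poly_Mapping.lookup (frag_extend f j) x)"
      unfolding frag_trace_def using J(1)
      by (simp add: E_def frag_extend_diff frag_extend_sum frag_extend_cmul lookup_minus lookup_sum
          sum_subtractf)
    then show ?thesis using fE by simp
  qed
  have f_D1_s1: "frag_trace S (\<lambda>c. frag_extend f (frag_extend D1 (frag_extend s1 c))) =
      frag_trace T (\<lambda>c. frag_extend f1 (frag_extend s1 (frag_extend D1 c)))"
  proof -
    have "frag_trace S (\<lambda>c. frag_extend f (frag_extend D1 (frag_extend s1 c))) =
        frag_trace S (\<lambda>c. frag_extend D1 (frag_extend (\<lambda>x. frag_extend f1 (s1 x)) c))"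
      unfolding f_D1'[OF ext_T] by (simp only: frag_extend_frag_extend)
    also have "\<dots> = frag_trace T (\<lambda>c. frag_extend (\<lambda>x. frag_extend f1 (s1 x)) (frag_extend D1 c))"
      by (rule frag_trace_commute[OF S T]) (use D1 keys_f1[OF s1(1)] in auto)
    finally show ?thesis by (simp only: frag_extend_frag_extend)
  qed
  have "frag_trace S (\<lambda>c. frag_extend f (frag_extend Q c)) =
      N0 * N1 * frag_trace S (frag_extend f) -
      N1 * frag_trace S (\<lambda>c. frag_extend f (frag_extend s0 (frag_extend D0 c))) -
      N0 * frag_trace S (\<lambda>c. frag_extend f (frag_extend D1 (frag_extend s1 c)))"
    unfolding frag_trace_def Q
    by (simp add: frag_extend_diff frag_extend_cmul lookup_minus sum_subtractf sum_distrib_left)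
  moreover have "frag_trace S (\<lambda>c. frag_extend f (frag_extend Q c)) =
      N0 * N1 * (\<Sum>j\<in>J. \<xi> j (frag_extend f j))"
  proof -
    have *: "(\<Sum>x\<in>S. Poly_Mapping.lookup (frag_extend f j) x * V j (Q x)) =
        N * (N0 * N1 * \<xi> j (frag_extend f j))" if j: "j \<in> J" for j
    proof -
      let ?z = "frag_extend f j"
      have z: "?z \<in> Z" using f_Z J(2) j by blast
      then have "(\<Sum>x\<in>S. Poly_Mapping.lookup ?z x * V j (Q x)) = V j (frag_extend Q ?z)"
        by (simp add: V_ext Z_def)
      also have "\<dots> = N0 * N1 * V j ?z - N0 * V j (frag_extend D1 (frag_extend s1 ?z))"
        using z unfolding Q by (simp add: V_diff V_cmul Z_def)
      also have "V j (frag_extend D1 (frag_extend s1 ?z)) = 0"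
        using v'[OF j bd_Z[OF ext_T]] \<xi>_bd[OF j ext_T] by simp
      finally show ?thesis
        using v'[OF j z] by simp
    qed
    have "N * frag_trace S (\<lambda>c. frag_extend f (frag_extend Q c)) =
        (\<Sum>x\<in>S. \<Sum>j\<in>J. Poly_Mapping.lookup (frag_extend f j) x * V j (Q x))"
      unfolding fQ using v'[OF _ QZ]
      by (auto simp: sum_distrib_left mult.assoc mult.commute mult.left_commute intro!: sum.cong)
    also have "\<dots> = (\<Sum>j\<in>J. \<Sum>x\<in>S. Poly_Mapping.lookup (frag_extend f j) x * V j (Q x))"
      by (rule sum.swap)
    also have "\<dots> = N * (N0 * N1 * (\<Sum>j\<in>J. \<xi> j (frag_extend f j)))"
      by (simp add: * sum_distrib_left)
    finally show ?thesis using N by simp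
  qed
  ultimately show ?thesis
    unfolding f_D1_s1 by simp
qed

section \<open>Traces on the torsion-free part\<close>

text \<open>The classes of \<open>J\<close> form a basis of the torsion-free quotient, with coordinates \<open>\<xi>\<close>: two elements of
  \<open>A\<close> have the same image in the quotient if and only if they have the same values under \<open>\<xi>\<close>.\<close>

lemma torsion_free_trace_dual_basis:
  fixes A :: "'g::ab_group_add set" and G :: "('h, 'm) monoid_scheme"
  assumes G: "comm_group G"
    and A: "\<And>a b. a \<in> A \<Longrightarrow> b \<in> A \<Longrightarrow> a + b \<in> A" "\<And>a b. a \<in> A \<Longrightarrow> b \<in> A \<Longrightarrow> a - b \<in> A"
    and \<kappa>: "\<kappa> ` A = carrier G" "\<And>a b. a \<in> A \<Longrightarrow> b \<in> A \<Longrightarrow> \<kappa> (a + b) = \<kappa> a \<otimes>\<^bsub>G\<^esub> \<kappa> b"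
    and J: "finite J" "J \<subseteq> A"
    and \<xi>: "\<And>j a b. j \<in> J \<Longrightarrow> a \<in> A \<Longrightarrow> b \<in> A \<Longrightarrow> \<xi> j (a + b) = \<xi> j a + \<xi> j b"
    and dual: "\<And>j k. j \<in> J \<Longrightarrow> k \<in> J \<Longrightarrow> \<xi> j k = (if j = k then 1 else (0::int))"
    and ker: "\<And>a. a \<in> A \<Longrightarrow> (\<forall>j\<in>J. \<xi> j a = 0) \<longleftrightarrow> \<kappa> a \<in> torsion_part G"
    and f: "\<And>a. a \<in> A \<Longrightarrow> f a \<in> A" "\<And>a. a \<in> A \<Longrightarrow> \<phi> (\<kappa> a) = \<kappa> (f a)"
    and \<phi>: "\<phi> \<in> hom G G"
  shows "torsion_free_trace G \<phi> = (\<Sum>j\<in>J. \<xi> j (f j))"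
proof -
  interpret G: comm_group G by (rule G)
  let ?T = "torsion_part G"
  let ?K = "G Mod ?T"
  note T = G.subgroup_torsion_part
  have normal: "?T \<lhd> G"
    using T by (simp add: G.normal_iff_subgroup)
  interpret K: comm_group ?K
    by (rule G.abelian_FactGroup[OF T])
  define \<pi> where "\<pi> a = ?T #>\<^bsub>G\<^esub> \<kappa> a" for a
  have \<kappa>c: "\<kappa> a \<in> carrier G" if "a \<in> A" for a
    using \<kappa>(1) that by blast
  have carrier: "carrier ?K = \<pi> ` A"
    by (auto simp: FactGroup_def RCOSETS_def \<pi>_def[abs_def] simp flip: \<kappa>(1))
  have \<pi>_add: "\<pi> (a + b) = \<pi> a \<otimes>\<^bsub>?K\<^esub> \<pi> b" if "a \<in> A" "b \<in> A" for a b
    using normal.rcos_sum[OF normal \<kappa>c[OF that(1)] \<kappa>c[OF that(2)]] \<kappa>(2)[OF that]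
    by (simp add: FactGroup_def \<pi>_def)
  have \<pi>_eq: "\<pi> a = \<pi> b \<longleftrightarrow> (\<forall>j\<in>J. \<xi> j a = \<xi> j b)" if ab: "a \<in> A" "b \<in> A" for a b
  proof -
    have d: "a - b \<in> A" using A(2) ab .
    have \<kappa>a: "\<kappa> a = \<kappa> (a - b) \<otimes>\<^bsub>G\<^esub> \<kappa> b"
      using \<kappa>(2)[OF d ab(2)] by simp
    have "\<pi> a = \<pi> b \<longleftrightarrow> \<kappa> a \<in> ?T #>\<^bsub>G\<^esub> \<kappa> b"
      unfolding \<pi>_def
      using G.repr_independence[OF _ \<kappa>c[OF ab(2)] T] G.rcos_self[OF \<kappa>c[OF ab(1)] T] by metis
    also have "\<dots> \<longleftrightarrow> \<kappa> (a - b) \<in> ?T"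
    proof
      assume "\<kappa> a \<in> ?T #>\<^bsub>G\<^esub> \<kappa> b"
      then obtain t where t: "t \<in> ?T" "\<kappa> (a - b) \<otimes>\<^bsub>G\<^esub> \<kappa> b = t \<otimes>\<^bsub>G\<^esub> \<kappa> b"
        unfolding r_coset_def \<kappa>a by blast
      then have "\<kappa> (a - b) = t"
        using \<kappa>c[OF d] \<kappa>c[OF ab(2)] subgroup.mem_carrier[OF T t(1)] by simp
      then show "\<kappa> (a - b) \<in> ?T" using t(1) by simp
    next
      assume "\<kappa> (a - b) \<in> ?T"
      then show "\<kappa> a \<in> ?T #>\<^bsub>G\<^esub> \<kappa> b"
        unfolding r_coset_def \<kappa>a by blast
    qed
    also have "\<dots> \<longleftrightarrow> (\<forall>j\<in>J. \<xi> j (a - b) = 0)"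
      using ker[OF d] by simp
    also have "\<dots> \<longleftrightarrow> (\<forall>j\<in>J. \<xi> j a = \<xi> j b)"
    proof -
      have "\<xi> j a = \<xi> j (a - b) + \<xi> j b" if "j \<in> J" for j
        using \<xi>[OF that d ab(2)] by simp
      then show ?thesis by auto
    qed
    finally show ?thesis .
  qed
  (* the functionals on the quotient that are induced by the dual basis *)
  define \<Xi> where "\<Xi> j k = \<xi> j (SOME a. a \<in> A \<and> \<pi> a = k)" for j k
  have \<Xi>: "\<Xi> j (\<pi> a) = \<xi> j a" if "j \<in> J" "a \<in> A" for j a
  proof -
    have "(SOME a'. a' \<in> A \<and> \<pi> a' = \<pi> a) \<in> A \<and> \<pi> (SOME a'. a' \<in> A \<and> \<pi> a' = \<pi> a) = \<pi> a"
      by (rule someI[of "\<lambda>a'. a' \<in> A \<and> \<pi> a' = \<pi> a" a]) (simp add: that)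
    then show ?thesis
      unfolding \<Xi>_def using \<pi>_eq[of "SOME a'. a' \<in> A \<and> \<pi> a' = \<pi> a" a] that by blast
  qed
  have \<Xi>_mult: "\<Xi> j (x \<otimes>\<^bsub>?K\<^esub> y) = \<Xi> j x + \<Xi> j y"
    if "j \<in> J" and xy: "x \<in> carrier ?K" "y \<in> carrier ?K" for j x y
  proof -
    obtain a b where ab: "a \<in> A" "b \<in> A" "x = \<pi> a" "y = \<pi> b"
      using xy unfolding carrier by blast
    show ?thesis
      unfolding ab(3,4) \<pi>_add[OF ab(1,2), symmetric]
      using \<Xi>[OF \<open>j \<in> J\<close>] \<xi>[OF \<open>j \<in> J\<close> ab(1,2)] A(1)[OF ab(1,2)] ab(1,2) by simp
  qed
  have \<Xi>_inject: "x = y" if xy: "x \<in> carrier ?K" "y \<in> carrier ?K" and eq: "\<And>j. j \<in> J \<Longrightarrow> \<Xi> j x = \<Xi> j y" for x y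
  proof -
    obtain a b where "a \<in> A" "b \<in> A" "x = \<pi> a" "y = \<pi> b"
      using xy unfolding carrier by blast
    then show ?thesis
      using eq \<Xi> \<pi>_eq by simp
  qed
  let ?B = "\<pi> ` J"
  have inj: "inj_on \<pi> J"
  proof (rule inj_onI)
    fix j k assume jk: "j \<in> J" "k \<in> J" "\<pi> j = \<pi> k"
    then have "\<xi> j j = \<xi> j k"
      using \<pi>_eq[of j k] J(2) by blast
    then show "j = k"
      using dual[of j j] dual[of j k] jk by (simp split: if_splits)
  qed
  have B: "finite ?B" "?B \<subseteq> carrier ?K"
    using J carrier by auto
  have \<Xi>_comb: "\<Xi> j (int_comb ?K ?B c) = c (\<pi> j)" if j: "j \<in> J" for j c
  proof -
    have "\<Xi> j (int_comb ?K ?B c) = (\<Sum>b\<in>?B. c b * \<Xi> j b)"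
      by (rule K.additive_int_comb[OF \<Xi>_mult[OF j] B])
    also have "\<dots> = (\<Sum>k\<in>J. c (\<pi> k) * \<xi> j k)"
      using \<Xi>[OF j] J(2) by (subst sum.reindex[OF inj]) (auto intro!: sum.cong)
    also have "\<dots> = (\<Sum>k\<in>J. if j = k then c (\<pi> k) else 0)"
      using dual[OF j] by (intro sum.cong) auto
    finally show ?thesis
      using J(1) j by simp
  qed
  have comb_iff: "x = int_comb ?K ?B c \<longleftrightarrow> (\<forall>j\<in>J. c (\<pi> j) = \<Xi> j x)" if x: "x \<in> carrier ?K" for x c
  proof
    assume "x = int_comb ?K ?B c"
    then show "\<forall>j\<in>J. c (\<pi> j) = \<Xi> j x"
      using \<Xi>_comb by simp
  next
    assume "\<forall>j\<in>J. c (\<pi> j) = \<Xi> j x"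
    then show "x = int_comb ?K ?B c"
      using \<Xi>_comb by (intro \<Xi>_inject[OF x K.int_comb_closed[OF B(2)]]) simp
  qed
  have ex1: "\<exists>!c. c \<in> ?B \<rightarrow>\<^sub>E UNIV \<and> x = int_comb ?K ?B c" if x: "x \<in> carrier ?K" for x
  proof (rule ex1I)
    let ?c = "restrict (\<lambda>b. \<Xi> (inv_into J \<pi> b) x) ?B"
    have "?c (\<pi> j) = \<Xi> j x" if "j \<in> J" for j
      using that inj by simp
    then show "?c \<in> ?B \<rightarrow>\<^sub>E UNIV \<and> x = int_comb ?K ?B ?c"
      using comb_iff[OF x, of ?c] by simp
    fix c assume c: "c \<in> ?B \<rightarrow>\<^sub>E UNIV \<and> x = int_comb ?K ?B c"
    show "c = ?c"
    proof (rule extensionalityI[of _ ?B])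
      fix b assume "b \<in> ?B"
      then obtain j where "j \<in> J" "b = \<pi> j" by blast
      then show "c b = ?c b"
        using comb_iff[OF x, of c] c inj by simp
    qed (use c in \<open>simp_all add: PiE_iff\<close>)
  qed
  have basis: "int_basis ?K ?B"
    unfolding int_basis_def by (intro conjI B ballI ex1)
  let ?\<phi> = "torsion_free_map G \<phi>"
  have \<phi>_\<pi>: "?\<phi> (\<pi> a) = \<pi> (f a)" if "a \<in> A" for a
    using G.torsion_free_map_coset[OF \<phi> \<kappa>c[OF that]] f(2)[OF that] by (simp add: \<pi>_def)
  have \<phi>c: "\<phi> x \<in> carrier G" if "x \<in> carrier G" for x
    using \<phi> that by (auto simp: hom_def)
  have hom: "?\<phi> \<in> hom ?K ?K"
  proof (rule homI)
    fix x assume "x \<in> carrier ?K"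
    then show "?\<phi> x \<in> carrier ?K"
      unfolding carrier using \<phi>_\<pi> f(1) by auto
    fix y assume "y \<in> carrier ?K"
    then obtain a b where ab: "a \<in> A" "b \<in> A" "x = \<pi> a" "y = \<pi> b"
      using \<open>x \<in> carrier ?K\<close> unfolding carrier by blast
    have "\<kappa> (f (a + b)) = \<phi> (\<kappa> a \<otimes>\<^bsub>G\<^esub> \<kappa> b)"
      using f(2)[OF A(1)[OF ab(1,2)]] \<kappa>(2)[OF ab(1,2)] by simp
    also have "\<dots> = \<kappa> (f a + f b)"
      using hom_mult[OF \<phi> \<kappa>c[OF ab(1)] \<kappa>c[OF ab(2)]] f ab(1,2) \<kappa>(2) by simp
    finally have "\<pi> (f (a + b)) = \<pi> (f a + f b)"
      by (simp add: \<pi>_def)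
    then show "?\<phi> (x \<otimes>\<^bsub>?K\<^esub> y) = ?\<phi> x \<otimes>\<^bsub>?K\<^esub> ?\<phi> y"
      unfolding ab(3,4) \<phi>_\<pi>[OF ab(1)] \<phi>_\<pi>[OF ab(2)] \<pi>_add[OF ab(1,2), symmetric]
        \<phi>_\<pi>[OF A(1)[OF ab(1,2)]] \<pi>_add[OF f(1)[OF ab(1)] f(1)[OF ab(2)], symmetric] .
  qed
  have "torsion_free_trace G \<phi> = trace_wrt ?K ?B ?\<phi>"
    unfolding torsion_free_trace_def by (rule K.free_trace_eq[OF hom basis])
  also have "\<dots> = (\<Sum>j\<in>J. int_coords ?K ?B (\<pi> (f j)) (\<pi> j))"
    unfolding trace_wrt_def using \<phi>_\<pi> J(2) by (subst sum.reindex[OF inj]) (auto intro!: sum.cong)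
  also have "\<dots> = (\<Sum>j\<in>J. \<xi> j (f j))"
  proof (rule sum.cong[OF refl])
    fix j assume j: "j \<in> J"
    then have fj: "f j \<in> A" "\<pi> (f j) \<in> carrier ?K"
      using f(1) J(2) carrier by auto
    then have "int_comb ?K ?B (int_coords ?K ?B (\<pi> (f j))) = \<pi> (f j)"
      using int_coords(2)[OF basis] by blast
    then show "int_coords ?K ?B (\<pi> (f j)) (\<pi> j) = \<xi> j (f j)"
      using \<Xi>_comb[OF j, of "int_coords ?K ?B (\<pi> (f j))"] \<Xi>[OF j fj(1)] by simp
  qed
  finally show ?thesis .
qed

lemma mult_homologous_rel_set:
  "homologous_rel_set p X {} a \<otimes>\<^bsub>homology_group (int p) X\<^esub> homologous_rel_set p X {} b =
    homologous_rel_set p X {} (a + b)"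
proof -
  have "\<exists>r s. homologous_rel p X {} a r \<and> homologous_rel p X {} b s \<and> t = r + s"
    if "homologous_rel p X {} (a + b) t" for t
    using that by (intro exI[of _ a] exI[of _ "t - a"]) (auto simp: homologous_rel_def algebra_simps)
  then show ?thesis
    unfolding mult_relative_homology_group using homologous_rel_add by fastforce
qed

lemma pow_homologous_rel_set:
  fixes n :: nat
  assumes "singular_relcycle p X {} a"
  shows "homologous_rel_set p X {} a [^]\<^bsub>homology_group (int p) X\<^esub> n =
    homologous_rel_set p X {} (frag_cmul (int n) a)"
proof (induction n)
  case 0
  have "homologous_rel_set p X {} 0 = singular_relboundary_set p X {}"
    by (simp add: homologous_rel_set_eq_relboundary)
  then show ?case by (simp add: nat_pow_def)
next
  case (Suc n)
  then show ?case
    by (simp add: mult_homologous_rel_set frag_cmul_distrib add.commute)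
qed

section \<open>Fixed points\<close>

text \<open>A monotone self-map \<open>k\<close> of \<open>{..p}\<close> has a fixed point, namely the least \<open>i\<close> with \<open>k i \<le> i\<close>.\<close>

lemma mono_atMost_fixed_point:
  fixes k :: "nat \<Rightarrow> nat"
  assumes k: "\<And>i. i \<le> p \<Longrightarrow> k i \<le> p" and mono: "\<And>i i'. i < i' \<Longrightarrow> i' \<le> p \<Longrightarrow> k i \<le> k i'"
  obtains i where "i \<le> p" "k i = i"
proof -
  define i where "i = (LEAST i. k i \<le> i)"
  have i: "k i \<le> i" "i \<le> p"
    unfolding i_def by (rule LeastI[of _ p], rule k, simp) (rule Least_le, rule k, simp)
  have "k i = i"
  proof (rule ccontr)
    assume "k i \<noteq> i"
    then have "k i < i" using i(1) by simp
    then have "k (k i) \<le> k i" using mono i(2) by blast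
    then have "i \<le> k i" unfolding i_def by (rule Least_le)
    then show False using \<open>k i < i\<close> by simp
  qed
  then show ?thesis using that i(2) by blast
qed

text \<open>For a vertex \<open>y\<close> of \<open>s\<close> take a vertex \<open>(x, y)\<close> of \<open>t\<close>. The vertices of \<open>t\<close> are comparable in the
  product order, so that \<open>y \<mapsto> x\<close> is a monotone self-map of the vertices of \<open>s\<close>.\<close>

lemma graph_simplex_fixed_point:
  assumes X: "finite_t0_space X"
    and s: "s \<in> order_simplices p X" and t: "t \<in> order_simplices q (multi_graph X X F)"
    and fst: "fst ` t ` standard_simplex q \<subseteq> s ` standard_simplex p"
    and snd: "s ` standard_simplex p \<subseteq> snd ` t ` standard_simplex q"
  shows "\<exists>x\<in>topspace X. x \<in> F x"
proof -
  let ?G = "multi_graph X X F"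
  have fin: "finite (topspace X)"
    using X by (simp add: finite_t0_space_def)
  obtain v where v: "s = order_simplex p v" "strict_chain X p v"
    using s by (auto simp: order_simplices_def)
  obtain w where w: "t = order_simplex q w" "strict_chain ?G q w"
    using t by (auto simp: order_simplices_def)
  have le: "spec_le X (fst (w i)) (fst (w j))" "spec_le X (snd (w i)) (snd (w j))" if "i \<le> j" "j \<le> q" for i j
    using strict_chain_le[OF w(2) that]
      spec_le_subtopology_prod[OF fin fin, of _ "fst (w i)" "snd (w i)" "fst (w j)" "snd (w j)"]
    unfolding multi_graph_def prod.collapse by blast+
  have "\<forall>i\<in>{..p}. \<exists>a. a \<le> q \<and> snd (w a) = v i"
    using snd unfolding v(1) w(1) image_order_simplex by (fastforce simp: image_subset_iff image_iff)
  then obtain a where a: "\<And>i. i \<le> p \<Longrightarrow> a i \<le> q \<and> snd (w (a i)) = v i"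
    by (metis atMost_iff)
  have "\<forall>i\<in>{..p}. \<exists>k. k \<le> p \<and> fst (w (a i)) = v k"
    using fst a unfolding v(1) w(1) image_order_simplex by (fastforce simp: image_subset_iff image_iff)
  then obtain k where k: "\<And>i. i \<le> p \<Longrightarrow> k i \<le> p \<and> fst (w (a i)) = v (k i)"
    by (metis atMost_iff)
  have mono: "k i \<le> k i'" if i: "i < i'" "i' \<le> p" for i i'
  proof -
    have v_less: "spec_less X (v i) (v i')"
      using v(2) i by (auto simp: strict_chain_def)
    have "a i \<le> a i'"
    proof (rule ccontr)
      assume "\<not> a i \<le> a i'"
      then have "spec_le X (v i') (v i)"
        using le(2)[of "a i'" "a i"] a[of i] a[of i'] i by simp
      then show False
        using v_less spec_le_antisym[OF X, of "v i" "v i'"] by (auto simp: spec_less_def)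
    qed
    then have "spec_le X (v (k i)) (v (k i'))"
      using le(1)[of "a i" "a i'"] a[of i'] k[of i] k[of i'] i by simp
    moreover have "spec_less X (v (k i')) (v (k i))" if "k i' < k i"
      using that k[of i] i v(2) by (auto simp: strict_chain_def)
    ultimately show ?thesis
      using spec_le_antisym[OF X, of "v (k i)" "v (k i')"] by (force simp: spec_less_def not_less[symmetric])
  qed
  obtain i where i: "i \<le> p" "k i = i"
    using mono_atMost_fixed_point[of p k] k mono by blast
  then have "w (a i) = (v i, v i)"
    using a[of i] k[of i] by (simp add: prod_eq_iff)
  moreover have "w (a i) \<in> topspace ?G"
    using w(2) a[OF i(1)] by (auto simp: strict_chain_def)
  ultimately show ?thesis
    by (auto simp: multi_graph_def)
qed

theorem theorem2:
  fixes X :: "'a topology" and F :: "'a \<Rightarrow> 'a set"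
  assumes "finite_t0_space X"
    and "vietoris_like_multimap X X F"
    and "Lefschetz_number X (\<lambda>i. multi_induced (int i) X X F) \<noteq> 0"
  shows "\<exists>x\<in>topspace X. x \<in> F x"
proof (rule ccontr)
  assume no_fix: "\<not> (\<exists>x\<in>topspace X. x \<in> F x)"
  note X = assms(1)
  have fin: "finite (topspace X)"
    using X by (simp add: finite_t0_space_def)
  let ?G = "multi_graph X X F"
  obtain l m where l: "carried_chain_map X ?G (\<lambda>Q. {z \<in> topspace ?G. fst z \<in> Q}) l"
    and lo: "\<And>p s. s \<in> order_simplices p X \<Longrightarrow> order_chain p ?G (l p s)"
    and m: "carried_chain_map ?G X ((`) snd) m"
    and mo: "\<And>p s. s \<in> order_simplices p ?G \<Longrightarrow> order_chain p X (m p s)"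
    and ind: "\<And>p c. order_chain p X c \<Longrightarrow> chain_boundary p c = 0 \<Longrightarrow>
      multi_induced (int p) X X F (homologous_rel_set p X {} c) =
      homologous_rel_set p X {} (frag_extend (m p) (frag_extend (l p) c))"
    by (rule multi_induced_order_cycle[OF X X assms(2)]) (rule that)
  define S where "S p = order_simplices p X" for p
  define D where "D p s = chain_boundary p (frag_of s)" for p and s :: "(nat \<Rightarrow> real) \<Rightarrow> 'a"
  define f where "f p s = frag_extend (m p) (l p s)" for p s
  have S: "finite (S p)" for p
    unfolding S_def by (rule finite_order_simplices[OF fin])
  have D: "frag_extend (D p) c = chain_boundary p c" for p c
    unfolding D_def[abs_def] chain_boundary_extend[symmetric] by (simp flip: frag_expansion)
  have f_ext: "frag_extend (f p) c = frag_extend (m p) (frag_extend (l p) c)" for p c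
    unfolding f_def[abs_def] frag_extend_frag_extend ..
  have order: "order_chain p X c \<longleftrightarrow> Poly_Mapping.keys c \<subseteq> S p" for p c
    by (simp add: order_chain_def S_def)
  have l_chain: "order_chain p ?G (frag_extend (l p) c)" if "order_chain p X c" for p c
    using that lo by (intro order_chain_extend) (auto simp: order_chain_def[of p X])
  have f_chain: "order_chain p X (f p s)" if "s \<in> S p" for p s
    unfolding f_def
  proof (rule order_chain_extend)
    fix t assume "t \<in> Poly_Mapping.keys (l p s)"
    then have "t \<in> order_simplices p ?G"
      using lo[of s p] that by (auto simp: S_def order_chain_def)
    then show "order_chain p X (m p t)"
      by (rule mo)
  qed
  have f_chain': "order_chain p X (frag_extend (f p) c)" if "order_chain p X c" for p c
    using that f_chain by (intro order_chain_extend) (auto simp: order)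
  have f_bd: "chain_boundary (Suc p) (frag_extend (f (Suc p)) c) = frag_extend (f p) (chain_boundary (Suc p) c)"
    if "order_chain (Suc p) X c" for p c
    unfolding f_ext
    using carried_chain_map_extend[OF m l_chain[OF that]] carried_chain_map_extend[OF l that] by simp
  have f_cycle: "chain_boundary p (frag_extend (f p) c) = 0"
    if "order_chain p X c" "chain_boundary p c = 0" for p c
    using that f_bd[of "p - 1" c] by (cases p) auto
  have D_keys: "Poly_Mapping.keys (D p s) \<subseteq> S (p - 1)" if "s \<in> S p" for p s
    using order_chain_boundary[of p X "frag_of s"] that by (simp add: D_def S_def order_chain_def)
  have "\<exists>N s. N > (0::int) \<and> (\<forall>y. Poly_Mapping.keys (s y) \<subseteq> S p) \<and>
      (\<forall>c. Poly_Mapping.keys c \<subseteq> S p \<longrightarrow>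
        frag_extend (D p) (frag_extend s (frag_extend (D p) c)) = frag_cmul N (frag_extend (D p) c))" for p
    by (rule generalized_inverse[of "S p" "S (p - 1)" "D p", OF S S D_keys]) (assumption, blast)
  then obtain N s where N: "\<And>p. N p > (0::int)" and s: "\<And>p y. Poly_Mapping.keys (s p y) \<subseteq> S p"
    and inv: "\<And>p c. Poly_Mapping.keys c \<subseteq> S p \<Longrightarrow>
      frag_extend (D p) (frag_extend (s p) (frag_extend (D p) c)) = frag_cmul (N p) (frag_extend (D p) c)"
    by metis
  (* the correction term between the traces in degrees p and p - 1 *)
  define a where "a p = frag_trace (S p) (\<lambda>c. frag_extend (f p) (frag_extend (s p) (frag_extend (D p) c)))" for p
  define tr where "tr p = torsion_free_trace (homology_group (int p) X) (multi_induced (int p) X X F)" for p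
  have trace_0: "frag_trace (S p) (frag_extend (f p)) = 0" for p
    unfolding frag_trace_def
  proof (rule sum.neutral, rule ballI)
    fix x assume x: "x \<in> S p"
    have "x \<notin> Poly_Mapping.keys (f p x)"
    proof
      assume "x \<in> Poly_Mapping.keys (f p x)"
      then obtain t where t: "t \<in> Poly_Mapping.keys (l p x)" "x \<in> Poly_Mapping.keys (m p t)"
        unfolding f_def using keys_frag_extend[of "m p" "l p x"] by blast
      have tG: "t \<in> order_simplices p ?G"
        using lo[of x p] x t(1) by (auto simp: S_def order_chain_def)
      have "singular_chain p (subtopology ?G {z \<in> topspace ?G. fst z \<in> x ` standard_simplex p}) (l p x)"
        using l x by (simp add: carried_chain_map_def S_def)
      then have "fst ` t ` standard_simplex p \<subseteq> x ` standard_simplex p"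
        using t(1) unfolding singular_chain_subtopology by blast
      moreover have "singular_chain p (subtopology X (snd ` t ` standard_simplex p)) (m p t)"
        using m tG by (simp add: carried_chain_map_def)
      then have "x ` standard_simplex p \<subseteq> snd ` t ` standard_simplex p"
        using t(2) unfolding singular_chain_subtopology by blast
      ultimately show False
        using graph_simplex_fixed_point[OF X _ tG] x no_fix unfolding S_def by blast
    qed
    then show "Poly_Mapping.lookup (frag_extend (f p) (frag_of x)) x = 0"
      by (simp add: in_keys_iff)
  qed
  have tr: "N p * N (Suc p) * tr p = - N (Suc p) * a p - N p * a (Suc p)" for p
  proof -
    let ?H = "homology_group (int p) X" and ?\<kappa> = "homologous_rel_set p X {}"
    define Z where "Z = {z. Poly_Mapping.keys z \<subseteq> S p \<and> frag_extend (D p) z = 0}"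
    have Z_iff: "z \<in> Z \<longleftrightarrow> order_chain p X z \<and> chain_boundary p z = 0" for z
      by (simp add: Z_def D order)
    have cyc: "singular_relcycle p X {} z" if "z \<in> Z" for z
      using that order_chain_imp_singular_chain[OF fin] by (simp add: Z_iff singular_cycle)
    have DD: "frag_extend (D p) (D (Suc p) y) = 0" if "y \<in> S (Suc p)" for y
      using that chain_boundary_boundary_alt[of p X "frag_of y"] singular_simplex_order_simplices[OF fin]
      by (simp add: D D_def S_def singular_chain_of)
    have DS: "Poly_Mapping.keys (D (Suc p) y) \<subseteq> S p" if "y \<in> S (Suc p)" for y
      using D_keys[OF that] by simp
    obtain J \<xi> v M where M: "M > (0::int)" and J: "finite J" "J \<subseteq> Z"
      and v: "\<And>j z. j \<in> J \<Longrightarrow> z \<in> Z \<Longrightarrow> M * \<xi> j z = (\<Sum>x\<in>S p. Poly_Mapping.lookup z x * v j x)"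
      and dual: "\<And>j k. j \<in> J \<Longrightarrow> k \<in> J \<Longrightarrow> \<xi> j k = (if j = k then 1 else 0)"
      and ker: "\<And>z. z \<in> Z \<Longrightarrow> (\<forall>j\<in>J. \<xi> j z = 0) \<longleftrightarrow>
        (\<exists>M>0. \<exists>y. Poly_Mapping.keys y \<subseteq> S (Suc p) \<and> frag_cmul M z = frag_extend (D (Suc p)) y)"
      by (rule cycles_dual_basis[of "S p" "S (Suc p)" "D (Suc p)" "D p", OF S S DS, folded Z_def])
        (assumption, rule that)
    have f_Z: "frag_extend (f p) z \<in> Z" if "z \<in> Z" for z
      using that f_chain' f_cycle by (simp add: Z_iff)
    have Z_add: "b + c \<in> Z" and Z_diff: "b - c \<in> Z" if "b \<in> Z" "c \<in> Z" for b c
      using that by (simp_all add: Z_iff order_chain_add order_chain_diff chain_boundary_add chain_boundary_diff)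
    have torsion: "(\<forall>j\<in>J. \<xi> j z = 0) \<longleftrightarrow> ?\<kappa> z \<in> torsion_part ?H" if z: "z \<in> Z" for z
    proof -
      have pow: "?\<kappa> z [^]\<^bsub>?H\<^esub> n = \<one>\<^bsub>?H\<^esub> \<longleftrightarrow>
          (\<exists>y. Poly_Mapping.keys y \<subseteq> S (Suc p) \<and> frag_cmul (int n) z = frag_extend (D (Suc p)) y)" for n :: nat
      proof -
        have c: "order_chain p X (frag_cmul (int n) z)"
          using z by (simp add: Z_iff order_chain_cmul)
        have "?\<kappa> z [^]\<^bsub>?H\<^esub> n = \<one>\<^bsub>?H\<^esub> \<longleftrightarrow> singular_relboundary p X {} (frag_cmul (int n) z)"
          unfolding pow_homologous_rel_set[OF cyc[OF z]]
          by (simp add: homologous_rel_set_eq_relboundary)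
        also have "\<dots> \<longleftrightarrow> (\<exists>y. order_chain (Suc p) X y \<and> chain_boundary (Suc p) y = frag_cmul (int n) z)"
          using order_chain_boundary_if_singular_boundary[OF X c] order_chain_imp_singular_chain[OF fin]
          unfolding singular_boundary by metis
        finally show ?thesis
          unfolding D order by metis
      qed
      have "?\<kappa> z \<in> carrier ?H"
        using cyc[OF z] by (simp add: carrier_relative_homology_group)
      then have "?\<kappa> z \<in> torsion_part ?H \<longleftrightarrow> (\<exists>n::nat. n > 0 \<and>
          (\<exists>y. Poly_Mapping.keys y \<subseteq> S (Suc p) \<and> frag_cmul (int n) z = frag_extend (D (Suc p)) y))"
        unfolding torsion_part_def by (simp add: pow del: one_relative_homology_group)
      also have "\<dots> \<longleftrightarrow> (\<exists>M>0. \<exists>y. Poly_Mapping.keys y \<subseteq> S (Suc p) \<and> frag_cmul M z = frag_extend (D (Suc p)) y)"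
        by (metis of_nat_0_less_iff zero_less_imp_eq_int)
      finally show ?thesis
        using ker[OF z] by simp
    qed
    have \<kappa>_image: "?\<kappa> ` Z = carrier ?H"
    proof
      show "?\<kappa> ` Z \<subseteq> carrier ?H"
        using cyc by (auto simp: carrier_relative_homology_group)
      show "carrier ?H \<subseteq> ?\<kappa> ` Z"
      proof
        fix x assume "x \<in> carrier ?H"
        then obtain c where "order_chain p X c" "chain_boundary p c = 0" "x = ?\<kappa> c"
          by (rule homology_class_order_cycle[OF X])
        then show "x \<in> ?\<kappa> ` Z"
          using Z_iff by blast
      qed
    qed
    have ind': "multi_induced (int p) X X F (?\<kappa> z) = ?\<kappa> (frag_extend (f p) z)" if "z \<in> Z" for z
      using ind that by (simp add: Z_iff f_ext)
    have hom: "multi_induced (int p) X X F \<in> hom ?H ?H"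
    proof (rule homI)
      fix x assume "x \<in> carrier ?H"
      then obtain b where b: "b \<in> Z" "x = ?\<kappa> b"
        unfolding \<kappa>_image[symmetric] by blast
      then show "multi_induced (int p) X X F x \<in> carrier ?H"
        using ind' f_Z \<kappa>_image by auto
      fix y assume "y \<in> carrier ?H"
      then obtain c where c: "c \<in> Z" "y = ?\<kappa> c"
        unfolding \<kappa>_image[symmetric] by blast
      show "multi_induced (int p) X X F (x \<otimes>\<^bsub>?H\<^esub> y) =
          multi_induced (int p) X X F x \<otimes>\<^bsub>?H\<^esub> multi_induced (int p) X X F y"
        unfolding b(2) c(2) mult_homologous_rel_set ind'[OF b(1)] ind'[OF c(1)] ind'[OF Z_add[OF b(1) c(1)]]
        by (simp add: frag_extend_add)
    qed
    have \<xi>_add: "\<xi> j (b + c) = \<xi> j b + \<xi> j c" if "j \<in> J" "b \<in> Z" "c \<in> Z" for j b c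
    proof -
      have "M * \<xi> j (b + c) = M * (\<xi> j b + \<xi> j c)"
        using v[OF that(1)] that Z_add[OF that(2,3)]
        by (simp add: distrib_left lookup_add distrib_right sum.distrib)
      then show ?thesis using M by simp
    qed
    have "tr p = (\<Sum>j\<in>J. \<xi> j (frag_extend (f p) j))"
      unfolding tr_def
      by (rule torsion_free_trace_dual_basis[where A = Z and \<kappa> = ?\<kappa> and \<xi> = \<xi>])
        (use abelian_homology_group Z_add Z_diff \<kappa>_image J \<xi>_add dual torsion f_Z ind' hom
          in \<open>simp_all add: mult_homologous_rel_set\<close>)
    moreover have "N p * N (Suc p) * (\<Sum>j\<in>J. \<xi> j (frag_extend (f p) j)) =
        N p * N (Suc p) * frag_trace (S p) (frag_extend (f p)) - N (Suc p) * a p - N p * a (Suc p)"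
      unfolding a_def
    proof (rule homology_trace[where S = "S p" and ?D0.0 = "D p" and v = v,
          folded Z_def])
      show "frag_extend (f p) (D (Suc p) y) = frag_extend (D (Suc p)) (f (Suc p) y)" if "y \<in> S (Suc p)" for y
        using f_bd[of p "frag_of y"] that by (simp add: D S_def) (simp add: D_def)
    qed (use S D_keys DS DD s inv N f_chain f_Z M J v dual ker in \<open>simp_all add: order\<close>)
    ultimately show ?thesis
      by (simp add: trace_0)
  qed
  define \<alpha> where "\<alpha> p = rat_of_int (a p) / rat_of_int (N p)" for p
  have tr_\<alpha>: "rat_of_int (tr p) = - \<alpha> p - \<alpha> (Suc p)" for p
  proof -
    have "rat_of_int (N p * N (Suc p) * tr p) = rat_of_int (- N (Suc p) * a p - N p * a (Suc p))"
      by (simp only: tr)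
    then show ?thesis
      using N[of p] N[of "Suc p"] by (simp add: \<alpha>_def field_simps)
  qed
  let ?n = "card (topspace X)"
  have high: "\<alpha> p = 0" if "?n \<le> p" for p
    using order_simplices_high_degree[OF fin that] by (simp add: \<alpha>_def a_def S_def frag_trace_def)
  have "\<alpha> 0 = 0"
    by (simp add: \<alpha>_def a_def D frag_trace_def)
  have telescope: "(\<Sum>p<k. (-1) ^ p * (- \<alpha> p - \<alpha> (Suc p))) = (-1) ^ k * \<alpha> k - \<alpha> 0" for k
    by (induction k) (simp_all add: algebra_simps)
  have "Lefschetz_number X (\<lambda>i. multi_induced (int i) X X F) = (\<Sum>p<?n. (-1) ^ p * tr p)"
    unfolding Lefschetz_number_def tr_def[symmetric]
  proof (rule Sum_any.expand_superset)
    have "tr p = 0" if "?n \<le> p" for p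
      using tr_\<alpha>[of p] high[of p] high[of "Suc p"] that by simp
    then show "{p. (-1) ^ p * tr p \<noteq> 0} \<subseteq> {..<?n}"
      using not_le_imp_less by auto
  qed simp
  also have "\<dots> = 0"
  proof -
    have "rat_of_int (\<Sum>p<?n. (-1) ^ p * tr p) = 0"
      using telescope[of ?n] high[of ?n] \<open>\<alpha> 0 = 0\<close> by (simp add: tr_\<alpha>)
    then show ?thesis
      by (simp only: of_int_eq_0_iff)
  qed
  finally show False
    using assms(3) by contradiction
qed

end
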